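(* Let $d,n\ge1$ be integers. The modified hierarchy $\tilde H_m$ ($m\ge2$) defined in the context is complete, i.e. every non-simulable POVM is detected for large enough $m$: for every $d$-dimensional POVM $\mathcal M=\{M_0,\dots,M_{n-1}\}$ with $n$ effects such that $\mathcal M\notin\mathcal P(d,n)$, one has $\tilde H_m(\mathcal M)<1$ for all sufficiently large $m$.
   Context: A $d$-dimensional POVM with $n$ effects is a tuple $\mathcal M=\{M_0,\dots,M_{n-1}\}$ of positive semidefinite complex $d\times d$ matrices with $\sum_{i=0}^{n-1} M_i=\mathbb I_d$. It is projective if $M_iM_j=\delta_{ij}M_i$ for all $i,j$ (zero effects are allowed). The set $\mathcal P(d,n)$ of (projectively) simulable POVMs is the convex hull of the set of projective $d$-dimensional POVMs with $n$ effects, i.e. $\mathcal M\in\mathcal P(d,n)$ iff $M_i=\sum_{k=1}^N p_kP_i^k$ for all $i$, for some $N$, some probability distribution $(p_k)$ and some projective POVMs $\{P_0^k,\dots,P_{n-1}^k\}$. For $0\le t\le 1$ put $\Phi_t(M_i)=tM_i+(1-t)\frac{\mathrm{Tr}(M_i)}{d}\mathbb I_d$. For $m\ge2$ and $1\le a<b\le m$, let $V_{(ab)}$ be the unitary on $(\mathbb C^d)^{\otimes m}$ swapping tensor factors $a$ and $b$, and let $\mathrm{Tr}_a$ be the partial trace over factor $a$. $\tilde H_m(\mathcal M)$ is the maximum of $t\in[0,1]$ such that there exist $d^m\times d^m$ complex matrices $R_{i_1\dots i_m}$ acting on $(\mathbb C^d)^{\otimes m}$, indexed by $(i_1,\dots,i_m)\in\{0,\dots,n-1\}^m$,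 and positive semidefinite matrices $\tilde R_{i_1\dots i_{m-1}}$ acting on $(\mathbb C^d)^{\otimes (m-1)}$, with: (1) $R_{i_1\dots i_m}\ge 0$ (positive semidefinite) for all indices; (2) for every $j\in\{1,\dots,m\}$ and every $i_j\in\{0,\dots,n-1\}$, the sum of $R_{i_1\dots i_m}$ over all indices other than $i_j$ equals $\mathbb I\otimes\cdots\otimes\Phi_t(M_{i_j})\otimes\cdots\otimes\mathbb I$, with $\Phi_t(M_{i_j})$ in the $j$-th tensor factor; (3) $\mathrm{Tr}_a(V_{(ab)}R_{i_1\dots i_m})=0$ for all $a<b$ and all $(i_1,\dots,i_m)$ with $i_a\ne i_b$; (4) $V_{(ab)}R_{i_1\dots i_a\dots i_b\dots i_m}V_{(ab)}=R_{i_1\dots i_b\dots i_a\dots i_m}$ (indices at positions $a$ and $b$ exchanged) for all $a<b$ and all indices; (5) $\sum_{i_m=0}^{n-1}R_{i_1\dots i_{m-1}i_m}=\tilde R_{i_1\dots i_{m-1}}\otimes\mathbb I_d$ for all $i_1,\dots,i_{m-1}$. *)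

theory Defs
  imports "Jordan_Normal_Form.Conjugate" "Jordan_Normal_Form.Matrix"
begin

text \<open>Over the complex numbers the quadratic-form condition already forces the matrix to be
  Hermitian: \<open>0 \<le> z\<close> in the order on \<^typ>\<open>complex\<close> says that \<open>z\<close> is real and nonnegative.\<close>

definition psd :: "nat \<Rightarrow> complex mat \<Rightarrow> bool" where
  "psd N A \<longleftrightarrow> A \<in> carrier_mat N N \<and> (\<forall>v \<in> carrier_vec N. 0 \<le> (A *\<^sub>v v) \<bullet>c v)"

definition mat_trace :: "complex mat \<Rightarrow> complex" where
  "mat_trace A = (\<Sum>k<dim_row A. A $$ (k, k))"

text \<open>The type of matrices carries no global zero, so the big sum takes the dimension as a
  parameter.\<close>

definition msum :: "nat \<Rightarrow> ('i \<Rightarrow> complex mat) \<Rightarrow> 'i set \<Rightarrow> complex mat" where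
  "msum N f I = mat N N (\<lambda>(x, y). \<Sum>i\<in>I. f i $$ (x, y))"

text \<open>A tuple \<open>(M\<^sub>0, \<dots>, M\<^sub>n\<^sub>-\<^sub>1)\<close> is a function on \<^typ>\<open>nat\<close> of which only the values below \<open>n\<close>
  matter.\<close>

definition povm :: "nat \<Rightarrow> nat \<Rightarrow> (nat \<Rightarrow> complex mat) \<Rightarrow> bool" where
  "povm d n M \<longleftrightarrow> (\<forall>i<n. psd d (M i)) \<and> msum d M {..<n} = 1\<^sub>m d"

definition projective_povm :: "nat \<Rightarrow> nat \<Rightarrow> (nat \<Rightarrow> complex mat) \<Rightarrow> bool" where
  "projective_povm d n M \<longleftrightarrow> povm d n M \<and>
     (\<forall>i<n. \<forall>j<n. M i * M j = (if i = j then M i else 0\<^sub>m d d))"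

definition simulable :: "nat \<Rightarrow> nat \<Rightarrow> (nat \<Rightarrow> complex mat) \<Rightarrow> bool" where
  "simulable d n M \<longleftrightarrow> (\<exists>(N::nat) (p :: nat \<Rightarrow> real) P.
     (\<forall>k<N. 0 \<le> p k) \<and> (\<Sum>k<N. p k) = 1 \<and>
     (\<forall>k<N. projective_povm d n (P k)) \<and>
     (\<forall>i<n. M i = msum d (\<lambda>k. complex_of_real (p k) \<cdot>\<^sub>m P k i) {..<N}))"

definition depolarise :: "nat \<Rightarrow> real \<Rightarrow> complex mat \<Rightarrow> complex mat" where
  "depolarise d t A = complex_of_real t \<cdot>\<^sub>m A
     + (complex_of_real (1 - t) * mat_trace A / of_nat d) \<cdot>\<^sub>m 1\<^sub>m d"

definition kron :: "complex mat \<Rightarrow> complex mat \<Rightarrow> complex mat" where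
  "kron A B = mat (dim_row A * dim_row B) (dim_col A * dim_col B)
     (\<lambda>(x, y). A $$ (x div dim_row B, y div dim_col B) * B $$ (x mod dim_row B, y mod dim_col B))"

text \<open>Tensor factors are numbered from \<open>0\<close>. The basis vector \<open>e\<^bsub>x\<^sub>0\<^esub> \<otimes> \<dots> \<otimes> e\<^bsub>x\<^sub>m\<^sub>-\<^sub>1\<^esub>\<close> of the \<open>m\<close>-fold tensor
  power has the index with base-\<open>d\<close> digits \<open>x\<^sub>0, \<dots>, x\<^sub>m\<^sub>-\<^sub>1\<close>, the most significant digit first;
  this is the ordering that \<^const>\<open>kron\<close> induces.\<close>

definition enc :: "nat \<Rightarrow> nat list \<Rightarrow> nat" where
  "enc d xs = horner_sum id d (rev xs)"

definition dec :: "nat \<Rightarrow> nat \<Rightarrow> nat \<Rightarrow> nat list" where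
  "dec d m x = map (\<lambda>k. x div d ^ (m - 1 - k) mod d) [0..<m]"

definition swap_list :: "nat \<Rightarrow> nat \<Rightarrow> 'a list \<Rightarrow> 'a list" where
  "swap_list a b xs = xs[a := xs ! b, b := xs ! a]"

definition insert_at :: "nat \<Rightarrow> 'a \<Rightarrow> 'a list \<Rightarrow> 'a list" where
  "insert_at a r xs = take a xs @ r # drop a xs"

definition at_factor :: "nat \<Rightarrow> nat \<Rightarrow> nat \<Rightarrow> complex mat \<Rightarrow> complex mat" where
  "at_factor d m j A = kron (kron (1\<^sub>m (d ^ j)) A) (1\<^sub>m (d ^ (m - 1 - j)))"

definition swap_op :: "nat \<Rightarrow> nat \<Rightarrow> nat \<Rightarrow> nat \<Rightarrow> complex mat" where
  "swap_op d m a b = mat (d ^ m) (d ^ m)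
     (\<lambda>(x, y). if dec d m x = swap_list a b (dec d m y) then 1 else 0)"

definition ptrace :: "nat \<Rightarrow> nat \<Rightarrow> nat \<Rightarrow> complex mat \<Rightarrow> complex mat" where
  "ptrace d m a A = mat (d ^ (m - 1)) (d ^ (m - 1))
     (\<lambda>(x, y). \<Sum>r<d. A $$ (enc d (insert_at a r (dec d (m - 1) x)),
                            enc d (insert_at a r (dec d (m - 1) y))))"

definition multi_indices :: "nat \<Rightarrow> nat \<Rightarrow> nat list set" where
  "multi_indices n m = {is. set is \<subseteq> {..<n} \<and> length is = m}"

definition hierarchy_feasible ::
    "nat \<Rightarrow> nat \<Rightarrow> nat \<Rightarrow> (nat \<Rightarrow> complex mat) \<Rightarrow> real \<Rightarrow> bool" where
  "hierarchy_feasible d n m M t \<longleftrightarrow>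
    (\<exists>(R :: nat list \<Rightarrow> complex mat) (R' :: nat list \<Rightarrow> complex mat).
      (\<forall>is \<in> multi_indices n m. psd (d ^ m) (R is)) \<and>
      (\<forall>is \<in> multi_indices n (m - 1). psd (d ^ (m - 1)) (R' is)) \<and>
      (\<forall>j<m. \<forall>i<n. msum (d ^ m) R {is \<in> multi_indices n m. is ! j = i}
                     = at_factor d m j (depolarise d t (M i))) \<and>
      (\<forall>is \<in> multi_indices n m. \<forall>a b. a < b \<and> b < m \<and> is ! a \<noteq> is ! b \<longrightarrow>
         ptrace d m a (swap_op d m a b * R is) = 0\<^sub>m (d ^ (m - 1)) (d ^ (m - 1))) \<and>
      (\<forall>is \<in> multi_indices n m. \<forall>a b. a < b \<and> b < m \<longrightarrow>
         swap_op d m a b * R is * swap_op d m a b = R (swap_list a b is)) \<and>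
      (\<forall>is \<in> multi_indices n (m - 1).
         msum (d ^ m) (\<lambda>i. R (is @ [i])) {..<n} = kron (R' is) (1\<^sub>m d)))"

text \<open>The maximum exists for every POVM: \<open>t = 0\<close> is feasible (take \<open>R\<^bsub>i\<dots>i\<^esub> = Tr(M\<^sub>i)/d \<cdot> I\<close>
  and all other \<open>R = 0\<close>), and the feasible set is compact.\<close>

definition hierarchy_value :: "nat \<Rightarrow> nat \<Rightarrow> nat \<Rightarrow> (nat \<Rightarrow> complex mat) \<Rightarrow> real" where
  "hierarchy_value d n m M =
     (GREATEST t. 0 \<le> t \<and> t \<le> 1 \<and> hierarchy_feasible d n m M t)"

end

theory Submission
  imports Defs "HOL-Analysis.Topology_Euclidean_Space"
begin

text \<open>Suppose \<open>t = 1\<close> is feasible for arbitrarily large \<open>m\<close>. Measuring the factors of a feasible point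
  with a fixed informationally complete POVM gives an exchangeable probability on words, and
  condition (5) makes its marginals consistent. Conditioning on the outcomes of \<open>k\<close> factors decomposes
  \<open>M\<close> into a mixture of POVMs \<open>B\<^sup>z\<close>. The mean squared norm of the conditional distribution of one
  further letter increases with \<open>k\<close> and is bounded by \<open>1\<close>, so for some \<open>k\<close> two further letters are
  nearly independent given \<open>z\<close>. Condition (3) says that the swap has expectation zero on two factors with
  different outcomes; by near independence the mean of the \<open>Tr (B\<^sup>z\<^sub>i B\<^sup>z\<^sub>j)\<close>, \<open>i \<noteq> j\<close>, is of order
  \<open>m\<close> to the power \<open>- 1 / 2\<close>. Caratheodory's theorem bounds the number of terms, and in a limit point
  these traces vanish: the terms are projective.\<close>

section \<open>Words and exchangeable weights\<close>

text \<open>Feasible points for different \<open>m\<close> are unrelated, so there is no infinite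
  exchangeable family to which a de Finetti theorem could be applied; the estimate has to be
  quantitative for one finite \<open>m\<close>. Measuring first replaces operators by real weights
  on \<open>4 * n * d ^ 2\<close> letters, a number independent of \<open>m\<close>, where near
  independence is a matter of ordinary sums. Matrix entries are fixed linear combinations of these
  weights, so the way back costs only a constant, \<open>(2 * real d ^ 2)\<^sup>2\<close> for two
  factors. The mixtures for different \<open>m\<close> have unrelated index sets of unbounded size;
  they can be compared only after a reduction to a common number of terms, and the mean defect is
  carried through this reduction as one more coordinate. Every mixture averages to \<open>M\<close>
  exactly, only projectivity is approximate, so nothing is lost in the limit. That a value not below
  \<open>1\<close> yields a feasible point at \<open>t = 1\<close> is a separate matter:
  \<open>GREATEST\<close> carries information only once the maximum is known to be attained.\<close>

definition words :: "'a set \<Rightarrow> nat \<Rightarrow> 'a list set" where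
  "words A k = {z. set z \<subseteq> A \<and> length z = k}"

lemma finite_words [simp]: "finite A \<Longrightarrow> finite (words A k)"
  unfolding words_def by (rule finite_lists_length_eq)

lemma words_0 [simp]: "words A 0 = {[]}"
  by (auto simp: words_def)

lemma words_length: "z \<in> words A k \<Longrightarrow> length z = k"
  by (simp add: words_def)

lemma Cons_in_words [simp]: "a # z \<in> words A (Suc k) \<longleftrightarrow> a \<in> A \<and> z \<in> words A k"
  by (auto simp: words_def)

lemma nth_word: "x \<in> words A k \<Longrightarrow> j < k \<Longrightarrow> x ! j \<in> A"
  unfolding words_def using nth_mem[of j x] by blast

lemma hd_word: "x \<in> words A k \<Longrightarrow> 0 < k \<Longrightarrow> hd x \<in> A"
  using nth_word[of x A k 0] by (cases x) (auto simp: words_def)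

lemma append_in_words: "x \<in> words A j \<Longrightarrow> y \<in> words A k \<Longrightarrow> x @ y \<in> words A (j + k)"
  by (auto simp: words_def)

lemma words_Suc: "words A (Suc k) = (\<lambda>(a, z). a # z) ` (A \<times> words A k)"
  by (auto simp: words_def image_iff length_Suc_conv)

lemma words_Suc_snoc: "words A (Suc k) = (\<lambda>(z, a). z @ [a]) ` (words A k \<times> A)"
proof (intro equalityI subsetI)
  fix x assume "x \<in> words A (Suc k)"
  then have "x = butlast x @ [last x]" "butlast x \<in> words A k" "last x \<in> A"
    by (auto simp: words_def in_set_butlastD intro!: append_butlast_last_id[symmetric]
        dest: in_set_butlastD)
      (metis last_in_set list.size(3) nat.distinct(1) subsetD)
  then show "x \<in> (\<lambda>(z, a). z @ [a]) ` (words A k \<times> A)"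
    by (auto simp: image_iff)
qed (auto simp: words_def)

lemma sum_words_Suc: "(\<Sum>z\<in>words A (Suc k). g z) = (\<Sum>a\<in>A. \<Sum>z\<in>words A k. g (a # z))"
proof -
  have "inj_on (\<lambda>(a, z). a # z) (A \<times> words A k)" by (auto simp: inj_on_def)
  then show ?thesis
    by (simp add: words_Suc sum.reindex sum.cartesian_product case_prod_unfold)
qed

lemma sum_words_snoc: "(\<Sum>z\<in>words A (Suc k). g z) = (\<Sum>z\<in>words A k. \<Sum>a\<in>A. g (z @ [a]))"
proof -
  have "inj_on (\<lambda>(z, a). z @ [a]) (words A k \<times> A)" by (auto simp: inj_on_def)
  then show ?thesis
    by (simp add: words_Suc_snoc sum.reindex sum.cartesian_product case_prod_unfold)
qed

text \<open>A consistent family of laws on words of every length up to \<open>m\<close>. New letters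
  are prepended, the tail \<open>z\<close> is what is conditioned on, and both marginalisation and
  exchange act at the head.\<close>

locale exchangeable_weights =
  fixes A :: "'a set" and m :: nat and p :: "'a list \<Rightarrow> real"
  assumes fin: "finite A"
    and nonneg: "z \<in> words A k \<Longrightarrow> k \<le> m \<Longrightarrow> 0 \<le> p z"
    and marginal: "z \<in> words A k \<Longrightarrow> k < m \<Longrightarrow> (\<Sum>a\<in>A. p (a # z)) = p z"
    and exchange: "z \<in> words A k \<Longrightarrow> k + 2 \<le> m \<Longrightarrow> a \<in> A \<Longrightarrow> b \<in> A \<Longrightarrow> p (a # b # z) = p (b # a # z)"
    and normalised: "p [] = 1"
begin

lemma total: "k \<le> m \<Longrightarrow> (\<Sum>z\<in>words A k. p z) = 1"
proof (induction k)
  case (Suc k)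
  have "(\<Sum>z\<in>words A (Suc k). p z) = (\<Sum>z\<in>words A k. \<Sum>a\<in>A. p (a # z))"
    unfolding sum_words_Suc by (rule sum.swap)
  also have "\<dots> = (\<Sum>z\<in>words A k. p z)"
    using Suc by (intro sum.cong) (auto intro: marginal)
  finally show ?case using Suc by simp
qed (simp add: normalised)

lemma Cons_le: 
  assumes "z \<in> words A k" "k < m" "a \<in> A" shows "p (a # z) \<le> p z"
proof -
  have "p (a # z) \<le> (\<Sum>a\<in>A. p (a # z))"
    using assms fin by (intro member_le_sum) (auto intro: nonneg[of _ "Suc k"])
  then show ?thesis using marginal assms by simp
qed

text \<open>Makes the convention \<open>x / 0 = 0\<close> harmless in the quotients below: a
  numerator vanishes together with the probability that divides it.\<close>

lemma Cons_zero: "z \<in> words A k \<Longrightarrow> k < m \<Longrightarrow> a \<in> A \<Longrightarrow> p z = 0 \<Longrightarrow> p (a # z) = 0"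
  using Cons_le[of z k a] nonneg[of "a # z" "Suc k"] by simp

text \<open>Only the head can be summed out, so each letter \<open>b\<close> of the conditioning is
  exchanged with \<open>a\<close> and then removed.\<close>

lemma total_Cons:
  assumes "k < m" "a \<in> A"
  shows "(\<Sum>z\<in>words A k. p (a # z)) = p [a]"
  using assms(1)
proof (induction k)
  case (Suc k)
  have "(\<Sum>z\<in>words A (Suc k). p (a # z)) = (\<Sum>z\<in>words A k. \<Sum>b\<in>A. p (b # a # z))"
    unfolding sum_words_Suc using Suc.prems assms(2)
    by (subst sum.swap) (auto intro!: sum.cong exchange)
  also have "\<dots> = (\<Sum>z\<in>words A k. p (a # z))"
    using Suc.prems assms(2) by (intro sum.cong marginal[of _ "Suc k"]) auto
  finally show ?case using Suc by simp
qed simp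

text \<open>This is \<open>p z\<close> times the conditional covariance, given \<open>z\<close>, of
  the events that two further letters are \<open>a\<close> and \<open>b\<close>.\<close>

definition corr :: "'a \<Rightarrow> 'a \<Rightarrow> 'a list \<Rightarrow> real" where
  "corr a b z = p (a # b # z) - p (a # z) * p (b # z) / p z"

text \<open>The factor \<open>p z\<close> of the mean has been cancelled against one of the two
  denominators of the squared conditional probability.\<close>

definition energy :: "nat \<Rightarrow> real" where
  "energy k = (\<Sum>z\<in>words A k. \<Sum>a\<in>A. (p (a # z))\<^sup>2 / p z)"

lemma energy_nonneg: "k < m \<Longrightarrow> 0 \<le> energy k"
  unfolding energy_def by (intro sum_nonneg divide_nonneg_nonneg) (auto intro: nonneg)

lemma energy_le_1: assumes "k < m" shows "energy k \<le> 1"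
proof -
  have "energy k \<le> (\<Sum>z\<in>words A k. \<Sum>a\<in>A. p (a # z))"
    unfolding energy_def
  proof (intro sum_mono)
    fix z a assume za: "z \<in> words A k" "a \<in> A"
    then have "p (a # z) \<le> p z" "0 \<le> p (a # z)" 
      using Cons_le assms nonneg[of "a # z" "Suc k"] by auto
    then show "(p (a # z))\<^sup>2 / p z \<le> p (a # z)"
      by (cases "p z = 0") (auto simp: power2_eq_square divide_le_eq intro: mult_left_mono)
  qed
  also have "\<dots> = (\<Sum>z\<in>words A k. p z)"
    using assms by (intro sum.cong) (auto intro: marginal)
  finally show ?thesis using total[of k] assms by simp
qed

text \<open>Conditioning on one more letter increases the energy by a variance, as for a martingale.\<close>

lemma energy_increment:
  assumes "k + 2 \<le> m"
  shows "energy (Suc k) - energy k = (\<Sum>z\<in>words A k. \<Sum>a\<in>A. \<Sum>b\<in>A. (corr a b z)\<^sup>2 / p (b # z))"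
proof -
  have "(\<Sum>b\<in>A. (corr a b z)\<^sup>2 / p (b # z)) = (\<Sum>b\<in>A. (p (a # b # z))\<^sup>2 / p (b # z)) - (p (a # z))\<^sup>2 / p z"
    if z: "z \<in> words A k" and a: "a \<in> A" for z a
  proof -
    \<comment> \<open>The conditional probability of \<open>a\<close> given \<open>z\<close>. The
      square is expanded so that, after exchange, the sums over \<open>b\<close> of the last two
      terms are marginals.\<close>
    define t where "t = p (a # z) / p z"
    have "(corr a b z)\<^sup>2 / p (b # z) = (p (a # b # z))\<^sup>2 / p (b # z) - 2 * t * p (b # a # z) + t\<^sup>2 * p (b # z)"
      if b: "b \<in> A" for b
    proof (cases "p (b # z) = 0")
      case True
      have "p (a # b # z) = 0" using Cons_zero[of "b # z" "Suc k" a] True a b z assms by simp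
      then show ?thesis using True exchange[of z k b a] a b z assms by simp
    next
      case False
      have eq: "p (a # b # z) = p (b # a # z)" using exchange[of z k b a] a b z assms by simp
      have corr: "corr a b z = p (b # a # z) - t * p (b # z)" by (simp add: corr_def t_def eq)
      show ?thesis unfolding eq corr using False
        by (simp add: power2_eq_square field_simps)
    qed
    then have "(\<Sum>b\<in>A. (corr a b z)\<^sup>2 / p (b # z)) =
        (\<Sum>b\<in>A. (p (a # b # z))\<^sup>2 / p (b # z)) - 2 * t * (\<Sum>b\<in>A. p (b # a # z)) + t\<^sup>2 * (\<Sum>b\<in>A. p (b # z))"
      by (simp add: sum.distrib sum_subtractf sum_distrib_left)
    also have "(\<Sum>b\<in>A. p (b # a # z)) = p (a # z)"
      using marginal[of "a # z" "Suc k"] a z assms by simp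
    also have "(\<Sum>b\<in>A. p (b # z)) = p z"
      using marginal[of z k] z assms by simp
    finally show ?thesis
      by (cases "p z = 0") (simp_all add: t_def power2_eq_square)
  qed
  then have "(\<Sum>z\<in>words A k. \<Sum>a\<in>A. \<Sum>b\<in>A. (corr a b z)\<^sup>2 / p (b # z))
      = (\<Sum>z\<in>words A k. \<Sum>a\<in>A. \<Sum>b\<in>A. (p (a # b # z))\<^sup>2 / p (b # z)) - energy k"
    by (simp add: energy_def sum_subtractf)
  also have "(\<Sum>z\<in>words A k. \<Sum>a\<in>A. \<Sum>b\<in>A. (p (a # b # z))\<^sup>2 / p (b # z)) = energy (Suc k)"
    unfolding energy_def sum_words_Suc
    by (rule trans[OF sum.cong[OF refl sum.swap] sum.swap])
  finally show ?thesis by simp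
qed

text \<open>The \<open>m - 1\<close> increments telescope to at most \<open>1\<close>, so they
  cannot all exceed \<open>1 / (m - 1)\<close>.\<close>

lemma exists_small_increment:
  assumes "2 \<le> m"
  shows "\<exists>k. k + 2 \<le> m \<and> energy (Suc k) - energy k \<le> 1 / real (m - 1)"
proof (rule ccontr)
  assume large: "\<not> ?thesis"
  have "(\<Sum>k<m - 1. 1 / real (m - 1)) < (\<Sum>k<m - 1. energy (Suc k) - energy k)"
  proof (intro sum_strict_mono)
    fix k assume "k \<in> {..<m - 1}"
    then have "k + 2 \<le> m" by auto
    with large show "1 / real (m - 1) < energy (Suc k) - energy k"
      using not_le by blast
  qed (use assms in \<open>auto simp: lessThan_empty_iff\<close>)
  also have "\<dots> = energy (m - 1) - energy 0"
    by (rule sum_lessThan_telescope)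
  also have "\<dots> \<le> 1" using energy_le_1[of "m - 1"] energy_nonneg[of 0] assms by simp
  finally show False using assms by simp
qed

text \<open>Passes from squares to absolute values by \<open>x \<le> q + x\<^sup>2 / q\<close> with
  \<open>q = c * p (b # z)\<close>. The terms \<open>q\<close> add up to \<open>c * card A\<close>,
  the others to the energy increment divided by \<open>c\<close>. The two parts balance for
  \<open>c\<close> of order \<open>m\<close> to the power \<open>- 1 / 2\<close>; \<open>c\<close>
  stays free so that it can be tuned to a prescribed accuracy.\<close>

lemma exists_small_corr:
  fixes c :: real
  assumes "2 \<le> m" "0 < c"
  shows "\<exists>k. k + 2 \<le> m \<and> (\<Sum>z\<in>words A k. \<Sum>a\<in>A. \<Sum>b\<in>A. \<bar>corr a b z\<bar>)
           \<le> c * card A + 1 / (c * real (m - 1))"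
proof -
  obtain k where k: "k + 2 \<le> m" "energy (Suc k) - energy k \<le> 1 / real (m - 1)"
    using exists_small_increment assms by blast
  have "\<bar>corr a b z\<bar> \<le> c * p (b # z) + (corr a b z)\<^sup>2 / p (b # z) / c"
    if "z \<in> words A k" "a \<in> A" "b \<in> A" for z a b
  proof (cases "p (b # z) = 0")
    case True
    then show ?thesis using Cons_zero[of "b # z" "Suc k" a] that k by (simp add: corr_def)
  next
    case False
    then have pos: "0 < p (b # z)" using nonneg[of "b # z" "Suc k"] that k by simp
    define x q where "x = \<bar>corr a b z\<bar>" and "q = c * p (b # z)"
    have "0 < q" using pos assms by (simp add: q_def)
    have "0 \<le> (x - q)\<^sup>2 + x * q" using \<open>0 < q\<close> by (simp add: x_def)
    then have "x * q \<le> q\<^sup>2 + x\<^sup>2" using \<open>0 < q\<close>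
      by (auto simp: power2_eq_square algebra_simps)
    then have "x \<le> q + x\<^sup>2 / q" using \<open>0 < q\<close>
      by (simp add: field_simps power2_eq_square)
    then show ?thesis by (simp add: x_def q_def mult.commute)
  qed
  then have "(\<Sum>z\<in>words A k. \<Sum>a\<in>A. \<Sum>b\<in>A. \<bar>corr a b z\<bar>)
     \<le> (\<Sum>z\<in>words A k. \<Sum>a\<in>A. \<Sum>b\<in>A. c * p (b # z) + (corr a b z)\<^sup>2 / p (b # z) / c)"
    by (intro sum_mono) auto
  also have "\<dots> = c * card A * (\<Sum>z\<in>words A k. \<Sum>b\<in>A. p (b # z)) + (energy (Suc k) - energy k) / c"
    by (simp add: energy_increment[OF k(1)] sum.distrib sum_distrib_left sum_divide_distrib mult_ac)
  also have "(\<Sum>z\<in>words A k. \<Sum>b\<in>A. p (b # z)) = 1"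
    using total[of "Suc k"] k unfolding sum_words_Suc by (subst sum.swap) simp
  also have "(energy (Suc k) - energy k) / c \<le> 1 / real (m - 1) / c"
    using k assms by (intro divide_right_mono) auto
  finally show ?thesis using k by (auto simp: mult.commute)
qed

end

section \<open>Conic combinations and convergent subsequences\<close>

text \<open>Gaussian elimination: the functions in \<open>F\<close> are homogeneous equations, the
  elements of \<open>S\<close> are the unknowns, and there are more unknowns than equations.\<close>

lemma nontrivial_linear_relation:
  fixes F :: "('k \<Rightarrow> real) set"
  assumes "finite F" "finite S" "card F \<le> n" "n < card S"
  shows "\<exists>l. (\<exists>k\<in>S. l k \<noteq> 0) \<and> (\<forall>g\<in>F. (\<Sum>k\<in>S. l k * g k) = 0)"
  using assms
proof (induction n arbitrary: F S)
  case 0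
  then have "F = {}" "S \<noteq> {}" by auto
  then show ?case by (intro exI[of _ "\<lambda>_. 1"]) auto
next
  case (Suc n)
  show ?case
  proof (cases "\<exists>g\<in>F. \<exists>j\<in>S. g j \<noteq> 0")
    case False
    have "S \<noteq> {}" using Suc.prems by auto
    then show ?thesis using False by (intro exI[of _ "\<lambda>_. 1"]) (auto intro!: sum.neutral)
  next
    case True
    then obtain g j where g: "g \<in> F" "j \<in> S" "g j \<noteq> 0" by blast
    \<comment> \<open>Subtracting multiples of the pivot equation \<open>g\<close> removes the
      unknown \<open>j\<close>. Distinct equations may become equal, so the induction carries an
      upper bound on \<open>card F\<close> and not its exact value.\<close>
    define F' where "F' = (\<lambda>h k. h k - h j / g j * g k) ` (F - {g})"
    have "card F' \<le> card (F - {g})" unfolding F'_def using Suc.prems by (intro card_image_le) auto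
    then have "card F' \<le> n" "finite F'" using Suc.prems g by (auto simp: F'_def)
    moreover have "n < card (S - {j})" using Suc.prems g by auto
    ultimately obtain l where l: "\<exists>k\<in>S - {j}. l k \<noteq> 0" "\<forall>g\<in>F'. (\<Sum>k\<in>S - {j}. l k * g k) = 0"
      using Suc.IH[of F' "S - {j}"] Suc.prems by auto
    \<comment> \<open>The unknown \<open>j\<close> is solved from equation \<open>g\<close>; by
      \<open>split\<close> the other equations then reduce to those in \<open>F'\<close>.\<close>
    define l' where "l' = l(j := - (\<Sum>k\<in>S - {j}. l k * g k) / g j)"
    have split: "(\<Sum>k\<in>S. l' k * h k) = (\<Sum>k\<in>S - {j}. l k * h k) - (\<Sum>k\<in>S - {j}. l k * g k) * (h j / g j)" for h
      using Suc.prems g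
      by (subst sum.remove[of S j]) (auto simp: l'_def intro!: sum.cong)
    have "(\<Sum>k\<in>S. l' k * h k) = 0" if h: "h \<in> F" for h
    proof (cases "h = g")
      case True
      then show ?thesis using g by (simp add: split)
    next
      case False
      then have "(\<Sum>k\<in>S - {j}. l k * (h k - h j / g j * g k)) = 0"
        using l h by (auto simp: F'_def)
      also have "(\<Sum>k\<in>S - {j}. l k * (h k - h j / g j * g k))
          = (\<Sum>k\<in>S - {j}. l k * h k) - (\<Sum>k\<in>S - {j}. l k * g k) * (h j / g j)"
        by (simp add: algebra_simps sum_subtractf sum_distrib_left)
      finally show ?thesis by (simp only: split)
    qed
    moreover have "\<exists>k\<in>S. l' k \<noteq> 0" using l by (auto simp: l'_def)
    ultimately show ?thesis by blast
  qed
qed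

text \<open>In a representation of smallest support with more than \<open>card F\<close> terms, the
  weights could be moved along a linear relation until one of them vanishes. The total weight is
  preserved as soon as the constant function belongs to \<open>F\<close>.\<close>

lemma conic_caratheodory:
  fixes F :: "('k \<Rightarrow> real) set" and w :: "'k \<Rightarrow> real"
  assumes F: "finite F" and I: "finite I" and w: "\<And>k. k \<in> I \<Longrightarrow> 0 \<le> w k"
  obtains S u where "S \<subseteq> I" "card S \<le> card F" "\<And>k. k \<in> S \<Longrightarrow> 0 \<le> u k"
    "\<And>g. g \<in> F \<Longrightarrow> (\<Sum>k\<in>S. u k * g k) = (\<Sum>k\<in>I. w k * g k)"
proof -
  define good where "good = (\<lambda>(S, u). S \<subseteq> I \<and> (\<forall>k\<in>S. 0 \<le> u k) \<and>
     (\<forall>g\<in>F. (\<Sum>k\<in>S. u k * g k) = (\<Sum>k\<in>I. w k * g k)))"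
  have "good (I, w)" using w by (auto simp: good_def)
  then obtain Su where Su: "good Su" "\<And>Tv. good Tv \<Longrightarrow> card (fst Su) \<le> card (fst Tv)"
    using ex_has_least_nat[of good "(I, w)" "\<lambda>Tv. card (fst Tv)"] by blast
  obtain S u where Su_eq: "Su = (S, u)" by fastforce
  have S: "S \<subseteq> I" "\<And>k. k \<in> S \<Longrightarrow> 0 \<le> u k" "\<And>g. g \<in> F \<Longrightarrow> (\<Sum>k\<in>S. u k * g k) = (\<Sum>k\<in>I. w k * g k)"
    using Su(1) by (auto simp: good_def Su_eq)
  have "finite S" using S I finite_subset by blast
  have "card S \<le> card F"
  proof (rule ccontr)
    assume "\<not> ?thesis"
    then obtain l0 k0 where l0: "k0 \<in> S" "l0 k0 \<noteq> 0" "\<forall>g\<in>F. (\<Sum>k\<in>S. l0 k * g k) = 0"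
      using nontrivial_linear_relation[OF F \<open>finite S\<close> order_refl] by auto
    \<comment> \<open>The sign makes at least one coefficient positive, so that \<open>T\<close>
      below is nonempty.\<close>
    define l where "l = (\<lambda>k. sgn (l0 k0) * l0 k)"
    have l: "0 < l k0" "\<forall>g\<in>F. (\<Sum>k\<in>S. l k * g k) = 0"
      using l0 by (auto simp: l_def sgn_if mult.assoc sum_distrib_left[symmetric] sum_negf)
    define T where "T = {k\<in>S. 0 < l k}"
    have T: "finite T" "T \<noteq> {}" using \<open>finite S\<close> l l0 by (auto simp: T_def)
    \<comment> \<open>Ratio test: \<open>t\<close> is the largest multiple of the relation that can
      be subtracted without creating a negative weight, and it cancels the weight of
      \<open>j\<close>.\<close>
    obtain j where j: "j \<in> T" "\<And>k. k \<in> T \<Longrightarrow> u j / l j \<le> u k / l k"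
      using arg_min_if_finite[OF T, of "\<lambda>k. u k / l k"] by (metis not_le)
    define t where "t = u j / l j"
    define v where "v = (\<lambda>k. u k - t * l k)"
    have "0 < l j" "j \<in> S" using j by (auto simp: T_def)
    have "0 \<le> t" using S(2)[OF \<open>j \<in> S\<close>] \<open>0 < l j\<close> by (simp add: t_def)
    have "v j = 0" using \<open>0 < l j\<close> by (simp add: v_def t_def)
    have "0 \<le> v k" if k: "k \<in> S" for k
    proof (cases "0 < l k")
      case True
      then have "t \<le> u k / l k" using j k by (auto simp: t_def T_def)
      then show ?thesis using True by (simp add: v_def field_simps)
    next
      case False
      then have "t * l k \<le> 0" using \<open>0 \<le> t\<close> by (simp add: mult_nonneg_nonpos)
      then show ?thesis using S(2)[OF k] by (simp add: v_def)
    qed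
    moreover have "(\<Sum>k\<in>S - {j}. v k * g k) = (\<Sum>k\<in>I. w k * g k)" if "g \<in> F" for g
    proof -
      have "(\<Sum>k\<in>S - {j}. v k * g k) = (\<Sum>k\<in>S. v k * g k)"
        using \<open>j \<in> S\<close> \<open>finite S\<close> \<open>v j = 0\<close> by (subst sum.remove[of S j]) auto
      also have "\<dots> = (\<Sum>k\<in>S. u k * g k) - t * (\<Sum>k\<in>S. l k * g k)"
        by (simp add: v_def algebra_simps sum_subtractf sum_distrib_left)
      finally show ?thesis using S l that by simp
    qed
    ultimately have "good (S - {j}, v)" using S by (auto simp: good_def)
    from Su(2)[OF this] have "card S \<le> card (S - {j})" by (simp add: Su_eq)
    then show False using card_Diff1_less[OF \<open>finite S\<close> \<open>j \<in> S\<close>] by linarith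
  qed
  then show ?thesis using that S by blast
qed

section \<open>Compactness in finitely many complex coordinates\<close>

lemma common_convergent_subsequence:
  fixes f :: "'s \<Rightarrow> nat \<Rightarrow> complex"
  assumes "finite S" "\<And>s. s \<in> S \<Longrightarrow> bounded (range (f s))"
  shows "\<exists>r l. strict_mono r \<and> (\<forall>s\<in>S. (\<lambda>n. f s (r n)) \<longlonglongrightarrow> l s)"
  using assms
proof (induction S)
  case empty
  show ?case by (intro exI[of _ id]) (auto simp: strict_mono_def)
next
  case (insert s S)
  then obtain r l where r: "strict_mono r" "\<forall>s\<in>S. (\<lambda>n. f s (r n)) \<longlonglongrightarrow> l s" by blast
  have "bounded (range (\<lambda>n. f s (r n)))"
    using insert.prems[of s] by (auto intro: bounded_subset)
  then obtain l' r' where r': "strict_mono r'" "((\<lambda>n. f s (r n)) \<circ> r') \<longlonglongrightarrow> l'"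
    using bounded_imp_convergent_subsequence by blast
  have "\<forall>s'\<in>insert s S. (\<lambda>n. f s' ((r \<circ> r') n)) \<longlonglongrightarrow> (l(s := l')) s'"
    using r' LIMSEQ_subseq_LIMSEQ[OF _ r'(1)] r insert.hyps by (fastforce simp: o_def)
  then show ?case using strict_mono_o[OF r(1) r'(1)] by blast
qed

section \<open>Positive semidefinite matrices as functions\<close>

text \<open>Matrices are plain functions of two indices from here on. Values outside the range are
  ignored, so limits, conditional operators and kernels can be written entrywise without carrier
  conditions. The form is conjugate linear in its first argument.\<close>

definition ip :: "nat \<Rightarrow> (nat \<Rightarrow> complex) \<Rightarrow> (nat \<Rightarrow> complex) \<Rightarrow> complex" where
  "ip d u v = (\<Sum>r<d. cnj (u r) * v r)"

definition app :: "nat \<Rightarrow> (nat \<Rightarrow> nat \<Rightarrow> complex) \<Rightarrow> (nat \<Rightarrow> complex) \<Rightarrow> nat \<Rightarrow> complex" where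
  "app d A u r = (\<Sum>s<d. A r s * u s)"

definition psdf :: "nat \<Rightarrow> (nat \<Rightarrow> nat \<Rightarrow> complex) \<Rightarrow> bool" where
  "psdf d A \<longleftrightarrow> (\<forall>u. 0 \<le> ip d u (app d A u))"

lemma ip_self: "ip d u u = complex_of_real (\<Sum>r<d. (cmod (u r))\<^sup>2)"
  unfolding ip_def of_real_sum
  by (intro sum.cong refl) (simp only: mult.commute[of "cnj _"] complex_norm_square[symmetric])

lemma ip_diff_left: "ip d (\<lambda>r. u r - v r) w = ip d u w - ip d v w"
  by (simp add: ip_def left_diff_distrib sum_subtractf)

lemma ip_diff_right: "ip d w (\<lambda>r. u r - v r) = ip d w u - ip d w v"
  by (simp add: ip_def right_diff_distrib sum_subtractf)

lemma app_diff: "app d A (\<lambda>r. u r - v r) = (\<lambda>r. app d A u r - app d A v r)"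
  by (auto simp: app_def right_diff_distrib sum_subtractf)

lemma ip_app: "ip d u (app d A v) = (\<Sum>r<d. \<Sum>s<d. cnj (u r) * A r s * v s)"
  by (simp add: ip_def app_def sum_distrib_left mult.assoc)

lemma app_unit: "r < d \<Longrightarrow> app d A (\<lambda>t. if t = r then c else 0) = (\<lambda>t. A t r * c)"
proof
  fix t assume "r < d"
  have "app d A (\<lambda>t. if t = r then c else 0) t = (\<Sum>s<d. if s = r then A t s * c else 0)"
    unfolding app_def by (intro sum.cong) auto
  with \<open>r < d\<close> show "app d A (\<lambda>t. if t = r then c else 0) t = A t r * c" by simp
qed

lemma ip_unit: "r < d \<Longrightarrow> ip d (\<lambda>t. if t = r then c else 0) v = cnj c * v r"
proof -
  assume "r < d"
  have "ip d (\<lambda>t. if t = r then c else 0) v = (\<Sum>s<d. if s = r then cnj c * v s else 0)"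
    unfolding ip_def by (intro sum.cong) auto
  with \<open>r < d\<close> show ?thesis by simp
qed

text \<open>The common source of hermiticity, of the entry bound and of polarisation. The two units
  are added, not assigned by cases, so \<open>r = s\<close> is covered as well.\<close>

lemma ip_app_pair:
  assumes "r < d" "s < d"
  defines "u \<equiv> (\<lambda>c t. (if t = r then 1 else 0) + (if t = s then c else 0))"
  shows "ip d (u c) (app d A (u c)) = A r r + c * A r s + cnj c * A s r + cnj c * c * A s s"
proof -
  have ip_add: "ip d (\<lambda>t. v t + w t) z = ip d v z + ip d w z" for v w z
    by (simp add: ip_def distrib_right sum.distrib)
  have "app d A (\<lambda>t. v t + w t) t = app d A v t + app d A w t" for v w t
    by (simp add: app_def distrib_left sum.distrib)
  then show ?thesis
    using assms(1,2) unfolding u_def ip_add by (simp add: ip_unit app_unit algebra_simps)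
qed

lemma psdf_diag: "psdf d A \<Longrightarrow> r < d \<Longrightarrow> 0 \<le> A r r"
  unfolding psdf_def by (drule spec[of _ "\<lambda>t. if t = r then 1 else 0"]) (simp add: app_unit ip_unit)

lemma psdf_hermitian:
  assumes "psdf d A" "r < d" "s < d"
  shows "A s r = cnj (A r s)"
proof (cases "r = s")
  case True
  then show ?thesis using psdf_diag[OF assms(1,2)] by (auto simp: less_eq_complex_def complex_eq_iff)
next
  case False
  have "0 \<le> A r r + c * A r s + cnj c * A s r + cnj c * c * A s s" for c
    by (subst ip_app_pair[OF assms(2,3), symmetric]) (use assms(1) in \<open>simp add: psdf_def\<close>)
  \<comment> \<open>The value at \<open>1\<close> makes the imaginary parts of the two entries
    opposite, the value at \<i> makes their real parts equal.\<close>
  from this[of 1] this[of \<i>] psdf_diag[OF assms(1,2)] psdf_diag[OF assms(1,3)]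
  show ?thesis by (auto simp: less_eq_complex_def complex_eq_iff)
qed

text \<open>A bound that is linear in the diagonal: a bounded diagonal bounds the whole matrix, and
  a zero diagonal makes it zero.\<close>

lemma psdf_cmod_le:
  assumes "psdf d A" "r < d" "s < d"
  shows "cmod (A r s) \<le> Re (A r r) + Re (A s s)"
proof (cases "r = s")
  case True
  then show ?thesis using psdf_diag[OF assms(1,2)] by (auto simp: less_eq_complex_def cmod_def)
next
  case False
  \<comment> \<open>This phase turns both off-diagonal terms of the quadratic form into
    \<open>- cmod (A r s)\<close>.\<close>
  define c where "c = - sgn (cnj (A r s))"
  have "0 \<le> A r r + c * A r s + cnj c * A s r + cnj c * c * A s s"
    by (subst ip_app_pair[OF assms(2,3), symmetric]) (use assms(1) in \<open>simp add: psdf_def\<close>)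
  moreover have "c * A r s = - complex_of_real (cmod (A r s))"
  proof (cases "A r s = 0")
    case nz: False
    have "cnj (A r s) * A r s = complex_of_real ((cmod (A r s))\<^sup>2)"
      by (simp only: mult.commute[of "cnj _"] complex_norm_square)
    then have "c * A r s = - (complex_of_real ((cmod (A r s))\<^sup>2) / cmod (A r s))"
      by (simp add: c_def sgn_eq)
    then show ?thesis using nz by (simp add: power2_eq_square)
  qed simp
  moreover have "cnj c * A s r = cnj (c * A r s)"
    using psdf_hermitian[OF assms] by simp
  moreover have "Re (cnj c * c * A s s) \<le> Re (A s s)"
  proof -
    have "cnj c * c = of_real ((cmod c)\<^sup>2)" by (simp only: mult.commute[of "cnj _"] complex_norm_square)
    moreover have "cmod c \<le> 1" by (simp add: c_def norm_sgn)
    ultimately show ?thesis using psdf_diag[OF assms(1,3)]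
      by (auto simp: less_eq_complex_def mult_left_le_one_le power_le_one simp flip: of_real_power)
  qed
  ultimately have "2 * cmod (A r s) \<le> Re (A r r) + Re (A s s)"
    by (auto simp: less_eq_complex_def)
  then show ?thesis using norm_ge_zero[of "A r s"] by linarith
qed

lemma psdf_self_adjoint:
  assumes "psdf d A" shows "ip d u (app d A v) = ip d (app d A u) v"
proof -
  have "ip d (app d A u) v = (\<Sum>s<d. \<Sum>r<d. cnj (A s r) * cnj (u r) * v s)"
    by (simp add: ip_def app_def sum_distrib_right)
  also have "\<dots> = (\<Sum>r<d. \<Sum>s<d. cnj (u r) * A r s * v s)"
    by (subst sum.swap, intro sum.cong refl) (simp add: psdf_hermitian[OF assms, symmetric])
  finally show ?thesis by (simp add: ip_app)
qed

lemma psdf_zero_diag: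
  assumes "psdf d A" "\<And>r. r < d \<Longrightarrow> A r r = 0" "r < d" "s < d"
  shows "A r s = 0"
  using psdf_cmod_le[OF assms(1,3,4)] assms by simp

lemma psd_iff_psdf: "psd d A \<longleftrightarrow> A \<in> carrier_mat d d \<and> psdf d (\<lambda>r s. A $$ (r, s))"
proof -
  have form: "(A *\<^sub>v v) \<bullet>c v = ip d (vec_index v) (app d (\<lambda>r s. A $$ (r, s)) (vec_index v))"
    if "A \<in> carrier_mat d d" "v \<in> carrier_vec d" for v
    using that by (auto simp: scalar_prod_def ip_def app_def atLeast0LessThan mult.commute intro!: sum.cong)
  have ext: "ip d u (app d (\<lambda>r s. A $$ (r, s)) u) = (A *\<^sub>v Matrix.vec d u) \<bullet>c Matrix.vec d u"
    if "A \<in> carrier_mat d d" for u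
    using that by (subst form) (auto simp: ip_def app_def)
  show ?thesis
  proof (cases "A \<in> carrier_mat d d")
    case True
    show ?thesis unfolding psd_def psdf_def
    proof (intro conj_cong refl iffI allI ballI)
      fix u assume "\<forall>v\<in>carrier_vec d. 0 \<le> (A *\<^sub>v v) \<bullet>c v"
      then have "0 \<le> (A *\<^sub>v Matrix.vec d u) \<bullet>c Matrix.vec d u" by simp
      then show "0 \<le> ip d u (app d (\<lambda>r s. A $$ (r, s)) u)" by (simp only: ext[OF True])
    next
      fix v :: "complex Matrix.vec" 
      assume "\<forall>u. 0 \<le> ip d u (app d (\<lambda>r s. A $$ (r, s)) u)" "v \<in> carrier_vec d"
      then show "0 \<le> (A *\<^sub>v v) \<bullet>c v" by (simp only: form[OF True])
    qed
  qed (simp add: psd_def)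
qed

section \<open>POVMs, their defect, and projectivity\<close>

definition povmf :: "nat \<Rightarrow> nat \<Rightarrow> (nat \<Rightarrow> nat \<Rightarrow> nat \<Rightarrow> complex) \<Rightarrow> bool" where
  "povmf d n B \<longleftrightarrow> (\<forall>i<n. psdf d (B i)) \<and> (\<forall>r<d. \<forall>s<d. (\<Sum>i<n. B i r s) = (if r = s then 1 else 0))"

text \<open>The sum of \<open>Tr (B\<^sub>i - B\<^sub>i\<^sup>2)\<close>, that is, of \<open>Tr (B\<^sub>i B\<^sub>j)\<close> over \<open>i \<noteq> j\<close>.\<close>

definition defect :: "nat \<Rightarrow> nat \<Rightarrow> (nat \<Rightarrow> nat \<Rightarrow> nat \<Rightarrow> complex) \<Rightarrow> real" where
  "defect d n B = (\<Sum>i<n. \<Sum>r<d. Re (B i r r) - (\<Sum>s<d. (cmod (B i s r))\<^sup>2))"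

lemma povmf_effect_le:
  assumes "povmf d n B" "i < n"
  shows "ip d u (app d (B i) u) \<le> ip d u u"
proof -
  have "(\<Sum>j<n. ip d u (app d (B j) u)) = (\<Sum>r<d. \<Sum>s<d. cnj (u r) * (\<Sum>j<n. B j r s) * u s)"
    unfolding ip_app by (subst sum.swap, rule sum.cong[OF refl], subst sum.swap)
      (simp add: sum_distrib_left sum_distrib_right)
  also have "\<dots> = (\<Sum>r<d. \<Sum>s<d. if r = s then cnj (u r) * u s else 0)"
    using assms by (intro sum.cong refl) (auto simp: povmf_def)
  also have "\<dots> = ip d u u" by (simp add: ip_def)
  finally have "(\<Sum>j<n. ip d u (app d (B j) u)) = ip d u u" .
  moreover have "ip d u (app d (B i) u) \<le> (\<Sum>j<n. ip d u (app d (B j) u))"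
    using assms by (intro member_le_sum) (auto simp: povmf_def psdf_def)
  ultimately show ?thesis by simp
qed

text \<open>With \<open>w = B u\<close> and \<open>x = u - w\<close>, this is \<open>B - B\<^sup>2 = B (1 - B) B + (1 - B) B (1 - B)\<close>.\<close>

lemma psdf_minus_square:
  assumes "povmf d n B" "i < n"
  shows "psdf d (\<lambda>r s. B i r s - (\<Sum>t<d. B i r t * B i t s))"
  unfolding psdf_def
proof
  fix u
  let ?A = "app d (B i)"
  define w where "w = ?A u"
  define x where "x = (\<lambda>r. u r - w r)"
  have psd: "psdf d (B i)" using assms by (simp add: povmf_def)
  have "app d (\<lambda>r s. B i r s - (\<Sum>t<d. B i r t * B i t s)) u = (\<lambda>r. w r - ?A w r)"
  proof
    fix r
    have "(\<Sum>s<d. (\<Sum>t<d. B i r t * B i t s) * u s) = ?A w r"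
      unfolding w_def app_def sum_distrib_left sum_distrib_right
      by (subst sum.swap) (simp add: mult.assoc)
    then show "app d (\<lambda>r s. B i r s - (\<Sum>t<d. B i r t * B i t s)) u r = w r - ?A w r"
      by (simp add: app_def left_diff_distrib sum_subtractf w_def)
  qed
  then have "ip d u (app d (\<lambda>r s. B i r s - (\<Sum>t<d. B i r t * B i t s)) u) = ip d u w - ip d w w"
    using psdf_self_adjoint[OF psd, of u w] by (simp add: ip_diff_right w_def)
  also have "\<dots> = (ip d w w - ip d w (?A w)) + ip d x (?A x)"
    using psdf_self_adjoint[OF psd, of u w]
    by (simp add: x_def app_diff ip_diff_left ip_diff_right) (simp add: w_def)
  also have "0 \<le> \<dots>"
    using povmf_effect_le[OF assms, of w] psd by (intro add_nonneg_nonneg) (auto simp: psdf_def)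
  finally show "0 \<le> ip d u (app d (\<lambda>r s. B i r s - (\<Sum>t<d. B i r t * B i t s)) u)" .
qed

lemma square_diag:
  assumes "psdf d A" "r < d"
  shows "(\<Sum>t<d. A r t * A t r) = complex_of_real (\<Sum>s<d. (cmod (A s r))\<^sup>2)"
  unfolding of_real_sum
proof (intro sum.cong refl)
  fix t assume "t \<in> {..<d}"
  then have "A r t = cnj (A t r)" using psdf_hermitian[OF assms(1) _ assms(2), of t] by simp
  then show "A r t * A t r = complex_of_real ((cmod (A t r))\<^sup>2)"
    by (simp only: mult.commute[of "cnj _"] complex_norm_square[symmetric])
qed

lemma povmf_square_le:
  assumes "povmf d n B" "i < n" "r < d"
  shows "(\<Sum>s<d. (cmod (B i s r))\<^sup>2) \<le> Re (B i r r)"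
proof -
  have "psdf d (B i)" using assms by (simp add: povmf_def)
  note square_diag[OF this assms(3)]
  then have "0 \<le> B i r r - complex_of_real (\<Sum>s<d. (cmod (B i s r))\<^sup>2)"
    using psdf_diag[OF psdf_minus_square[OF assms(1,2)] assms(3)] by (simp only:)
  then show ?thesis
    by (auto simp only: less_eq_complex_def minus_complex.simps Re_complex_of_real zero_complex.simps
        diff_ge_0_iff_ge)
qed

lemma defect_nonneg: "povmf d n B \<Longrightarrow> 0 \<le> defect d n B"
  unfolding defect_def by (intro sum_nonneg) (simp add: povmf_square_le)

text \<open>Column \<open>r\<close> has squared norm at most the diagonal entry
  \<open>B i r r\<close>; this bounds that entry by \<open>1\<close>, and then the whole column. It
  supplies the boundedness needed for convergent subsequences.\<close>

lemma povmf_cmod_le_1: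
  assumes "povmf d n B" "i < n" "r < d" "s < d"
  shows "cmod (B i s r) \<le> 1"
proof -
  have le: "(cmod (B i t r))\<^sup>2 \<le> Re (B i r r)" if "t < d" for t
    using povmf_square_le[OF assms(1-3)] member_le_sum[of t "{..<d}" "\<lambda>s. (cmod (B i s r))\<^sup>2"] that
    by force
  have "(cmod (B i r r))\<^sup>2 \<le> cmod (B i r r)" 
    using le[of r] complex_Re_le_cmod[of "B i r r"] assms by linarith
  then have "cmod (B i r r) \<le> 1"
    by (cases "cmod (B i r r) = 0") (auto simp: power2_eq_square)
  then have "(cmod (B i s r))\<^sup>2 \<le> 1"
    using le[of s] complex_Re_le_cmod[of "B i r r"] assms by linarith
  then show ?thesis by (simp add: abs_square_le_1)
qed

text \<open>The defect is a sum of nonnegative diagonal entries of \<open>B i\<close> minus its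
  square. If it vanishes, these positive semidefinite matrices have zero diagonal and are zero, so
  every effect is idempotent. Orthogonality follows because idempotent effects that sum to the
  identity leave no room for each other.\<close>

lemma projective_if_defect_zero:
  assumes B: "povmf d n B" and z: "defect d n B = 0" and ij: "i < n" "j < n" "r < d" "s < d"
  shows "(\<Sum>t<d. B i r t * B j t s) = (if i = j then B i r s else 0)"
proof -
  have psd: "psdf d (B i)" if "i < n" for i using B that by (simp add: povmf_def)
  have diag: "Re (B i r r) - (\<Sum>s<d. (cmod (B i s r))\<^sup>2) = 0" if "i < n" "r < d" for i r
  proof -
    have "\<forall>i\<in>{..<n}. (\<Sum>r<d. Re (B i r r) - (\<Sum>s<d. (cmod (B i s r))\<^sup>2)) = 0"
      using z unfolding defect_def
      by (subst (asm) sum_nonneg_eq_0_iff) (auto intro!: sum_nonneg povmf_square_le[OF B])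
    then have "(\<Sum>r<d. Re (B i r r) - (\<Sum>s<d. (cmod (B i s r))\<^sup>2)) = 0" using that by auto
    then show ?thesis
      using that by (subst (asm) sum_nonneg_eq_0_iff) (auto intro!: povmf_square_le[OF B])
  qed
  have idem: "(\<Sum>t<d. B i r t * B i t s) = B i r s" if "i < n" "r < d" "s < d" for i r s
  proof -
    have "B i r s - (\<Sum>t<d. B i r t * B i t s) = 0"
    proof (rule psdf_zero_diag[OF psdf_minus_square[OF B \<open>i < n\<close>] _ that(2,3)])
      fix r assume "r < d"
      then show "B i r r - (\<Sum>t<d. B i r t * B i t r) = 0"
        using diag[OF \<open>i < n\<close>] square_diag[OF psd[OF \<open>i < n\<close>], of r] psdf_diag[OF psd[OF \<open>i < n\<close>], of r]
        by (auto simp: complex_eq_iff less_eq_complex_def)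
    qed
    then show ?thesis by simp
  qed
  show ?thesis
  proof (cases "i = j")
    case True
    then show ?thesis using idem ij by simp
  next
    case False
    \<comment> \<open>Column \<open>s\<close> of \<open>B j\<close>, which \<open>B j\<close> fixes.
      The squared norm of \<open>v\<close> is the sum over \<open>k\<close> of nonnegative numbers
      of which \<open>k = j\<close> already takes everything; by \<open>herm\<close> each of the
      others is the squared norm of \<open>B k\<close> applied to \<open>v\<close>.\<close>
    define v where "v = (\<lambda>t. B j t s)"
    have herm: "ip d v (app d (B k) v) = complex_of_real (\<Sum>r<d. (cmod (app d (B k) v r))\<^sup>2)" if "k < n" for k
    proof -
      have "app d (B k) v r = app d (B k) (app d (B k) v) r" if "r < d" for r
      proof -
        have "app d (B k) (app d (B k) v) r = (\<Sum>s<d. (\<Sum>t<d. B k r t * B k t s) * v s)"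
          unfolding app_def sum_distrib_left sum_distrib_right
          by (subst sum.swap) (simp add: mult.assoc)
        also have "\<dots> = app d (B k) v r"
          unfolding app_def using idem \<open>k < n\<close> \<open>r < d\<close> by (intro sum.cong) auto
        finally show ?thesis by simp
      qed
      then have "ip d v (app d (B k) v) = ip d v (app d (B k) (app d (B k) v))"
        by (simp add: ip_def)
      then show ?thesis by (simp add: psdf_self_adjoint[OF psd[OF that]] ip_self)
    qed
    have "(\<Sum>k<n. ip d v (app d (B k) v)) = ip d v v"
    proof -
      have "(\<Sum>k<n. ip d v (app d (B k) v)) = (\<Sum>r<d. \<Sum>s<d. cnj (v r) * (\<Sum>j<n. B j r s) * v s)"
        unfolding ip_app by (subst sum.swap, rule sum.cong[OF refl], subst sum.swap)
          (simp add: sum_distrib_left sum_distrib_right)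
      also have "\<dots> = (\<Sum>r<d. \<Sum>s<d. if r = s then cnj (v r) * v s else 0)"
        using B by (intro sum.cong refl) (auto simp: povmf_def)
      finally show ?thesis by (simp add: ip_def)
    qed
    moreover have "app d (B j) v t = v t" if "t < d" for t
      using idem[OF ij(2) that ij(4)] by (simp add: app_def v_def)
    then have "ip d v (app d (B j) v) = ip d v v" by (simp add: ip_def)
    ultimately have "(\<Sum>k\<in>{..<n} - {j}. ip d v (app d (B k) v)) = 0"
      using sum.remove[of "{..<n}" j "\<lambda>k. ip d v (app d (B k) v)"] ij by simp
    then have "ip d v (app d (B i) v) = 0"
      using ij False by (subst (asm) sum_nonneg_eq_0_iff) (use psd in \<open>auto simp: psdf_def\<close>)
    then have "(\<Sum>r<d. (cmod (app d (B i) v r))\<^sup>2) = 0" using herm[OF ij(1)] by (simp only: of_real_eq_0_iff)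
    then have "app d (B i) v r = 0"
      using ij by (subst (asm) sum_nonneg_eq_0_iff) auto
    then show ?thesis using False by (simp add: app_def v_def)
  qed
qed

section \<open>Limits of mixtures of POVMs\<close>

lemma psdf_limit:
  assumes "\<And>\<nu>. psdf d (A \<nu>)" "\<And>r s. r < d \<Longrightarrow> s < d \<Longrightarrow> (\<lambda>\<nu>. A \<nu> r s) \<longlonglongrightarrow> L r s"
  shows "psdf d L"
  unfolding psdf_def
proof
  fix u
  have "(\<lambda>\<nu>. ip d u (app d (A \<nu>) u)) \<longlonglongrightarrow> ip d u (app d L u)"
    unfolding ip_app by (intro tendsto_intros assms(2)) auto
  note lim = this
  have nonneg: "0 \<le> ip d u (app d (A \<nu>) u)" for \<nu> using assms(1) by (simp add: psdf_def)
  have "0 \<le> Re (ip d u (app d L u))"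
    by (rule LIMSEQ_le_const[OF tendsto_Re[OF lim]]) (use nonneg in \<open>auto simp: less_eq_complex_def\<close>)
  moreover have "(\<lambda>\<nu>. Im (ip d u (app d (A \<nu>) u))) \<longlonglongrightarrow> 0"
    using nonneg by (simp add: less_eq_complex_def)
  then have "Im (ip d u (app d L u)) = 0"
    using LIMSEQ_unique tendsto_Im[OF lim] by blast
  ultimately show "0 \<le> ip d u (app d L u)" by (simp add: less_eq_complex_def)
qed

lemma povmf_limit:
  assumes "\<And>\<nu>. povmf d n (A \<nu>)"
    and "\<And>i r s. i < n \<Longrightarrow> r < d \<Longrightarrow> s < d \<Longrightarrow> (\<lambda>\<nu>. A \<nu> i r s) \<longlonglongrightarrow> L i r s"
  shows "povmf d n L"
  unfolding povmf_def
proof (intro conjI allI impI)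
  fix i assume "i < n"
  then show "psdf d (L i)"
    using assms(1) by (intro psdf_limit[of d "\<lambda>\<nu>. A \<nu> i" "L i"] assms(2)) (simp_all add: povmf_def)
next
  fix r s assume rs: "r < d" "s < d"
  have "(\<lambda>\<nu>. \<Sum>i<n. A \<nu> i r s) \<longlonglongrightarrow> (\<Sum>i<n. L i r s)"
    using rs by (intro tendsto_sum assms(2)) auto
  moreover have "(\<lambda>\<nu>. \<Sum>i<n. A \<nu> i r s) = (\<lambda>\<nu>. if r = s then 1 else 0)"
    using assms(1) rs by (simp add: povmf_def)
  ultimately show "(\<Sum>i<n. L i r s) = (if r = s then 1 else 0)"
    by (metis LIMSEQ_unique tendsto_const)
qed

text \<open>The quantities a reduced mixture has to keep: total weight, mean defect, and the real
  and imaginary parts of all averaged entries. The defect is not linear in the POVM, but its mean is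
  linear in the weights, which is all that the reduction requires.\<close>

definition mixture_coordinates ::
    "nat \<Rightarrow> nat \<Rightarrow> ('z \<Rightarrow> nat \<Rightarrow> nat \<Rightarrow> nat \<Rightarrow> complex) \<Rightarrow> ('z \<Rightarrow> real) set" where
  "mixture_coordinates d n B = insert (\<lambda>_. 1) (insert (\<lambda>z. defect d n (B z))
     ((\<lambda>(i, r, s) z. Re (B z i r s)) ` ({..<n} \<times> {..<d} \<times> {..<d}) \<union>
      (\<lambda>(i, r, s) z. Im (B z i r s)) ` ({..<n} \<times> {..<d} \<times> {..<d})))"

lemma finite_mixture_coordinates: "finite (mixture_coordinates d n B)"
  by (simp add: mixture_coordinates_def)

lemma card_mixture_coordinates:
  fixes B :: "'z \<Rightarrow> nat \<Rightarrow> nat \<Rightarrow> nat \<Rightarrow> complex"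
  shows "card (mixture_coordinates d n B) \<le> 2 + 2 * (n * d * d)"
proof -
  let ?X = "{..<n} \<times> {..<d} \<times> {..<d}"
  have X: "card ?X = n * d * d" by simp
  have insert: "card (insert x A) \<le> Suc (card A)" for x and A :: "('z \<Rightarrow> real) set"
    by (cases "finite A") (auto simp: card_insert_if)
  have "card (mixture_coordinates d n B) \<le> Suc (Suc (card
      ((\<lambda>(i, r, s) z. Re (B z i r s)) ` ?X \<union> (\<lambda>(i, r, s) z. Im (B z i r s)) ` ?X)))"
    unfolding mixture_coordinates_def
    by (rule order_trans[OF insert]) (rule Suc_le_mono[THEN iffD2, OF insert])
  also have "\<dots> \<le> Suc (Suc (card ((\<lambda>(i, r, s) z. Re (B z i r s)) ` ?X)
      + card ((\<lambda>(i, r, s) z. Im (B z i r s)) ` ?X)))"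
    using card_Un_le by (simp del: card_cartesian_product)
  also have "\<dots> \<le> Suc (Suc (card ?X + card ?X))"
    by (intro Suc_le_mono[THEN iffD2] add_mono card_image_le) auto
  finally show ?thesis by (simp only: X)
qed

text \<open>The number of terms depends only on \<open>d\<close> and \<open>n\<close>. Zero weights
  pad every mixture to exactly this number, which gives mixtures over different index sets a common
  shape.\<close>

lemma mixture_bounded_terms:
  fixes p :: "'z \<Rightarrow> real" and B :: "'z \<Rightarrow> nat \<Rightarrow> nat \<Rightarrow> nat \<Rightarrow> complex"
  assumes I: "finite I" and p: "\<And>z. z \<in> I \<Longrightarrow> 0 \<le> p z" "(\<Sum>z\<in>I. p z) = 1"
    and B: "\<And>z. z \<in> I \<Longrightarrow> povmf d n (B z)"
  obtains w :: "nat \<Rightarrow> real" and C :: "nat \<Rightarrow> nat \<Rightarrow> nat \<Rightarrow> nat \<Rightarrow> complex" where "\<And>k. 0 \<le> w k" "(\<Sum>k<2 + 2 * (n * d * d). w k) = (1::real)"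
    "\<And>k. povmf d n (C k)"
    "\<And>i r s. i < n \<Longrightarrow> r < d \<Longrightarrow> s < d \<Longrightarrow>
       (\<Sum>k<2 + 2 * (n * d * d). w k * C k i r s) = (\<Sum>z\<in>I. p z * B z i r s)"
    "(\<Sum>k<2 + 2 * (n * d * d). w k * defect d n (C k)) = (\<Sum>z\<in>I. p z * defect d n (B z))"
proof -
  define F where "F = mixture_coordinates d n B"
  define N where "N = 2 + 2 * (n * d * d)"
  obtain S u where S: "S \<subseteq> I" "card S \<le> card F" "\<And>k. k \<in> S \<Longrightarrow> 0 \<le> u k"
    "\<And>g. g \<in> F \<Longrightarrow> (\<Sum>k\<in>S. u k * g k) = (\<Sum>z\<in>I. p z * g z)"
    by (rule conic_caratheodory[of F I p]) (use I p finite_mixture_coordinates in \<open>auto simp: F_def\<close>)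
  have "card S \<le> N" using S(2) card_mixture_coordinates order_trans unfolding F_def N_def by blast
  have "finite S" using S(1) I finite_subset by blast
  have "(\<Sum>k\<in>S. u k) = 1" using S(4)[of "\<lambda>_. 1"] p by (simp add: F_def mixture_coordinates_def)
  then obtain z0 where "z0 \<in> S" by fastforce
  obtain e where e: "bij_betw e {..<card S} S"
    using ex_bij_betw_nat_finite[OF \<open>finite S\<close>] by (auto simp: atLeast0LessThan)
  define w where "w = (\<lambda>k. if k < card S then u (e k) else 0)"
  \<comment> \<open>Padding terms have weight zero but must still be POVMs, since limits are taken
    of all terms; \<open>B z0\<close> serves as filler.\<close>
  define C where "C = (\<lambda>k. if k < card S then B (e k) else B z0)"
  have eS: "e k \<in> S" if "k < card S" for k using e that by (auto simp: bij_betw_def)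
  have transfer: "(\<Sum>k<N. w k * h (C k)) = (\<Sum>z\<in>I. p z * h (B z))" if "(\<lambda>z. h (B z)) \<in> F" for h
  proof -
    have "(\<Sum>k<N. w k * h (C k)) = (\<Sum>k<card S. w k * h (C k))"
      using \<open>card S \<le> N\<close> by (intro sum.mono_neutral_right) (auto simp: w_def)
    also have "\<dots> = (\<Sum>k<card S. u (e k) * h (B (e k)))"
      by (intro sum.cong) (auto simp: w_def C_def)
    also have "\<dots> = (\<Sum>z\<in>S. u z * h (B z))"
      by (rule sum.reindex_bij_betw[OF e])
    finally show ?thesis using S(4)[OF that] by simp
  qed
  have Re: "(\<Sum>k<N. w k * Re (C k i r s)) = (\<Sum>z\<in>I. p z * Re (B z i r s))" 
    if "i < n" "r < d" "s < d" for i r s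
    using that by (intro transfer[of "\<lambda>B. Re (B i r s)"])
      (auto simp: F_def mixture_coordinates_def intro!: image_eqI[of _ _ "(i, r, s)"])
  have Im: "(\<Sum>k<N. w k * Im (C k i r s)) = (\<Sum>z\<in>I. p z * Im (B z i r s))"
    if "i < n" "r < d" "s < d" for i r s
    using that by (intro transfer[of "\<lambda>B. Im (B i r s)"])
      (auto simp: F_def mixture_coordinates_def intro!: image_eqI[of _ _ "(i, r, s)"])
  show ?thesis
  proof (rule that[of w C, folded N_def])
    show "0 \<le> w k" for k using S(3) eS by (simp add: w_def)
    show "(\<Sum>k<N. w k) = 1" using transfer[of "\<lambda>_. 1"] p by (simp add: F_def mixture_coordinates_def)
    show "povmf d n (C k)" for k using B eS S(1) \<open>z0 \<in> S\<close> by (auto simp: C_def)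
    show "(\<Sum>k<N. w k * C k i r s) = (\<Sum>z\<in>I. p z * B z i r s)" if "i < n" "r < d" "s < d" for i r s
      using Re[OF that] Im[OF that] by (simp add: complex_eq_iff)
    show "(\<Sum>k<N. w k * defect d n (C k)) = (\<Sum>z\<in>I. p z * defect d n (B z))"
      by (rule transfer) (simp add: F_def mixture_coordinates_def)
  qed
qed

lemma simulable_if_mixture_defect_zero:
  fixes N :: nat and C :: "nat \<Rightarrow> nat \<Rightarrow> nat \<Rightarrow> nat \<Rightarrow> complex"
  assumes "\<And>i. i < n \<Longrightarrow> M i \<in> carrier_mat d d"
    and w: "\<And>k. k < N \<Longrightarrow> 0 \<le> w k" "(\<Sum>k<N. w k) = (1::real)"
    and C: "\<And>k. k < N \<Longrightarrow> povmf d n (C k)"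
    and M: "\<And>i r s. i < n \<Longrightarrow> r < d \<Longrightarrow> s < d \<Longrightarrow> M i $$ (r, s) = (\<Sum>k<N. complex_of_real (w k) * C k i r s)"
    and z: "(\<Sum>k<N. w k * defect d n (C k)) = 0"
  shows "simulable d n M"
proof -
  have "\<exists>k<N. w k \<noteq> 0"
    by (rule ccontr) (use w(2) in auto)
  then obtain k0 where k0: "k0 < N" "w k0 \<noteq> 0" by blast
  \<comment> \<open>A vanishing mean forces zero defect only where the weight is positive; the other
    terms are replaced by \<open>C k0\<close>, which changes no average.\<close>
  define D where "D = (\<lambda>k. if w k = 0 then C k0 else C k)"
  have "\<forall>k\<in>{..<N}. w k * defect d n (C k) = 0"
    by (rule sum_nonneg_eq_0_iff[THEN iffD1, OF _ _ z])
      (auto intro: mult_nonneg_nonneg w defect_nonneg C)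
  then have D: "povmf d n (D k)" "defect d n (D k) = 0" if "k < N" for k
    using that C k0 by (auto simp: D_def)
  define P where "P = (\<lambda>k i. Matrix.mat d d (\<lambda>(r, s). D k i r s))"
  have "projective_povm d n (P k)" if k: "k < N" for k
    unfolding projective_povm_def povm_def
  proof (intro conjI allI impI)
    fix i assume "i < n"
    then have "psdf d (D k i)" using D(1)[OF k] by (simp add: povmf_def)
    moreover have "psdf d (\<lambda>r s. P k i $$ (r, s)) = psdf d (D k i)"
      by (simp add: psdf_def ip_app P_def)
    ultimately show "psd d (P k i)" by (simp add: psd_iff_psdf P_def)
  next
    show "msum d (P k) {..<n} = 1\<^sub>m d"
      using D(1)[OF k] by (auto simp: msum_def P_def povmf_def)
  next
    fix i j assume ij: "i < n" "j < n"
    show "P k i * P k j = (if i = j then P k i else 0\<^sub>m d d)"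
      using projective_if_defect_zero[OF D[OF k] ij]
      by (auto simp: P_def scalar_prod_def atLeast0LessThan)
  qed
  moreover have "M i = msum d (\<lambda>k. complex_of_real (w k) \<cdot>\<^sub>m P k i) {..<N}" if "i < n" for i
  proof (rule eq_matI)
    fix r s assume "r < dim_row (msum d (\<lambda>k. complex_of_real (w k) \<cdot>\<^sub>m P k i) {..<N})"
      "s < dim_col (msum d (\<lambda>k. complex_of_real (w k) \<cdot>\<^sub>m P k i) {..<N})"
    then have rs: "r < d" "s < d" by (auto simp: msum_def)
    then show "M i $$ (r, s) = msum d (\<lambda>k. complex_of_real (w k) \<cdot>\<^sub>m P k i) {..<N} $$ (r, s)"
      using M[OF that rs] by (auto simp: msum_def P_def D_def intro!: sum.cong)
  qed (use assms(1)[OF that] in \<open>auto simp: msum_def\<close>)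
  ultimately show ?thesis
    unfolding simulable_def using w by blast
qed

text \<open>After reduction to \<open>N\<close> terms, weights and entries lie in a bounded set of
  fixed dimension. The exact average \<open>M\<close> and the POVM conditions survive in a limit
  point, and by continuity its mean defect is zero.\<close>

lemma simulable_if_approximable:
  assumes M: "\<And>i. i < n \<Longrightarrow> M i \<in> carrier_mat d d"
    and approx: "\<And>\<epsilon>::real. 0 < \<epsilon> \<Longrightarrow>
       \<exists>(I :: 'z set) (p :: 'z \<Rightarrow> real) (B :: 'z \<Rightarrow> nat \<Rightarrow> nat \<Rightarrow> nat \<Rightarrow> complex). finite I \<and> (\<forall>z\<in>I. 0 \<le> p z \<and> povmf d n (B z)) \<and>
       (\<Sum>z\<in>I. p z) = 1 \<and>
       (\<forall>i<n. \<forall>r<d. \<forall>s<d. M i $$ (r, s) = (\<Sum>z\<in>I. complex_of_real (p z) * B z i r s)) \<and>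
       (\<Sum>z\<in>I. p z * defect d n (B z)) \<le> \<epsilon>"
  shows "simulable d n M"
proof -
  define N where "N = 2 + 2 * (n * d * d)"
  define Q where "Q = (\<lambda>\<nu> (w :: nat \<Rightarrow> real) (C :: nat \<Rightarrow> nat \<Rightarrow> nat \<Rightarrow> nat \<Rightarrow> complex).
     (\<forall>k. 0 \<le> w k \<and> povmf d n (C k)) \<and> (\<Sum>k<N. w k) = 1 \<and>
     (\<forall>i<n. \<forall>r<d. \<forall>s<d. M i $$ (r, s) = (\<Sum>k<N. complex_of_real (w k) * C k i r s)) \<and>
     (\<Sum>k<N. w k * defect d n (C k)) \<le> 1 / real (Suc \<nu>))"
  have "\<exists>w C. Q \<nu> w C" for \<nu>
  proof -
    obtain I :: "'z set" and p :: "'z \<Rightarrow> real" and B :: "'z \<Rightarrow> nat \<Rightarrow> nat \<Rightarrow> nat \<Rightarrow> complex" where I: "finite I" "\<forall>z\<in>I. 0 \<le> p z \<and> povmf d n (B z)" "(\<Sum>z\<in>I. p z) = 1"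
       "\<forall>i<n. \<forall>r<d. \<forall>s<d. M i $$ (r, s) = (\<Sum>z\<in>I. complex_of_real (p z) * B z i r s)"
       "(\<Sum>z\<in>I. p z * defect d n (B z)) \<le> 1 / real (Suc \<nu>)"
      using approx[of "1 / real (Suc \<nu>)"] by auto
    show ?thesis
    proof (rule mixture_bounded_terms[of I p d n B, folded N_def])
      fix w :: "nat \<Rightarrow> real" and C :: "nat \<Rightarrow> nat \<Rightarrow> nat \<Rightarrow> nat \<Rightarrow> complex"
      assume "\<And>k. 0 \<le> w k" "(\<Sum>k<N. w k) = (1::real)" "\<And>k. povmf d n (C k)"
        "\<And>i r s. i < n \<Longrightarrow> r < d \<Longrightarrow> s < d \<Longrightarrow>
           (\<Sum>k<N. w k * C k i r s) = (\<Sum>z\<in>I. p z * B z i r s)"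
        "(\<Sum>k<N. w k * defect d n (C k)) = (\<Sum>z\<in>I. p z * defect d n (B z))"
      with I(4,5) have "Q \<nu> w C" unfolding Q_def by simp
      then show ?thesis by blast
    qed (use I in auto)
  qed
  then obtain w C where Q: "\<And>\<nu>. Q \<nu> (w \<nu>) (C \<nu>)" by metis
  have w: "0 \<le> w \<nu> k" "(\<Sum>k<N. w \<nu> k) = 1" for \<nu> k using Q by (auto simp: Q_def)
  have w_le: "w \<nu> k \<le> 1" if "k < N" for \<nu> k
    using member_le_sum[of k "{..<N}" "w \<nu>"] w that by auto
  have C: "povmf d n (C \<nu> k)" for \<nu> k using Q by (auto simp: Q_def)
  \<comment> \<open>The sum type gathers weights and matrix entries in one finite family, so that a
    single subsequence serves all of them.\<close>
  define f where "f = (\<lambda>x \<nu>. case x of Inl k \<Rightarrow> complex_of_real (w \<nu> k) | Inr (k, i, r, s) \<Rightarrow> C \<nu> k i r s)"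
  define X where "X = Inl ` {..<N} \<union> Inr ` ({..<N} \<times> {..<n} \<times> {..<d} \<times> {..<d})"
  have "finite X" by (auto simp: X_def)
  moreover have "bounded (range (f x))" if "x \<in> X" for x
    by (rule boundedI[of _ 1]) (use that w w_le povmf_cmod_le_1[OF C] in \<open>auto simp: f_def X_def\<close>)
  ultimately obtain \<rho> l where \<rho>: "strict_mono \<rho>" "\<forall>x\<in>X. (\<lambda>\<nu>. f x (\<rho> \<nu>)) \<longlonglongrightarrow> l x"
    using common_convergent_subsequence[of X f] by blast
  define w' where "w' = (\<lambda>k. Re (l (Inl k)))"
  define C' where "C' = (\<lambda>k i r s. l (Inr (k, i, r, s)))"
  have wlim: "(\<lambda>\<nu>. w (\<rho> \<nu>) k) \<longlonglongrightarrow> w' k" if "k < N" for k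
    using tendsto_Re[OF bspec[OF \<rho>(2), of "Inl k"]] that by (auto simp: X_def f_def w'_def)
  have Clim: "(\<lambda>\<nu>. C (\<rho> \<nu>) k i r s) \<longlonglongrightarrow> C' k i r s" if "k < N" "i < n" "r < d" "s < d" for k i r s
    using bspec[OF \<rho>(2), of "Inr (k, i, r, s)"] that by (auto simp: X_def f_def C'_def)
  have C': "povmf d n (C' k)" if "k < N" for k
    by (rule povmf_limit[of d n "\<lambda>\<nu>. C (\<rho> \<nu>) k"]) (use C Clim that in auto)
  have w'_nonneg: "0 \<le> w' k" if "k < N" for k
    by (rule LIMSEQ_le_const[OF wlim[OF that]]) (use w in auto)
  show ?thesis
  proof (rule simulable_if_mixture_defect_zero[of n M d N w' C'])
    have "(\<lambda>\<nu>. \<Sum>k<N. w (\<rho> \<nu>) k) \<longlonglongrightarrow> (\<Sum>k<N. w' k)"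
      by (intro tendsto_sum wlim) auto
    then show "(\<Sum>k<N. w' k) = 1" by (simp add: w LIMSEQ_const_iff)
  next
    fix i r s assume irs: "i < n" "r < d" "s < d"
    have "(\<lambda>\<nu>. \<Sum>k<N. w (\<rho> \<nu>) k * C (\<rho> \<nu>) k i r s) \<longlonglongrightarrow> (\<Sum>k<N. w' k * C' k i r s)"
      using irs by (intro tendsto_sum tendsto_mult tendsto_of_real wlim Clim) auto
    moreover have "(\<lambda>\<nu>. \<Sum>k<N. w (\<rho> \<nu>) k * C (\<rho> \<nu>) k i r s) = (\<lambda>\<nu>. M i $$ (r, s))"
      using Q irs by (auto simp: Q_def)
    ultimately show "M i $$ (r, s) = (\<Sum>k<N. w' k * C' k i r s)" by (simp add: LIMSEQ_const_iff)
  next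
    have "(\<lambda>\<nu>. \<Sum>k<N. w (\<rho> \<nu>) k * defect d n (C (\<rho> \<nu>) k)) \<longlonglongrightarrow> (\<Sum>k<N. w' k * defect d n (C' k))"
      unfolding defect_def by (intro tendsto_intros wlim Clim) auto
    moreover have "(\<lambda>\<nu>. 1 / real (Suc (\<rho> \<nu>))) \<longlonglongrightarrow> 0"
      using LIMSEQ_subseq_LIMSEQ[OF LIMSEQ_inverse_real_of_nat \<rho>(1)] by (simp add: o_def inverse_eq_divide)
    ultimately have "(\<Sum>k<N. w' k * defect d n (C' k)) \<le> 0"
      by (rule LIMSEQ_le) (use Q in \<open>auto simp: Q_def\<close>)
    moreover have "0 \<le> (\<Sum>k<N. w' k * defect d n (C' k))"
      by (intro sum_nonneg mult_nonneg_nonneg w'_nonneg defect_nonneg C') auto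
    ultimately show "(\<Sum>k<N. w' k * defect d n (C' k)) = 0" by simp
  qed (use M C' w'_nonneg in auto)
qed

section \<open>Exchangeable kernels\<close>

text \<open>Since the effects sum to the identity, the trace of \<open>B i\<close> is the sum over
  \<open>j\<close> of the traces of \<open>B i\<close> times \<open>B j\<close>; removing
  \<open>j = i\<close> leaves the products of different effects, to which the swap condition
  applies.\<close>

lemma povmf_defect_eq:
  assumes "povmf d n B"
  shows "complex_of_real (defect d n B) =
    (\<Sum>i<n. \<Sum>j\<in>{..<n} - {i}. \<Sum>r<d. \<Sum>s<d. B i r s * B j s r)"
proof -
  have psd: "psdf d (B i)" if "i < n" for i using assms that by (simp add: povmf_def)
  have "complex_of_real (Re (B i r r) - (\<Sum>s<d. (cmod (B i s r))\<^sup>2)) =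
      (\<Sum>j\<in>{..<n} - {i}. \<Sum>s<d. B i r s * B j s r)" if i: "i < n" and r: "r < d" for i r
  proof -
    have "(\<Sum>j<n. \<Sum>s<d. B i r s * B j s r) = (\<Sum>s<d. B i r s * (\<Sum>j<n. B j s r))"
      by (subst sum.swap) (simp add: sum_distrib_left)
    also have "\<dots> = (\<Sum>s<d. if s = r then B i r s else 0)"
      using assms r by (intro sum.cong) (auto simp: povmf_def)
    also have "\<dots> = B i r r" using r by simp
    also have "\<dots> = Re (B i r r)"
      using psdf_diag[OF psd[OF i] r] by (auto simp: less_eq_complex_def complex_eq_iff)
    finally have "(\<Sum>j<n. \<Sum>s<d. B i r s * B j s r) = Re (B i r r)" .
    moreover have "(\<Sum>j<n. \<Sum>s<d. B i r s * B j s r) = (\<Sum>s<d. B i r s * B i s r)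
        + (\<Sum>j\<in>{..<n} - {i}. \<Sum>s<d. B i r s * B j s r)"
      using i by (subst sum.remove[of _ i]) auto
    ultimately show ?thesis
      unfolding square_diag[OF psd[OF i] r] of_real_diff by (simp only: algebra_simps)
  qed
  then have "complex_of_real (defect d n B) = (\<Sum>i<n. \<Sum>r<d. \<Sum>j\<in>{..<n} - {i}. \<Sum>s<d. B i r s * B j s r)"
    unfolding defect_def of_real_sum by simp
  also have "\<dots> = (\<Sum>i<n. \<Sum>j\<in>{..<n} - {i}. \<Sum>r<d. \<Sum>s<d. B i r s * B j s r)"
    by (intro sum.cong refl sum.swap)
  finally show ?thesis .
qed

section \<open>Probe vectors and polarisation\<close>

text \<open>The probe \<open>(i, r, s, q)\<close> measures outcome \<open>i\<close> together with the vector \<open>e\<^sub>r + \<i>\<^sup>q e\<^sub>s\<close>. The four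
  phases recover every matrix entry by polarisation, and the projectors onto all probe vectors add up
  to \<open>8 d\<close> times the identity.\<close>

type_synonym letter = "nat \<times> nat \<times> nat \<times> nat"

fun probe :: "letter \<Rightarrow> nat \<Rightarrow> complex" where
  "probe (i, r, s, q) t = (if t = r then 1 else 0) + (if t = s then \<i> ^ q else 0)"

text \<open>Coordinates of the tensor product of probe vectors. The value \<open>1\<close> is the
  empty product; the digit words paired with \<open>z\<close> below have the length of
  \<open>z\<close>.\<close>

fun probes :: "letter list \<Rightarrow> nat list \<Rightarrow> complex" where
  "probes (a # z) (t # x) = probe a t * probes z x"
| "probes _ _ = 1"

lemma ip_app_probe:
  assumes "r < d" "s < d"
  shows "ip d (probe (i, r, s, q)) (app d C (probe (i, r, s, q))) =
    C r r + \<i> ^ q * C r s + cnj (\<i> ^ q) * C s r + cnj (\<i> ^ q) * \<i> ^ q * C s s"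
proof -
  have "probe (i, r, s, q) = (\<lambda>t. (if t = r then 1 else 0) + (if t = s then \<i> ^ q else 0))"
    by auto
  then show ?thesis using ip_app_pair[OF assms, of "\<i> ^ q" C] by (simp only:)
qed

lemma sum_lessThan_4: "(\<Sum>q<4. g q) = g 0 + g 1 + g 2 + g (3::nat)"
  by (simp add: eval_nat_numeral)

text \<open>The factor \<open>(- \<i>) ^ q\<close> cancels exactly the phase of the term with
  \<open>C r s\<close>; in the other three terms the remaining phases sum to zero over
  \<open>q\<close>.\<close>

lemma probe_polarisation:
  assumes "r < d" "s < d"
  shows "(\<Sum>q<4. (- \<i>) ^ q * ip d (probe (i, r, s, q)) (app d C (probe (i, r, s, q)))) = 4 * C r s"
  unfolding ip_app_probe[OF assms] sum_lessThan_4
  by (simp add: power2_eq_square power3_eq_cube algebra_simps)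

lemma probe_total:
  assumes "r < d" "s < d"
  shows "(\<Sum>q<4. ip d (probe (i, r, s, q)) (app d C (probe (i, r, s, q)))) = 4 * (C r r + C s s)"
  unfolding ip_app_probe[OF assms] sum_lessThan_4
  by (simp add: power2_eq_square power3_eq_cube algebra_simps)

text \<open>\<open>K is x y\<close> plays the entry at digits \<open>x\<close>, \<open>y\<close> of
  an operator on \<open>length is\<close> tensor factors with outcomes \<open>is\<close>, the
  remaining factors being traced out with normalised trace. Swap, marginal and orthogonality are
  conditions (4), (5) and (3), formulated at the head of the words.\<close>

locale exchangeable_kernel =
  fixes d n m :: nat and K :: "nat list \<Rightarrow> nat list \<Rightarrow> nat list \<Rightarrow> complex"
  assumes d_pos: "0 < d"
    and kernel_pos: "k \<le> m \<Longrightarrow> is \<in> words {..<n} k \<Longrightarrow>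
      0 \<le> (\<Sum>x\<in>words {..<d} k. \<Sum>y\<in>words {..<d} k. cnj (u x) * K is x y * u y)"
    and kernel_swap: "k + 2 \<le> m \<Longrightarrow> is \<in> words {..<n} k \<Longrightarrow> x \<in> words {..<d} k \<Longrightarrow> y \<in> words {..<d} k \<Longrightarrow>
      i < n \<Longrightarrow> j < n \<Longrightarrow> r < d \<Longrightarrow> r' < d \<Longrightarrow> s < d \<Longrightarrow> s' < d \<Longrightarrow>
      K (i # j # is) (r # r' # x) (s # s' # y) = K (j # i # is) (r' # r # x) (s' # s # y)"
    and kernel_marginal: "k < m \<Longrightarrow> is \<in> words {..<n} k \<Longrightarrow> x \<in> words {..<d} k \<Longrightarrow> y \<in> words {..<d} k \<Longrightarrow>
      r < d \<Longrightarrow> s < d \<Longrightarrow> (\<Sum>i<n. K (i # is) (r # x) (s # y)) = (if r = s then K is x y else 0)"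
    and kernel_orthogonal: "k + 2 \<le> m \<Longrightarrow> is \<in> words {..<n} k \<Longrightarrow> x \<in> words {..<d} k \<Longrightarrow> y \<in> words {..<d} k \<Longrightarrow>
      i < n \<Longrightarrow> j < n \<Longrightarrow> i \<noteq> j \<Longrightarrow> s < d \<Longrightarrow> s' < d \<Longrightarrow> (\<Sum>r<d. K (i # j # is) (s # r # x) (r # s' # y)) = 0"
    and kernel_Nil: "K [] [] [] = 1"
begin

section \<open>Contraction of the kernel with probe vectors\<close>

definition letters :: "letter set" where
  "letters = {..<n} \<times> {..<d} \<times> {..<d} \<times> {..<4}"

lemma finite_letters [simp]: "finite letters"
  by (simp add: letters_def)

lemma sum_letters: "(\<Sum>a\<in>letters. g a) = (\<Sum>i<n. \<Sum>r<d. \<Sum>s<d. \<Sum>q<4. g (i, r, s, q))"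
  by (simp add: letters_def sum.cartesian_product case_prod_unfold)

lemma map_fst_letters: "z \<in> words letters k \<Longrightarrow> map fst z \<in> words {..<n} k"
  by (auto simp: words_def letters_def)

text \<open>The unnormalised probability of the word \<open>z\<close>: the quadratic form of the
  kernel at the product of its probes. In \<open>effect\<close> and \<open>effect2\<close> one or
  two further factors are left open, which gives operators on these factors.\<close>

definition weight :: "letter list \<Rightarrow> complex" where
  "weight z = (\<Sum>x\<in>words {..<d} (length z). \<Sum>y\<in>words {..<d} (length z).
     cnj (probes z x) * K (map fst z) x y * probes z y)"

definition effect :: "letter list \<Rightarrow> nat \<Rightarrow> nat \<Rightarrow> nat \<Rightarrow> complex" where
  "effect z i r s = (\<Sum>x\<in>words {..<d} (length z). \<Sum>y\<in>words {..<d} (length z).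
     cnj (probes z x) * K (i # map fst z) (r # x) (s # y) * probes z y)"

definition effect2 :: "letter list \<Rightarrow> nat \<Rightarrow> nat \<Rightarrow> nat \<Rightarrow> nat \<Rightarrow> nat \<Rightarrow> nat \<Rightarrow> complex" where
  "effect2 z i j r r' s s' = (\<Sum>x\<in>words {..<d} (length z). \<Sum>y\<in>words {..<d} (length z).
     cnj (probes z x) * K (i # j # map fst z) (r # r' # x) (s # s' # y) * probes z y)"

lemma weight_Cons: "weight (a # z) = ip d (probe a) (app d (effect z (fst a)) (probe a))"
proof -
  let ?W = "words {..<d} (length z)"
  have "weight (a # z) = (\<Sum>r<d. \<Sum>x\<in>?W. \<Sum>s<d. \<Sum>y\<in>?W. cnj (probe a r) *
      (cnj (probes z x) * K (fst a # map fst z) (r # x) (s # y) * probes z y) * probe a s)"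
    by (simp add: weight_def sum_words_Suc mult_ac)
  also have "\<dots> = (\<Sum>r<d. \<Sum>s<d. \<Sum>x\<in>?W. \<Sum>y\<in>?W. cnj (probe a r) *
      (cnj (probes z x) * K (fst a # map fst z) (r # x) (s # y) * probes z y) * probe a s)"
    by (intro sum.cong refl sum.swap)
  also have "\<dots> = ip d (probe a) (app d (effect z (fst a)) (probe a))"
    by (simp add: ip_app effect_def sum_distrib_left sum_distrib_right)
  finally show ?thesis .
qed

lemma effect_Cons:
  "effect (a # z) i r s = ip d (probe a) (app d (\<lambda>r' s'. effect2 z i (fst a) r r' s s') (probe a))"
proof -
  let ?W = "words {..<d} (length z)"
  have "effect (a # z) i r s = (\<Sum>r'<d. \<Sum>x\<in>?W. \<Sum>s'<d. \<Sum>y\<in>?W. cnj (probe a r') *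
      (cnj (probes z x) * K (i # fst a # map fst z) (r # r' # x) (s # s' # y) * probes z y) * probe a s')"
    by (simp add: effect_def sum_words_Suc mult_ac)
  also have "\<dots> = (\<Sum>r'<d. \<Sum>s'<d. \<Sum>x\<in>?W. \<Sum>y\<in>?W. cnj (probe a r') *
      (cnj (probes z x) * K (i # fst a # map fst z) (r # r' # x) (s # s' # y) * probes z y) * probe a s')"
    by (intro sum.cong refl sum.swap)
  also have "\<dots> = ip d (probe a) (app d (\<lambda>r' s'. effect2 z i (fst a) r r' s s') (probe a))"
    by (simp add: ip_app effect2_def sum_distrib_left sum_distrib_right)
  finally show ?thesis .
qed

lemma weight_nonneg: "k \<le> m \<Longrightarrow> z \<in> words letters k \<Longrightarrow> 0 \<le> weight z"
  using kernel_pos[OF _ map_fst_letters, of k z "probes z"] by (simp add: weight_def words_length)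

lemma effect_psd:
  assumes "k < m" "z \<in> words letters k" "i < n"
  shows "psdf d (effect z i)"
  unfolding psdf_def
proof
  fix u
  let ?W = "words {..<d} k"
  have word: "i # map fst z \<in> words {..<n} (Suc k)" using assms map_fst_letters by simp
  \<comment> \<open>Positivity of the kernel is used at the tensor product of \<open>u\<close> with
    the probes of \<open>z\<close>, written on words through \<open>hd\<close> and
    \<open>tl\<close>.\<close>
  have "0 \<le> (\<Sum>x\<in>words {..<d} (Suc k). \<Sum>y\<in>words {..<d} (Suc k).
      cnj (u (hd x) * probes z (tl x)) * K (i # map fst z) x y * (u (hd y) * probes z (tl y)))"
    using kernel_pos[of "Suc k", OF _ word, of "\<lambda>x. u (hd x) * probes z (tl x)"] assms by simp
  also have "\<dots> = (\<Sum>r<d. \<Sum>x\<in>?W. \<Sum>s<d. \<Sum>y\<in>?W. cnj (u r) *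
      (cnj (probes z x) * K (i # map fst z) (r # x) (s # y) * probes z y) * u s)"
    by (simp add: sum_words_Suc mult_ac)
  also have "\<dots> = (\<Sum>r<d. \<Sum>s<d. \<Sum>x\<in>?W. \<Sum>y\<in>?W. cnj (u r) *
      (cnj (probes z x) * K (i # map fst z) (r # x) (s # y) * probes z y) * u s)"
    by (intro sum.cong refl sum.swap)
  also have "\<dots> = ip d u (app d (effect z i) u)"
    using assms by (simp add: ip_app effect_def sum_distrib_left sum_distrib_right words_length)
  finally show "0 \<le> ip d u (app d (effect z i) u)" .
qed

text \<open>The marginal condition enters here: the operators left on an unmeasured factor sum to a
  multiple of the identity, so dividing by \<open>weight z\<close> makes them a POVM.\<close>

lemma sum_effect:
  assumes "k < m" "z \<in> words letters k" "r < d" "s < d"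
  shows "(\<Sum>i<n. effect z i r s) = (if r = s then weight z else 0)"
proof -
  let ?W = "words {..<d} k"
  have "(\<Sum>i<n. effect z i r s) = (\<Sum>x\<in>?W. \<Sum>y\<in>?W. cnj (probes z x) *
      (\<Sum>i<n. K (i # map fst z) (r # x) (s # y)) * probes z y)"
    unfolding effect_def words_length[OF assms(2)]
    by (subst sum.swap, rule sum.cong[OF refl], subst sum.swap)
      (simp add: sum_distrib_left sum_distrib_right)
  also have "\<dots> = (\<Sum>x\<in>?W. \<Sum>y\<in>?W. cnj (probes z x) *
      (if r = s then K (map fst z) x y else 0) * probes z y)"
    by (intro sum.cong refl arg_cong2[where f = "(*)"] kernel_marginal[OF assms(1)] map_fst_letters assms)
  also have "\<dots> = (if r = s then weight z else 0)"
    using assms by (simp add: weight_def words_length)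
  finally show ?thesis .
qed

lemma sum_weight_Cons:
  assumes "k < m" "z \<in> words letters k"
  shows "(\<Sum>a\<in>letters. weight (a # z)) = 8 * of_nat d ^ 2 * weight z"
proof -
  have "(\<Sum>a\<in>letters. weight (a # z)) = (\<Sum>i<n. \<Sum>r<d. \<Sum>s<d. 4 * (effect z i r r + effect z i s s))"
    unfolding sum_letters weight_Cons fst_conv
    by (intro sum.cong refl probe_total) auto
  also have "\<dots> = (\<Sum>r<d. \<Sum>s<d. 4 * ((\<Sum>i<n. effect z i r r) + (\<Sum>i<n. effect z i s s)))"
    by (subst sum.swap, rule sum.cong[OF refl], subst sum.swap)
      (simp add: sum.distrib sum_distrib_left)
  also have "\<dots> = (\<Sum>r<d. \<Sum>s<d. 8 * weight z)"
    using sum_effect[OF assms] by simp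
  finally show ?thesis by (simp add: power2_eq_square)
qed

lemma weight_exchange:
  assumes "k + 2 \<le> m" "z \<in> words letters k" "a \<in> letters" "b \<in> letters"
  shows "weight (a # b # z) = weight (b # a # z)"
proof -
  let ?W = "words {..<d} k"
  define h where "h = (\<lambda>a b r r' x s s' y. cnj (probe a r * probe b r' * probes z x) *
      K (fst a # fst b # map fst z) (r # r' # x) (s # s' # y) * (probe a s * probe b s' * probes z y))"
  have eq: "weight (a # b # z) = (\<Sum>r<d. \<Sum>r'<d. \<Sum>x\<in>?W. \<Sum>s<d. \<Sum>s'<d. \<Sum>y\<in>?W. h a b r r' x s s' y)" for a b
    using assms(2) by (simp add: weight_def sum_words_Suc words_length h_def mult.assoc)
  have "h a b r r' x s s' y = h b a r' r x s' s y"
    if "r < d" "r' < d" "s < d" "s' < d" "x \<in> ?W" "y \<in> ?W" for r r' s s' x y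
    unfolding h_def using assms(3,4) that
    by (subst kernel_swap[OF assms(1) map_fst_letters[OF assms(2)]]) (auto simp: letters_def mult_ac)
  then have "weight (a # b # z) = (\<Sum>r<d. \<Sum>r'<d. \<Sum>x\<in>?W. \<Sum>s<d. \<Sum>s'<d. \<Sum>y\<in>?W. h b a r' r x s' s y)"
    unfolding eq by (intro sum.cong refl) auto
  also have "\<dots> = (\<Sum>r<d. \<Sum>r'<d. \<Sum>x\<in>?W. \<Sum>s'<d. \<Sum>s<d. \<Sum>y\<in>?W. h b a r' r x s' s y)"
    by (intro sum.cong refl sum.swap)
  also have "\<dots> = weight (b # a # z)"
    unfolding eq by (rule sum.swap)
  finally show ?thesis .
qed

text \<open>Each letter contributes \<open>8 * real d ^ 2\<close>: a factor \<open>8 d\<close> from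
  the sum of the probe projectors and a factor \<open>d\<close> from the trace of the
  identity.\<close>

definition prob :: "letter list \<Rightarrow> real" where
  "prob z = Re (weight z) / (8 * real d ^ 2) ^ length z"

lemma weight_eq:
  assumes "k \<le> m" "z \<in> words letters k"
  shows "weight z = complex_of_real ((8 * real d ^ 2) ^ k * prob z)"
  using weight_nonneg[OF assms] assms(2) d_pos
  by (auto simp: prob_def words_length less_eq_complex_def complex_eq_iff)

lemma exchangeable_weights: "exchangeable_weights letters m prob"
proof
  fix z k assume z: "z \<in> words letters k"
  show "k \<le> m \<Longrightarrow> 0 \<le> prob z"
    using weight_nonneg[of k z] z by (simp add: prob_def less_eq_complex_def)
  show "(\<Sum>a\<in>letters. prob (a # z)) = prob z" if "k < m"
  proof -
    have "(\<Sum>a\<in>letters. prob (a # z)) = Re (\<Sum>a\<in>letters. weight (a # z)) / (8 * real d ^ 2) ^ Suc k"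
      using z by (simp add: prob_def sum_divide_distrib words_length)
    also have "Re (\<Sum>a\<in>letters. weight (a # z)) = 8 * real d ^ 2 * Re (weight z)"
      unfolding sum_weight_Cons[OF that z] by (simp add: power2_eq_square)
    finally show ?thesis using z d_pos by (simp add: prob_def words_length)
  qed
  show "prob (a # b # z) = prob (b # a # z)" if "k + 2 \<le> m" "a \<in> letters" "b \<in> letters" for a b
    using weight_exchange[OF that(1) z that(2,3)] by (simp add: prob_def)
qed (simp_all add: prob_def weight_def kernel_Nil)

sublocale exchangeable_weights letters m prob
  by (rule exchangeable_weights)

text \<open>Polarisation in the open factor. The constant is the normalisation of
  \<open>k + 1\<close> letters divided by the \<open>4\<close> of polarisation; in
  \<open>effect2_eq\<close> the same is done in both open factors.\<close>

lemma effect_eq: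
  assumes "k < m" "z \<in> words letters k" "i < n" "r < d" "s < d"
  shows "effect z i r s = complex_of_real (2 * real d ^ 2 * (8 * real d ^ 2) ^ k) *
    (\<Sum>q<4. (- \<i>) ^ q * complex_of_real (prob ((i, r, s, q) # z)))"
proof -
  have "4 * effect z i r s = (\<Sum>q<4. (- \<i>) ^ q * weight ((i, r, s, q) # z))"
    using probe_polarisation[OF assms(4,5), of i "effect z i"] by (simp add: weight_Cons)
  also have "\<dots> = (\<Sum>q<4. (- \<i>) ^ q * complex_of_real ((8 * real d ^ 2) ^ Suc k * prob ((i, r, s, q) # z)))"
    by (intro sum.cong refl arg_cong2[where f = "(*)"] weight_eq) (use assms in \<open>auto simp: letters_def\<close>)
  also have "\<dots> = 4 * (complex_of_real (2 * real d ^ 2 * (8 * real d ^ 2) ^ k) *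
    (\<Sum>q<4. (- \<i>) ^ q * complex_of_real (prob ((i, r, s, q) # z))))"
    by (simp add: sum_distrib_left mult_ac)
  finally show ?thesis by simp
qed

lemma effect2_eq:
  assumes "k + 2 \<le> m" "z \<in> words letters k" "i < n" "r < d" "s < d" "j < n" "r' < d" "s' < d"
  shows "effect2 z i j r r' s s' = complex_of_real ((2 * real d ^ 2)\<^sup>2 * (8 * real d ^ 2) ^ k) *
    (\<Sum>q<4. \<Sum>q'<4. (- \<i>) ^ q * (- \<i>) ^ q' * complex_of_real (prob ((i, r, s, q) # (j, r', s', q') # z)))"
proof -
  have "4 * effect2 z i j r r' s s' = (\<Sum>q'<4. (- \<i>) ^ q' * effect ((j, r', s', q') # z) i r s)"
    using probe_polarisation[OF assms(7,8), of j "\<lambda>r' s'. effect2 z i j r r' s s'"]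
    by (simp add: effect_Cons)
  also have "\<dots> = (\<Sum>q'<4. (- \<i>) ^ q' * (complex_of_real (2 * real d ^ 2 * (8 * real d ^ 2) ^ Suc k) *
    (\<Sum>q<4. (- \<i>) ^ q * complex_of_real (prob ((i, r, s, q) # (j, r', s', q') # z)))))"
    by (intro sum.cong refl arg_cong2[where f = "(*)"] effect_eq) (use assms in \<open>auto simp: letters_def\<close>)
  also have "\<dots> = 4 * (complex_of_real ((2 * real d ^ 2)\<^sup>2 * (8 * real d ^ 2) ^ k) *
    (\<Sum>q'<4. \<Sum>q<4. (- \<i>) ^ q * (- \<i>) ^ q' * complex_of_real (prob ((i, r, s, q) # (j, r', s', q') # z))))"
    by (simp add: sum_distrib_left power2_eq_square mult_ac)
  finally show ?thesis by (subst sum.swap) simp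
qed

text \<open>The index pattern is the trace of the swap against the operator on the two open factors;
  condition (3), contracted with the probes of the others, makes it vanish.\<close>

lemma effect2_trace:
  assumes "k + 2 \<le> m" "z \<in> words letters k" "i < n" "j < n" "i \<noteq> j"
  shows "(\<Sum>s<d. \<Sum>r<d. effect2 z i j s r r s) = 0"
proof (rule sum.neutral, rule ballI)
  fix s assume s: "s \<in> {..<d}"
  let ?W = "words {..<d} k"
  have "(\<Sum>r<d. effect2 z i j s r r s) = (\<Sum>x\<in>?W. \<Sum>y\<in>?W. cnj (probes z x) *
      (\<Sum>r<d. K (i # j # map fst z) (s # r # x) (r # s # y)) * probes z y)"
    unfolding effect2_def words_length[OF assms(2)]
    by (subst sum.swap, rule sum.cong[OF refl], subst sum.swap)
      (simp add: sum_distrib_left sum_distrib_right)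
  also have "\<dots> = 0"
    using kernel_orthogonal[OF assms(1) map_fst_letters[OF assms(2)] _ _ assms(3-5)] s
    by (intro sum.neutral ballI) simp
  finally show "(\<Sum>r<d. effect2 z i j s r r s) = 0" .
qed

section \<open>Conditional POVMs and their mean defect\<close>

definition branch :: "letter list \<Rightarrow> nat \<Rightarrow> nat \<Rightarrow> nat \<Rightarrow> complex" where
  "branch z i r s = effect z i r s / weight z"

lemma povmf_branch:
  assumes "k < m" "z \<in> words letters k" "prob z \<noteq> 0"
  shows "povmf d n (branch z)"
  unfolding povmf_def
proof (intro conjI allI impI)
  have w0: "0 \<le> weight z" using weight_nonneg[of k z] assms by simp
  fix i assume i: "i < n"
  show "psdf d (branch z i)"
    unfolding psdf_def
  proof
    fix u
    have "ip d u (app d (branch z i) u) = ip d u (app d (effect z i) u) / weight z"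
      by (simp add: ip_app branch_def sum_divide_distrib)
    moreover have "0 \<le> ip d u (app d (effect z i) u)"
      using effect_psd[OF assms(1,2) i] by (simp add: psdf_def)
    ultimately show "0 \<le> ip d u (app d (branch z i) u)"
      using w0 by (simp add: less_eq_complex_def Re_divide Im_divide)
  qed
next
  have w: "weight z \<noteq> 0" using assms by (auto simp: prob_def)
  fix r s assume rs: "r < d" "s < d"
  have "(\<Sum>i<n. branch z i r s) = (\<Sum>i<n. effect z i r s) / weight z"
    by (simp add: branch_def sum_divide_distrib)
  then show "(\<Sum>i<n. branch z i r s) = (if r = s then 1 else 0)"
    using sum_effect[OF assms(1,2) rs] w by simp
qed

text \<open>With the denominator cleared the entry is linear in the weights of words one letter
  longer. For \<open>prob z = 0\<close> both sides vanish, so the identity can be summed over all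
  \<open>z\<close>.\<close>

lemma prob_branch:
  assumes "k < m" "z \<in> words letters k" "i < n" "r < d" "s < d"
  shows "prob z * branch z i r s =
    complex_of_real (2 * real d ^ 2) * (\<Sum>q<4. (- \<i>) ^ q * complex_of_real (prob ((i, r, s, q) # z)))"
proof (cases "prob z = 0")
  case True
  have "prob ((i, r, s, q) # z) = 0" if "q < 4" for q
    using Cons_zero[OF assms(2,1) _ True] assms that by (simp add: letters_def)
  then show ?thesis using True by simp
next
  case False
  then show ?thesis
    using d_pos unfolding branch_def effect_eq[OF assms] weight_eq[OF less_imp_le[OF assms(1)] assms(2)]
    by (simp add: field_simps)
qed

text \<open>By \<open>prob_branch\<close> and \<open>total_Cons\<close> the average does not depend
  on \<open>k\<close>, and for \<open>k = 0\<close> the only term is the unconditioned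
  operator.\<close>

lemma mixture_branch:
  assumes "k < m" "i < n" "r < d" "s < d"
  shows "(\<Sum>z\<in>words letters k. prob z * branch z i r s) = K [i] [r] [s]"
proof -
  have eq: "(\<Sum>z\<in>words letters k. prob z * branch z i r s) =
      complex_of_real (2 * real d ^ 2) * (\<Sum>q<4. (- \<i>) ^ q * complex_of_real (prob [(i, r, s, q)]))"
    if "k < m" for k
  proof -
    have "(\<Sum>z\<in>words letters k. prob z * branch z i r s) = (\<Sum>z\<in>words letters k.
      complex_of_real (2 * real d ^ 2) * (\<Sum>q<4. (- \<i>) ^ q * complex_of_real (prob ((i, r, s, q) # z))))"
      using that assms by (intro sum.cong refl prob_branch)
    also have "\<dots> = complex_of_real (2 * real d ^ 2) * (\<Sum>q<4. (- \<i>) ^ q *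
        complex_of_real (\<Sum>z\<in>words letters k. prob ((i, r, s, q) # z)))"
      unfolding of_real_sum sum_distrib_left by (subst sum.swap) simp
    also have "\<dots> = complex_of_real (2 * real d ^ 2) * (\<Sum>q<4. (- \<i>) ^ q * complex_of_real (prob [(i, r, s, q)]))"
      using that assms by (intro arg_cong2[where f = "(*)"] sum.cong refl arg_cong[where f = complex_of_real]
          total_Cons) (auto simp: letters_def)
    finally show ?thesis .
  qed
  have "effect [] i r s = K [i] [r] [s]" by (simp add: effect_def)
  moreover have "prob [] * branch [] i r s = effect [] i r s"
    using normalised kernel_Nil by (simp add: branch_def weight_def)
  ultimately show ?thesis using eq[of 0] eq[of k] assms by simp
qed

text \<open>Up to the factor \<open>prob z\<close>, the trace of the product is a phase sum over
  products of conditional probabilities. Replacing each product by joint probability minus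
  covariance leaves only the covariances, because the joint part is the swap expectation
  \<open>effect2_trace\<close>.\<close>

lemma branch_pair:
  assumes km: "k + 2 \<le> m" and z: "z \<in> words letters k" and nz: "prob z \<noteq> 0"
    and ij: "i < n" "j < n" "i \<noteq> j"
  shows "prob z * (\<Sum>r<d. \<Sum>s<d. branch z i r s * branch z j s r) =
    - complex_of_real ((2 * real d ^ 2)\<^sup>2) * (\<Sum>r<d. \<Sum>s<d. \<Sum>q<4. \<Sum>q'<4.
      (- \<i>) ^ q * (- \<i>) ^ q' * complex_of_real (corr (i, r, s, q) (j, s, r, q') z))"
proof -
  define C where "C = complex_of_real ((2 * real d ^ 2)\<^sup>2)"
  have prod: "prob z * (branch z i r s * branch z j s r) = C * (\<Sum>q<4. \<Sum>q'<4. (- \<i>) ^ q * (- \<i>) ^ q' *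
      complex_of_real (prob ((i, r, s, q) # z) * prob ((j, s, r, q') # z) / prob z))"
    if rs: "r < d" "s < d" for r s
  proof -
    have "prob z * (branch z i r s * branch z j s r) =
        (prob z * branch z i r s) * (prob z * branch z j s r) / prob z"
      using nz by simp
    also have "\<dots> = C * ((\<Sum>q<4. (- \<i>) ^ q * complex_of_real (prob ((i, r, s, q) # z))) *
        (\<Sum>q<4. (- \<i>) ^ q * complex_of_real (prob ((j, s, r, q) # z)))) / prob z"
      using km z ij rs by (subst (1 2) prob_branch) (auto simp: C_def power2_eq_square)
    also have "\<dots> = C * (\<Sum>q<4. \<Sum>q'<4. (- \<i>) ^ q * (- \<i>) ^ q' *
      complex_of_real (prob ((i, r, s, q) # z) * prob ((j, s, r, q') # z) / prob z))"
      unfolding sum_product by (simp add: sum_distrib_left sum_divide_distrib mult_ac)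
    finally show ?thesis .
  qed
  have "complex_of_real ((2 * real d ^ 2)\<^sup>2 * (8 * real d ^ 2) ^ k) * (\<Sum>r<d. \<Sum>s<d. \<Sum>q<4. \<Sum>q'<4.
      (- \<i>) ^ q * (- \<i>) ^ q' * complex_of_real (prob ((i, r, s, q) # (j, s, r, q') # z)))
    = (\<Sum>r<d. \<Sum>s<d. effect2 z i j r s s r)"
    unfolding sum_distrib_left[of _ _ "{..<d}"]
    by (intro sum.cong refl effect2_eq[symmetric] km z ij) auto
  also have "\<dots> = 0" by (rule effect2_trace[OF km z ij])
  finally have zero: "(\<Sum>r<d. \<Sum>s<d. \<Sum>q<4. \<Sum>q'<4.
      (- \<i>) ^ q * (- \<i>) ^ q' * complex_of_real (prob ((i, r, s, q) # (j, s, r, q') # z))) = 0"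
    using d_pos by simp
  have "prob z * (\<Sum>r<d. \<Sum>s<d. branch z i r s * branch z j s r) =
      C * (\<Sum>r<d. \<Sum>s<d. \<Sum>q<4. \<Sum>q'<4. (- \<i>) ^ q * (- \<i>) ^ q' *
      complex_of_real (prob ((i, r, s, q) # z) * prob ((j, s, r, q') # z) / prob z))"
    unfolding sum_distrib_left[of _ _ "{..<d}"] by (intro sum.cong refl prod) auto
  also have "\<dots> = - C * (\<Sum>r<d. \<Sum>s<d. \<Sum>q<4. \<Sum>q'<4.
      (- \<i>) ^ q * (- \<i>) ^ q' * complex_of_real (corr (i, r, s, q) (j, s, r, q') z))"
    using zero by (simp add: corr_def right_diff_distrib sum_subtractf)
  finally show ?thesis by (simp only: C_def)
qed

text \<open>All phases have modulus one, so \<open>branch_pair\<close> turns the off-diagonal traces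
  into a sum of absolute covariances.\<close>

lemma branch_defect_le:
  assumes km: "k + 2 \<le> m" and z: "z \<in> words letters k"
  shows "prob z * defect d n (branch z) \<le> (2 * real d ^ 2)\<^sup>2 * (\<Sum>a\<in>letters. \<Sum>b\<in>letters. \<bar>corr a b z\<bar>)"
proof (cases "prob z = 0")
  case True
  then show ?thesis by (simp add: sum_nonneg)
next
  case False
  define g where "g = (\<lambda>i j r s. \<Sum>q<4. \<Sum>q'<4. \<bar>corr (i, r, s, q) (j, s, r, q') z\<bar>)"
  have povm: "povmf d n (branch z)" using povmf_branch[OF _ z False] km by simp
  have pair: "cmod (prob z * (\<Sum>r<d. \<Sum>s<d. branch z i r s * branch z j s r)) \<le>
      (2 * real d ^ 2)\<^sup>2 * (\<Sum>r<d. \<Sum>s<d. g i j r s)" if ij: "i < n" "j < n" "i \<noteq> j" for i j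
  proof -
    have "cmod (\<Sum>r<d. \<Sum>s<d. \<Sum>q<4. \<Sum>q'<4. (- \<i>) ^ q * (- \<i>) ^ q' *
        complex_of_real (corr (i, r, s, q) (j, s, r, q') z)) \<le> (\<Sum>r<d. \<Sum>s<d. g i j r s)"
      unfolding g_def
      by (intro sum_norm_le) (simp add: norm_mult norm_power)
    then show ?thesis
      unfolding branch_pair[OF km z False ij] norm_mult norm_minus_cancel norm_of_real
      by (simp add: mult_left_mono)
  qed
  have "prob z * defect d n (branch z) = Re (prob z * complex_of_real (defect d n (branch z)))"
    by simp
  also have "\<dots> \<le> cmod (prob z * complex_of_real (defect d n (branch z)))"
    by (rule complex_Re_le_cmod)
  also have "\<dots> \<le> (\<Sum>i<n. \<Sum>j\<in>{..<n} - {i}. (2 * real d ^ 2)\<^sup>2 * (\<Sum>r<d. \<Sum>s<d. g i j r s))"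
    unfolding povmf_defect_eq[OF povm] sum_distrib_left[of _ _ "{..<n}"] sum_distrib_left[of _ _ "{..<n} - _"]
    by (intro sum_norm_le pair) auto
  also have "\<dots> = (2 * real d ^ 2)\<^sup>2 * (\<Sum>i<n. \<Sum>j\<in>{..<n} - {i}. \<Sum>r<d. \<Sum>s<d. g i j r s)"
    by (simp only: sum_distrib_left)
  also have "\<dots> \<le> (2 * real d ^ 2)\<^sup>2 * (\<Sum>a\<in>letters. \<Sum>b\<in>letters. \<bar>corr a b z\<bar>)"
  proof (intro mult_left_mono)
    \<comment> \<open>Only pairs occur in which the second letter carries the matrix indices of the
      first in reversed order; all other pairs are added as nonnegative terms.\<close>
    have inner: "(\<Sum>j<n. \<Sum>q'<4. \<bar>corr (i, r, s, q) (j, s, r, q') z\<bar>) \<le> (\<Sum>b\<in>letters. \<bar>corr (i, r, s, q) b z\<bar>)"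
      if "r < d" "s < d" for i r s q
    proof -
      have "(\<Sum>q'<4. \<bar>corr (i, r, s, q) (j, s, r, q') z\<bar>) \<le>
          (\<Sum>r'<d. \<Sum>s'<d. \<Sum>q'<4. \<bar>corr (i, r, s, q) (j, r', s', q') z\<bar>)" for j
        using member_le_sum[of r "{..<d}" "\<lambda>s'. \<Sum>q'<4. \<bar>corr (i, r, s, q) (j, s, s', q') z\<bar>"]
          member_le_sum[of s "{..<d}" "\<lambda>r'. \<Sum>s'<d. \<Sum>q'<4. \<bar>corr (i, r, s, q) (j, r', s', q') z\<bar>"] that
        by (force simp: sum_nonneg)
      then show ?thesis unfolding sum_letters by (rule sum_mono)
    qed
    have "(\<Sum>i<n. \<Sum>j\<in>{..<n} - {i}. \<Sum>r<d. \<Sum>s<d. g i j r s) \<le> (\<Sum>i<n. \<Sum>j<n. \<Sum>r<d. \<Sum>s<d. g i j r s)"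
      unfolding g_def by (intro sum_mono sum_mono2 sum_nonneg) auto
    also have "\<dots> = (\<Sum>i<n. \<Sum>r<d. \<Sum>j<n. \<Sum>s<d. g i j r s)"
      by (intro sum.cong refl sum.swap)
    also have "\<dots> = (\<Sum>i<n. \<Sum>r<d. \<Sum>s<d. \<Sum>j<n. g i j r s)"
      by (intro sum.cong refl sum.swap)
    also have "\<dots> = (\<Sum>i<n. \<Sum>r<d. \<Sum>s<d. \<Sum>q<4. \<Sum>j<n. \<Sum>q'<4. \<bar>corr (i, r, s, q) (j, s, r, q') z\<bar>)"
      unfolding g_def by (intro sum.cong refl sum.swap)
    also have "\<dots> \<le> (\<Sum>a\<in>letters. \<Sum>b\<in>letters. \<bar>corr a b z\<bar>)"
      unfolding sum_letters[of "\<lambda>a. \<Sum>b\<in>letters. \<bar>corr a b z\<bar>"] by (intro sum_mono inner) auto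
    finally show "(\<Sum>i<n. \<Sum>j\<in>{..<n} - {i}. \<Sum>r<d. \<Sum>s<d. g i j r s) \<le> (\<Sum>a\<in>letters. \<Sum>b\<in>letters. \<bar>corr a b z\<bar>)" .
  qed simp
  finally show ?thesis .
qed

lemma mixture_of_small_defect:
  fixes c :: real
  assumes "2 \<le> m" "0 < c"
  shows "\<exists>(I :: letter list set) (p :: letter list \<Rightarrow> real) B. finite I \<and>
    (\<forall>z\<in>I. 0 \<le> p z \<and> povmf d n (B z)) \<and> (\<Sum>z\<in>I. p z) = 1 \<and>
    (\<forall>i<n. \<forall>r<d. \<forall>s<d. K [i] [r] [s] = (\<Sum>z\<in>I. complex_of_real (p z) * B z i r s)) \<and>
    (\<Sum>z\<in>I. p z * defect d n (B z))
      \<le> (2 * real d ^ 2)\<^sup>2 * (c * (4 * real n * real d ^ 2) + 1 / (c * real (m - 1)))"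
proof -
  obtain k where k: "k + 2 \<le> m" "(\<Sum>z\<in>words letters k. \<Sum>a\<in>letters. \<Sum>b\<in>letters. \<bar>corr a b z\<bar>)
      \<le> c * card letters + 1 / (c * real (m - 1))"
    using exists_small_corr[OF assms] by blast
  \<comment> \<open>Words of probability zero are dropped: \<open>branch\<close> is obtained by
    division and is known to be a POVM only where \<open>prob z\<close> is nonzero.\<close>
  define I where "I = {z \<in> words letters k. prob z \<noteq> 0}"
  have restrict: "(\<Sum>z\<in>I. h z) = (\<Sum>z\<in>words letters k. h z)"
    if "\<And>z. prob z = 0 \<Longrightarrow> h z = 0" for h :: "letter list \<Rightarrow> 'b::comm_monoid_add"
    by (intro sum.mono_neutral_left) (auto simp: I_def intro: that)
  have km: "k < m" "k \<le> m" using k by auto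
  have card: "real (card letters) = 4 * real n * real d ^ 2"
    by (simp add: letters_def power2_eq_square)
  have "(\<Sum>z\<in>I. prob z * defect d n (branch z)) = (\<Sum>z\<in>words letters k. prob z * defect d n (branch z))"
    by (rule restrict) simp
  also have "\<dots> \<le> (\<Sum>z\<in>words letters k. (2 * real d ^ 2)\<^sup>2 * (\<Sum>a\<in>letters. \<Sum>b\<in>letters. \<bar>corr a b z\<bar>))"
    by (rule sum_mono) (rule branch_defect_le[OF k(1)])
  also have "\<dots> = (2 * real d ^ 2)\<^sup>2 * (\<Sum>z\<in>words letters k. \<Sum>a\<in>letters. \<Sum>b\<in>letters. \<bar>corr a b z\<bar>)"
    by (simp only: sum_distrib_left)
  also have "\<dots> \<le> (2 * real d ^ 2)\<^sup>2 * (c * card letters + 1 / (c * real (m - 1)))"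
    by (intro mult_left_mono k) simp
  finally have small: "(\<Sum>z\<in>I. prob z * defect d n (branch z)) \<le>
      (2 * real d ^ 2)\<^sup>2 * (c * (4 * real n * real d ^ 2) + 1 / (c * real (m - 1)))"
    by (simp only: card)
  have "(\<Sum>z\<in>I. prob z) = 1"
    using restrict[of prob] total[OF km(2)] by simp
  moreover have "K [i] [r] [s] = (\<Sum>z\<in>I. complex_of_real (prob z) * branch z i r s)"
    if "i < n" "r < d" "s < d" for i r s
    using restrict[of "\<lambda>z. complex_of_real (prob z) * branch z i r s"] mixture_branch[OF km(1) that] by simp
  moreover have "0 \<le> prob z \<and> povmf d n (branch z)" if "z \<in> I" for z
    using that povmf_branch[OF km(1)] nonneg[OF _ km(2)] by (auto simp: I_def)
  moreover have "finite I" by (simp add: I_def)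
  ultimately show ?thesis using small by (intro exI[of _ I] exI[of _ prob] exI[of _ branch]) blast
qed

end

section \<open>Tensor indices and the entrywise hierarchy\<close>

lemma multi_indices_eq: "multi_indices n m = words {..<n} m"
  by (simp add: multi_indices_def words_def)

lemma enc_Nil [simp]: "enc d [] = 0"
  by (simp add: enc_def)

lemma enc_snoc [simp]: "enc d (x @ [r]) = enc d x * d + r"
  by (simp add: enc_def)

text \<open>The most significant digit comes first, so padding in front is invisible. Entries of an
  operator on \<open>m\<close> factors can thus be addressed by shorter words.\<close>

lemma enc_replicate_0 [simp]: "enc d (replicate k 0 @ x) = enc d x"
proof (induction x rule: rev_induct)
  case Nil
  have "replicate (Suc k) (0::nat) = replicate k 0 @ [0]" for k
    by (simp add: replicate_append_same)
  then have "enc d (replicate k 0) = 0" by (induction k) (simp_all del: replicate_Suc)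
  then show ?case by simp
next
  case (snoc r x)
  then show ?case unfolding append_assoc[symmetric] enc_snoc by simp
qed

lemma enc_Cons_0 [simp]: "enc d (0 # x) = enc d x"
  using enc_replicate_0[of d 1 x] by simp

lemma enc_singleton [simp]: "enc d [r] = r"
  using enc_snoc[of d "[]" r] by simp

lemma snoc_in_words [simp]: "x @ [r] \<in> words A (Suc k) \<longleftrightarrow> x \<in> words A k \<and> r \<in> A"
  by (auto simp: words_def)

lemma words_Suc_snocE:
  assumes "x \<in> words A (Suc k)"
  obtains z r where "x = z @ [r]" "z \<in> words A k" "r \<in> A"
  using assms unfolding words_Suc_snoc by auto

lemma enc_less: "x \<in> words {..<d} k \<Longrightarrow> enc d x < d ^ k"
proof (induction k arbitrary: x)
  case (Suc k)
  obtain z r where x: "x = z @ [r]" "z \<in> words {..<d} k" "r < d"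
    using words_Suc_snocE[OF Suc.prems] by auto
  have "enc d z * d + r < (enc d z + 1) * d" using x by simp
  also have "\<dots> \<le> d ^ k * d" using Suc.IH[OF x(2)] by (intro mult_right_mono) auto
  finally show ?case by (simp add: x mult.commute)
qed simp

lemma dec_Suc: "dec d (Suc k) x = dec d k (x div d) @ [x mod d]"
proof -
  have "x div d ^ (k - l) mod d = x div d div d ^ (k - 1 - l) mod d" if "l < k" for l
  proof -
    have "k - l = Suc (k - 1 - l)" using that by simp
    then show ?thesis by (simp add: div_mult2_eq)
  qed
  then show ?thesis by (auto simp: dec_def)
qed

lemma dec_enc [simp]: "x \<in> words {..<d} k \<Longrightarrow> dec d k (enc d x) = x"
proof (induction k arbitrary: x)
  case 0
  then show ?case by (simp add: dec_def)
next
  case (Suc k)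
  obtain z r where x: "x = z @ [r]" "z \<in> words {..<d} k" "r < d"
    using words_Suc_snocE[OF Suc.prems] by auto
  then show ?case using Suc.IH[OF x(2)] by (simp add: dec_Suc)
qed

lemma dec_in_words: "0 < d \<Longrightarrow> dec d k x \<in> words {..<d} k"
  by (auto simp: dec_def words_def)

lemma enc_dec [simp]: "x < d ^ k \<Longrightarrow> enc d (dec d k x) = x"
proof (induction k arbitrary: x)
  case 0
  then show ?case by (simp add: dec_def)
next
  case (Suc k)
  then have "x div d < d ^ k" by (metis less_mult_imp_div_less mult.commute power_Suc)
  then show ?case using Suc.IH by (simp add: dec_Suc)
qed

lemma bij_betw_enc: "0 < d \<Longrightarrow> bij_betw (enc d) (words {..<d} k) {..<d ^ k}"
  by (rule bij_betw_byWitness[where f' = "dec d k"]) (auto simp: enc_less dec_in_words)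

lemma sum_enc: "0 < d \<Longrightarrow> (\<Sum>x<d ^ k. g x) = (\<Sum>x\<in>words {..<d} k. g (enc d x))"
  by (rule sum.reindex_bij_betw[OF bij_betw_enc, symmetric])

lemma all_enc: "0 < d \<Longrightarrow> (\<forall>x<d ^ k. P x) \<longleftrightarrow> (\<forall>x\<in>words {..<d} k. P (enc d x))"
  by (metis enc_dec dec_in_words enc_less)

lemma enc_eq_iff: "x \<in> words {..<d} k \<Longrightarrow> y \<in> words {..<d} k \<Longrightarrow> enc d x = enc d y \<longleftrightarrow> x = y"
  by (metis dec_enc)

lemma swap_list_in_words: "x \<in> words A m \<Longrightarrow> a < m \<Longrightarrow> b < m \<Longrightarrow> swap_list a b x \<in> words A m"
  unfolding words_def swap_list_def
  by (auto dest!: set_update_subset_insert[THEN subsetD])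

lemma swap_list_involution:
  assumes "a < length x" "b < length x"
  shows "swap_list a b (swap_list a b x) = x"
  using assms by (intro nth_equalityI) (auto simp: swap_list_def nth_list_update)

lemma swap_list_append:
  assumes "length z = a"
  shows "swap_list a (Suc a) (z @ i # j # x) = z @ j # i # x"
  using assms by (auto simp: swap_list_def list_update_append nth_append)

text \<open>Brings an arbitrary position to the end, where the marginal condition of the hierarchy
  is stated.\<close>

lemma swap_list_last:
  assumes "length z = a" "b = Suc (a + length x)"
  shows "swap_list a b (z @ i # x @ [j]) = z @ j # x @ [i]"
  using assms by (auto simp: swap_list_def list_update_append nth_append)

lemma insert_at_append: "length z = a \<Longrightarrow> insert_at a r (z @ x) = z @ r # x"
  by (simp add: insert_at_def)

lemma insert_at_in_words:
  assumes "x \<in> words A k" "r \<in> A" "a \<le> k"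
  shows "insert_at a r x \<in> words A (Suc k)"
  using assms by (auto simp: words_def insert_at_def dest: in_set_takeD in_set_dropD)

section \<open>Matrix operations on tensor powers, entry by entry\<close>

lemma eq_mat_enc_iff:
  assumes "0 < d" "A \<in> carrier_mat (d ^ k) (d ^ k)" "B \<in> carrier_mat (d ^ k) (d ^ k)"
  shows "A = B \<longleftrightarrow> (\<forall>x\<in>words {..<d} k. \<forall>y\<in>words {..<d} k. A $$ (enc d x, enc d y) = B $$ (enc d x, enc d y))"
  (is "_ \<longleftrightarrow> ?R")
proof
  assume ?R
  then have "\<forall>x<d ^ k. \<forall>y<d ^ k. A $$ (x, y) = B $$ (x, y)"
    unfolding all_enc[OF assms(1)] .
  then show "A = B" using assms by (intro eq_matI) auto
qed simp

lemma swap_op_entry: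
  assumes "x \<in> words {..<d} m" "y \<in> words {..<d} m"
  shows "swap_op d m a b $$ (enc d x, enc d y) = (if x = swap_list a b y then 1 else 0)"
  using assms by (simp add: swap_op_def enc_less)

lemma swap_op_carrier [simp]: "swap_op d m a b \<in> carrier_mat (d ^ m) (d ^ m)"
  by (simp add: swap_op_def)

lemma times_mat_entry:
  assumes "0 < d" "A \<in> carrier_mat (d ^ m) (d ^ m)" "B \<in> carrier_mat (d ^ m) (d ^ m)"
    and "x \<in> words {..<d} m" "y \<in> words {..<d} m"
  shows "(A * B) $$ (enc d x, enc d y) =
    (\<Sum>z\<in>words {..<d} m. A $$ (enc d x, enc d z) * B $$ (enc d z, enc d y))"
proof -
  have "(A * B) $$ (enc d x, enc d y) = (\<Sum>z<d ^ m. A $$ (enc d x, z) * B $$ (z, enc d y))"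
    using assms enc_less[OF assms(4)] enc_less[OF assms(5)]
    by (auto simp: scalar_prod_def atLeast0LessThan)
  then show ?thesis by (simp add: sum_enc[OF assms(1)])
qed

lemma swap_op_times_entry:
  assumes "0 < d" "A \<in> carrier_mat (d ^ m) (d ^ m)" "a < m" "b < m"
    and xy: "x \<in> words {..<d} m" "y \<in> words {..<d} m"
  shows "(swap_op d m a b * A) $$ (enc d x, enc d y) = A $$ (enc d (swap_list a b x), enc d y)"
proof -
  have inv: "x = swap_list a b z \<longleftrightarrow> z = swap_list a b x" if "z \<in> words {..<d} m" for z
    using that xy(1) assms(3,4) by (metis swap_list_involution words_length)
  have "(swap_op d m a b * A) $$ (enc d x, enc d y) =
      (\<Sum>z\<in>words {..<d} m. if z = swap_list a b x then A $$ (enc d z, enc d y) else 0)"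
    unfolding times_mat_entry[OF assms(1) swap_op_carrier assms(2) xy]
    using xy inv by (intro sum.cong refl) (simp add: swap_op_entry)
  then show ?thesis using swap_list_in_words[OF xy(1) assms(3,4)] by simp
qed

lemma times_swap_op_entry:
  assumes "0 < d" "A \<in> carrier_mat (d ^ m) (d ^ m)" "a < m" "b < m"
    and xy: "x \<in> words {..<d} m" "y \<in> words {..<d} m"
  shows "(A * swap_op d m a b) $$ (enc d x, enc d y) = A $$ (enc d x, enc d (swap_list a b y))"
proof -
  have "(A * swap_op d m a b) $$ (enc d x, enc d y) =
      (\<Sum>z\<in>words {..<d} m. if z = swap_list a b y then A $$ (enc d x, enc d z) else 0)"
    unfolding times_mat_entry[OF assms(1,2) swap_op_carrier xy]
    using xy by (intro sum.cong refl) (auto simp: swap_op_entry)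
  then show ?thesis using swap_list_in_words[OF xy(2) assms(3,4)] by simp
qed

lemma ptrace_swap_eq_0_iff:
  assumes "0 < d" "A \<in> carrier_mat (d ^ m) (d ^ m)" "a < b" "b < m"
  shows "ptrace d m a (swap_op d m a b * A) = 0\<^sub>m (d ^ (m - 1)) (d ^ (m - 1)) \<longleftrightarrow>
    (\<forall>x\<in>words {..<d} (m - 1). \<forall>y\<in>words {..<d} (m - 1).
      (\<Sum>r<d. A $$ (enc d (swap_list a b (insert_at a r x)), enc d (insert_at a r y))) = 0)"
proof -
  have ins: "insert_at a r x \<in> words {..<d} m" if "x \<in> words {..<d} (m - 1)" "r < d" for x r
    using insert_at_in_words[OF that(1), of r a] that assms by simp
  have "ptrace d m a (swap_op d m a b * A) $$ (enc d x, enc d y) =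
      (\<Sum>r<d. A $$ (enc d (swap_list a b (insert_at a r x)), enc d (insert_at a r y)))"
    if "x \<in> words {..<d} (m - 1)" "y \<in> words {..<d} (m - 1)" for x y
    using that assms ins
    by (simp add: ptrace_def enc_less swap_op_times_entry[of d A m a b])
  moreover have "ptrace d m a (swap_op d m a b * A) \<in> carrier_mat (d ^ (m - 1)) (d ^ (m - 1))"
    by (simp add: ptrace_def)
  ultimately show ?thesis
    by (subst eq_mat_enc_iff[OF assms(1)]) (auto simp: enc_less)
qed

lemma swap_conj_eq_iff:
  assumes "0 < d" "A \<in> carrier_mat (d ^ m) (d ^ m)" "B \<in> carrier_mat (d ^ m) (d ^ m)" "a < m" "b < m"
  shows "swap_op d m a b * A * swap_op d m a b = B \<longleftrightarrow>
    (\<forall>x\<in>words {..<d} m. \<forall>y\<in>words {..<d} m.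
      A $$ (enc d (swap_list a b x), enc d (swap_list a b y)) = B $$ (enc d x, enc d y))"
proof -
  have VA: "swap_op d m a b * A \<in> carrier_mat (d ^ m) (d ^ m)"
    using assms(2) swap_op_carrier by (rule mult_carrier_mat[rotated])
  have "(swap_op d m a b * A * swap_op d m a b) $$ (enc d x, enc d y) =
      A $$ (enc d (swap_list a b x), enc d (swap_list a b y))"
    if "x \<in> words {..<d} m" "y \<in> words {..<d} m" for x y
    using that assms(4,5)
    by (simp add: times_swap_op_entry[OF assms(1) VA] swap_op_times_entry[OF assms(1,2)] swap_list_in_words)
  moreover have "swap_op d m a b * A * swap_op d m a b \<in> carrier_mat (d ^ m) (d ^ m)"
    using VA swap_op_carrier by (rule mult_carrier_mat)
  ultimately show ?thesis
    by (subst eq_mat_enc_iff[OF assms(1) _ assms(3)]) auto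
qed

text \<open>The last digit is the least significant one, so division by \<open>d\<close> and
  remainder in \<open>kron\<close> separate exactly the appended digits \<open>r\<close> and
  \<open>s\<close>.\<close>

lemma msum_eq_kron_iff:
  assumes "0 < d" "C \<in> carrier_mat (d ^ k) (d ^ k)"
  shows "msum (d ^ Suc k) f I = kron C (1\<^sub>m d) \<longleftrightarrow>
    (\<forall>x\<in>words {..<d} k. \<forall>y\<in>words {..<d} k. \<forall>r<d. \<forall>s<d.
      (\<Sum>i\<in>I. f i $$ (enc d (x @ [r]), enc d (y @ [s]))) = (if r = s then C $$ (enc d x, enc d y) else 0))"
proof -
  have entries: "kron C (1\<^sub>m d) $$ (enc d (x @ [r]), enc d (y @ [s])) = (if r = s then C $$ (enc d x, enc d y) else 0)"
    "msum (d ^ Suc k) f I $$ (enc d (x @ [r]), enc d (y @ [s])) = (\<Sum>i\<in>I. f i $$ (enc d (x @ [r]), enc d (y @ [s])))"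
    if "x \<in> words {..<d} k" "y \<in> words {..<d} k" "r < d" "s < d" for x y r s
    using assms that enc_less[of "x @ [r]" d "Suc k"] enc_less[of "y @ [s]" d "Suc k"]
    by (auto simp: kron_def msum_def mult.commute)
  have carrier: "kron C (1\<^sub>m d) \<in> carrier_mat (d ^ Suc k) (d ^ Suc k)"
    "msum (d ^ Suc k) f I \<in> carrier_mat (d ^ Suc k) (d ^ Suc k)"
    using assms by (simp_all add: kron_def msum_def mult.commute)
  have "(\<forall>x\<in>words {..<d} (Suc k). P x) \<longleftrightarrow> (\<forall>x\<in>words {..<d} k. \<forall>r<d. P (x @ [r]))" for P
    by (auto elim: words_Suc_snocE)
  then have "msum (d ^ Suc k) f I = kron C (1\<^sub>m d) \<longleftrightarrow>
    (\<forall>x\<in>words {..<d} k. \<forall>r<d. \<forall>y\<in>words {..<d} k. \<forall>s<d.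
      (\<Sum>i\<in>I. f i $$ (enc d (x @ [r]), enc d (y @ [s]))) = (if r = s then C $$ (enc d x, enc d y) else 0))"
    unfolding eq_mat_enc_iff[OF assms(1) carrier(2,1)]
    by (simp only:) (intro ball_cong all_cong refl, simp only: entries)
  then show ?thesis by blast
qed

lemma at_factor_carrier:
  assumes "j < m" "A \<in> carrier_mat d d"
  shows "at_factor d m j A \<in> carrier_mat (d ^ m) (d ^ m)"
proof -
  have "d ^ j * d * d ^ (m - 1 - j) = d ^ (j + 1 + (m - 1 - j))" by (simp only: power_add power_one_right)
  also have "j + 1 + (m - 1 - j) = m" using assms by simp
  finally show ?thesis using assms by (simp add: at_factor_def kron_def)
qed

lemma depolarise_carrier: "A \<in> carrier_mat d d \<Longrightarrow> depolarise d t A \<in> carrier_mat d d"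
  by (simp add: depolarise_def)

text \<open>The conditions for index functions instead of matrices, suited to limits and to padded
  words. The factor condition keeps numerical indices; the conditions about single factors use digit
  words.\<close>

definition hierarchy_entries ::
    "nat \<Rightarrow> nat \<Rightarrow> nat \<Rightarrow> (nat \<Rightarrow> complex mat) \<Rightarrow> real \<Rightarrow>
      (nat list \<Rightarrow> nat \<Rightarrow> nat \<Rightarrow> complex) \<Rightarrow> (nat list \<Rightarrow> nat \<Rightarrow> nat \<Rightarrow> complex) \<Rightarrow> bool" where
  "hierarchy_entries d n m M t R R' \<longleftrightarrow>
     (\<forall>is\<in>words {..<n} m. psdf (d ^ m) (R is)) \<and>
     (\<forall>is\<in>words {..<n} (m - 1). psdf (d ^ (m - 1)) (R' is)) \<and>
     (\<forall>j<m. \<forall>i<n. \<forall>x<d ^ m. \<forall>y<d ^ m. (\<Sum>is | is \<in> words {..<n} m \<and> is ! j = i. R is x y)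
        = at_factor d m j (depolarise d t (M i)) $$ (x, y)) \<and>
     (\<forall>is\<in>words {..<n} m. \<forall>a b. a < b \<and> b < m \<and> is ! a \<noteq> is ! b \<longrightarrow>
        (\<forall>x\<in>words {..<d} (m - 1). \<forall>y\<in>words {..<d} (m - 1).
          (\<Sum>r<d. R is (enc d (swap_list a b (insert_at a r x))) (enc d (insert_at a r y))) = 0)) \<and>
     (\<forall>is\<in>words {..<n} m. \<forall>a b. a < b \<and> b < m \<longrightarrow>
        (\<forall>x\<in>words {..<d} m. \<forall>y\<in>words {..<d} m.
          R is (enc d (swap_list a b x)) (enc d (swap_list a b y)) = R (swap_list a b is) (enc d x) (enc d y))) \<and>
     (\<forall>is\<in>words {..<n} (m - 1). \<forall>x\<in>words {..<d} (m - 1). \<forall>y\<in>words {..<d} (m - 1). \<forall>r<d. \<forall>s<d.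
        (\<Sum>i<n. R (is @ [i]) (enc d (x @ [r])) (enc d (y @ [s]))) = (if r = s then R' is (enc d x) (enc d y) else 0))"

lemma hierarchy_entriesD:
  assumes "hierarchy_entries d n m M t R R'"
  shows hierarchy_psd: "\<And>is. is \<in> words {..<n} m \<Longrightarrow> psdf (d ^ m) (R is)"
    and hierarchy_psd': "\<And>is. is \<in> words {..<n} (m - 1) \<Longrightarrow> psdf (d ^ (m - 1)) (R' is)"
    and hierarchy_factor: "\<And>j i x y. j < m \<Longrightarrow> i < n \<Longrightarrow> x < d ^ m \<Longrightarrow> y < d ^ m \<Longrightarrow>
      (\<Sum>is | is \<in> words {..<n} m \<and> is ! j = i. R is x y) = at_factor d m j (depolarise d t (M i)) $$ (x, y)"
    and hierarchy_orthogonal: "\<And>is a b x y. is \<in> words {..<n} m \<Longrightarrow> a < b \<Longrightarrow> b < m \<Longrightarrow> is ! a \<noteq> is ! b \<Longrightarrow>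
      x \<in> words {..<d} (m - 1) \<Longrightarrow> y \<in> words {..<d} (m - 1) \<Longrightarrow>
      (\<Sum>r<d. R is (enc d (swap_list a b (insert_at a r x))) (enc d (insert_at a r y))) = 0"
    and hierarchy_swap: "\<And>is a b x y. is \<in> words {..<n} m \<Longrightarrow> a < b \<Longrightarrow> b < m \<Longrightarrow>
      x \<in> words {..<d} m \<Longrightarrow> y \<in> words {..<d} m \<Longrightarrow>
      R is (enc d (swap_list a b x)) (enc d (swap_list a b y)) = R (swap_list a b is) (enc d x) (enc d y)"
    and hierarchy_marginal: "\<And>is x y r s. is \<in> words {..<n} (m - 1) \<Longrightarrow>
      x \<in> words {..<d} (m - 1) \<Longrightarrow> y \<in> words {..<d} (m - 1) \<Longrightarrow> r < d \<Longrightarrow> s < d \<Longrightarrow>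
      (\<Sum>i<n. R (is @ [i]) (enc d (x @ [r])) (enc d (y @ [s]))) = (if r = s then R' is (enc d x) (enc d y) else 0)"
proof -
  note c = assms[unfolded hierarchy_entries_def]
  note c1 = conjunct1[OF c] and c2 = conjunct2[OF c]
  note c4 = conjunct1[OF conjunct2[OF conjunct2[OF c2]]]
  note c56 = conjunct2[OF conjunct2[OF conjunct2[OF c2]]]
  show "psdf (d ^ m) (R is)" if "is \<in> words {..<n} m" for "is"
    using bspec[OF c1 that] .
  show "psdf (d ^ (m - 1)) (R' is)" if "is \<in> words {..<n} (m - 1)" for "is"
    using bspec[OF conjunct1[OF c2] that] .
  show "(\<Sum>is | is \<in> words {..<n} m \<and> is ! j = i. R is x y) = at_factor d m j (depolarise d t (M i)) $$ (x, y)"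
    if "j < m" "i < n" "x < d ^ m" "y < d ^ m" for j i x y
    using conjunct1[OF conjunct2[OF c2], rule_format, OF that] .
  show "(\<Sum>r<d. R is (enc d (swap_list a b (insert_at a r x))) (enc d (insert_at a r y))) = 0"
    if "is \<in> words {..<n} m" "a < b" "b < m" "is ! a \<noteq> is ! b" "x \<in> words {..<d} (m - 1)" "y \<in> words {..<d} (m - 1)"
    for "is" a b x y
    by (rule c4[THEN bspec, THEN spec, THEN spec, THEN mp, THEN bspec, THEN bspec]) (intro conjI that)+
  show "R is (enc d (swap_list a b x)) (enc d (swap_list a b y)) = R (swap_list a b is) (enc d x) (enc d y)"
    if "is \<in> words {..<n} m" "a < b" "b < m" "x \<in> words {..<d} m" "y \<in> words {..<d} m" for "is" a b x y
    by (rule conjunct1[OF c56, THEN bspec, THEN spec, THEN spec, THEN mp, THEN bspec, THEN bspec]) (intro conjI that)+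
  show "(\<Sum>i<n. R (is @ [i]) (enc d (x @ [r])) (enc d (y @ [s]))) = (if r = s then R' is (enc d x) (enc d y) else 0)"
    if "is \<in> words {..<n} (m - 1)" "x \<in> words {..<d} (m - 1)" "y \<in> words {..<d} (m - 1)" "r < d" "s < d"
    for "is" x y r s
    using conjunct2[OF c56, rule_format, OF that] .
qed

lemma hierarchy_conditions_iff:
  fixes R R' :: "nat list \<Rightarrow> complex mat"
  assumes d: "0 < d" and m: "0 < m" and M: "\<And>i. i < n \<Longrightarrow> M i \<in> carrier_mat d d"
    and R: "\<And>is. is \<in> words {..<n} m \<Longrightarrow> R is \<in> carrier_mat (d ^ m) (d ^ m)"
    and R': "\<And>is. is \<in> words {..<n} (m - 1) \<Longrightarrow> R' is \<in> carrier_mat (d ^ (m - 1)) (d ^ (m - 1))"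
  shows "hierarchy_entries d n m M t (\<lambda>is x y. R is $$ (x, y)) (\<lambda>is x y. R' is $$ (x, y)) \<longleftrightarrow>
      (\<forall>is \<in> multi_indices n m. psd (d ^ m) (R is)) \<and>
      (\<forall>is \<in> multi_indices n (m - 1). psd (d ^ (m - 1)) (R' is)) \<and>
      (\<forall>j<m. \<forall>i<n. msum (d ^ m) R {is \<in> multi_indices n m. is ! j = i}
                     = at_factor d m j (depolarise d t (M i))) \<and>
      (\<forall>is \<in> multi_indices n m. \<forall>a b. a < b \<and> b < m \<and> is ! a \<noteq> is ! b \<longrightarrow>
         ptrace d m a (swap_op d m a b * R is) = 0\<^sub>m (d ^ (m - 1)) (d ^ (m - 1))) \<and>
      (\<forall>is \<in> multi_indices n m. \<forall>a b. a < b \<and> b < m \<longrightarrow>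
         swap_op d m a b * R is * swap_op d m a b = R (swap_list a b is)) \<and>
      (\<forall>is \<in> multi_indices n (m - 1).
         msum (d ^ m) (\<lambda>i. R (is @ [i])) {..<n} = kron (R' is) (1\<^sub>m d))"
  unfolding hierarchy_entries_def multi_indices_eq
proof (intro conj_cong ball_cong iff_allI imp_cong refl)
  fix "is" assume "is \<in> words {..<n} m"
  then show "psdf (d ^ m) (\<lambda>x y. R is $$ (x, y)) = psd (d ^ m) (R is)"
    using R by (simp add: psd_iff_psdf)
next
  fix "is" assume "is \<in> words {..<n} (m - 1)"
  then show "psdf (d ^ (m - 1)) (\<lambda>x y. R' is $$ (x, y)) = psd (d ^ (m - 1)) (R' is)"
    using R' by (simp add: psd_iff_psdf)
next
  fix j i assume ji: "j < m" "i < n"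
  have "at_factor d m j (depolarise d t (M i)) \<in> carrier_mat (d ^ m) (d ^ m)"
    using ji M by (intro at_factor_carrier depolarise_carrier) auto
  then show "(\<forall>x<d ^ m. \<forall>y<d ^ m. (\<Sum>is | is \<in> words {..<n} m \<and> is ! j = i. R is $$ (x, y))
        = at_factor d m j (depolarise d t (M i)) $$ (x, y)) \<longleftrightarrow>
     msum (d ^ m) R {is \<in> words {..<n} m. is ! j = i} = at_factor d m j (depolarise d t (M i))"
    by (auto simp: msum_def mat_eq_iff)
next
  fix "is" a b assume "is \<in> words {..<n} m" "a < b \<and> b < m \<and> is ! a \<noteq> is ! b"
  then show "(\<forall>x\<in>words {..<d} (m - 1). \<forall>y\<in>words {..<d} (m - 1).
          (\<Sum>r<d. R is $$ (enc d (swap_list a b (insert_at a r x)), enc d (insert_at a r y))) = 0) \<longleftrightarrow>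
      ptrace d m a (swap_op d m a b * R is) = 0\<^sub>m (d ^ (m - 1)) (d ^ (m - 1))"
    using R d by (subst ptrace_swap_eq_0_iff) auto
next
  fix "is" a b assume "is \<in> words {..<n} m" "a < b \<and> b < m"
  then show "(\<forall>x\<in>words {..<d} m. \<forall>y\<in>words {..<d} m.
          R is $$ (enc d (swap_list a b x), enc d (swap_list a b y)) = R (swap_list a b is) $$ (enc d x, enc d y)) \<longleftrightarrow>
      swap_op d m a b * R is * swap_op d m a b = R (swap_list a b is)"
    using R d by (subst swap_conj_eq_iff) (auto simp: swap_list_in_words)
next
  fix "is" assume "is \<in> words {..<n} (m - 1)"
  then show "(\<forall>x\<in>words {..<d} (m - 1). \<forall>y\<in>words {..<d} (m - 1). \<forall>r<d. \<forall>s<d.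
        (\<Sum>i<n. R (is @ [i]) $$ (enc d (x @ [r]), enc d (y @ [s]))) = (if r = s then R' is $$ (enc d x, enc d y) else 0)) \<longleftrightarrow>
     msum (d ^ m) (\<lambda>i. R (is @ [i])) {..<n} = kron (R' is) (1\<^sub>m d)"
    using msum_eq_kron_iff[OF d R', of "is" "\<lambda>i. R (is @ [i])" "{..<n}"] m by simp
qed

lemma psdf_mat_iff: "psdf N (\<lambda>x y. Matrix.mat N N f $$ (x, y)) \<longleftrightarrow> psdf N (\<lambda>x y. f (x, y))"
  by (simp add: psdf_def ip_app)

text \<open>All conditions look only at entries within range, so arbitrary functions can be cut down
  to matrices of the right size.\<close>

lemma hierarchy_feasible_iff:
  assumes d: "0 < d" and m: "0 < m" and M: "\<And>i. i < n \<Longrightarrow> M i \<in> carrier_mat d d"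
  shows "hierarchy_feasible d n m M t \<longleftrightarrow> (\<exists>R R'. hierarchy_entries d n m M t R R')"
proof
  assume "hierarchy_feasible d n m M t"
  then obtain R R' where feas:
      "(\<forall>is \<in> multi_indices n m. psd (d ^ m) (R is)) \<and>
      (\<forall>is \<in> multi_indices n (m - 1). psd (d ^ (m - 1)) (R' is)) \<and>
      (\<forall>j<m. \<forall>i<n. msum (d ^ m) R {is \<in> multi_indices n m. is ! j = i}
                     = at_factor d m j (depolarise d t (M i))) \<and>
      (\<forall>is \<in> multi_indices n m. \<forall>a b. a < b \<and> b < m \<and> is ! a \<noteq> is ! b \<longrightarrow>
         ptrace d m a (swap_op d m a b * R is) = 0\<^sub>m (d ^ (m - 1)) (d ^ (m - 1))) \<and>
      (\<forall>is \<in> multi_indices n m. \<forall>a b. a < b \<and> b < m \<longrightarrow>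
         swap_op d m a b * R is * swap_op d m a b = R (swap_list a b is)) \<and>
      (\<forall>is \<in> multi_indices n (m - 1).
         msum (d ^ m) (\<lambda>i. R (is @ [i])) {..<n} = kron (R' is) (1\<^sub>m d))"
    unfolding hierarchy_feasible_def by (elim exE) (rule that)
  have "hierarchy_entries d n m M t (\<lambda>is x y. R is $$ (x, y)) (\<lambda>is x y. R' is $$ (x, y))"
  proof (rule hierarchy_conditions_iff[THEN iffD2, OF d m M _ _ feas])
    show "is \<in> words {..<n} m \<Longrightarrow> R is \<in> carrier_mat (d ^ m) (d ^ m)" for "is"
      using conjunct1[OF feas] by (simp add: multi_indices_eq psd_def)
    show "is \<in> words {..<n} (m - 1) \<Longrightarrow> R' is \<in> carrier_mat (d ^ (m - 1)) (d ^ (m - 1))" for "is"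
      using conjunct1[OF conjunct2[OF feas]] by (simp add: multi_indices_eq psd_def)
  qed
  then show "\<exists>R R'. hierarchy_entries d n m M t R R'" by blast
next
  assume "\<exists>R R'. hierarchy_entries d n m M t R R'"
  then obtain R R' where entries: "hierarchy_entries d n m M t R R'" by blast
  define S where "S = (\<lambda>is. Matrix.mat (d ^ m) (d ^ m) (\<lambda>(x, y). R is x y))"
  define S' where "S' = (\<lambda>is. Matrix.mat (d ^ (m - 1)) (d ^ (m - 1)) (\<lambda>(x, y). R' is x y))"
  have S: "S is \<in> carrier_mat (d ^ m) (d ^ m)" "S' is \<in> carrier_mat (d ^ (m - 1)) (d ^ (m - 1))" for "is"
    by (simp_all add: S_def S'_def)
  have m': "Suc (m - 1) = m" using m by simp
  have ins: "insert_at a r x \<in> words {..<d} m" if "x \<in> words {..<d} (m - 1)" "r < d" "a < m" for x r a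
    using insert_at_in_words[OF that(1), of r a] m' that by simp
  have snoc: "x @ [r] \<in> words A m \<longleftrightarrow> x \<in> words A (m - 1) \<and> r \<in> A" for x r and A :: "nat set"
    using snoc_in_words[of x r A "m - 1"] m' by simp
  have entry: "S is $$ (enc d x, enc d y) = R is (enc d x) (enc d y)"
    if "x \<in> words {..<d} m" "y \<in> words {..<d} m" for "is" x y
    using that by (simp add: S_def enc_less)
  have entry': "S' is $$ (enc d x, enc d y) = R' is (enc d x) (enc d y)"
    if "x \<in> words {..<d} (m - 1)" "y \<in> words {..<d} (m - 1)" for "is" x y
    using that by (simp add: S'_def enc_less)
  have "hierarchy_entries d n m M t (\<lambda>is x y. S is $$ (x, y)) (\<lambda>is x y. S' is $$ (x, y))"
    unfolding hierarchy_entries_def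
  proof (intro conjI ballI allI impI; (elim conjE)?)
    fix "is" assume "is \<in> words {..<n} m"
    then show "psdf (d ^ m) (\<lambda>x y. S is $$ (x, y))"
      using hierarchy_psd[OF entries] by (simp add: S_def psdf_mat_iff)
  next
    fix "is" assume "is \<in> words {..<n} (m - 1)"
    then show "psdf (d ^ (m - 1)) (\<lambda>x y. S' is $$ (x, y))"
      using hierarchy_psd'[OF entries] by (simp add: S'_def psdf_mat_iff)
  next
    fix j i x y assume "j < m" "i < n" "x < d ^ m" "y < d ^ m"
    then show "(\<Sum>is | is \<in> words {..<n} m \<and> is ! j = i. S is $$ (x, y)) =
        at_factor d m j (depolarise d t (M i)) $$ (x, y)"
      using hierarchy_factor[OF entries] by (simp add: S_def)
  next
    fix "is" a b x y
    assume *: "is \<in> words {..<n} m" "a < b" "b < m" "is ! a \<noteq> is ! b"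
      "x \<in> words {..<d} (m - 1)" "y \<in> words {..<d} (m - 1)"
    have "(\<Sum>r<d. S is $$ (enc d (swap_list a b (insert_at a r x)), enc d (insert_at a r y))) =
        (\<Sum>r<d. R is (enc d (swap_list a b (insert_at a r x))) (enc d (insert_at a r y)))"
      using * by (intro sum.cong refl entry swap_list_in_words ins) auto
    then show "(\<Sum>r<d. S is $$ (enc d (swap_list a b (insert_at a r x)), enc d (insert_at a r y))) = 0"
      by (simp only: hierarchy_orthogonal[OF entries *])
  next
    fix "is" a b x y
    assume *: "is \<in> words {..<n} m" "a < b" "b < m" "x \<in> words {..<d} m" "y \<in> words {..<d} m"
    have "S is $$ (enc d (swap_list a b x), enc d (swap_list a b y)) = R is (enc d (swap_list a b x)) (enc d (swap_list a b y))"
      using * by (intro entry swap_list_in_words) auto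
    also have "\<dots> = S (swap_list a b is) $$ (enc d x, enc d y)"
      by (simp only: hierarchy_swap[OF entries *] entry[OF *(4,5)])
    finally show "S is $$ (enc d (swap_list a b x), enc d (swap_list a b y)) = S (swap_list a b is) $$ (enc d x, enc d y)" .
  next
    fix "is" x y r s
    assume *: "is \<in> words {..<n} (m - 1)" "x \<in> words {..<d} (m - 1)" "y \<in> words {..<d} (m - 1)" "r < d" "s < d"
    then have "(\<Sum>i<n. S (is @ [i]) $$ (enc d (x @ [r]), enc d (y @ [s]))) =
        (\<Sum>i<n. R (is @ [i]) (enc d (x @ [r])) (enc d (y @ [s])))"
      by (intro sum.cong refl entry) (auto simp: snoc)
    then show "(\<Sum>i<n. S (is @ [i]) $$ (enc d (x @ [r]), enc d (y @ [s]))) =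
        (if r = s then S' is $$ (enc d x, enc d y) else 0)"
      by (simp only: hierarchy_marginal[OF entries *] entry'[OF *(2,3)])
  qed
  then show "hierarchy_feasible d n m M t"
    unfolding hierarchy_feasible_def
    by (intro exI[of _ S] exI[of _ S'] hierarchy_conditions_iff[THEN iffD1, OF d m M S])
qed

section \<open>The hierarchy value is attained\<close>

text \<open>With \<open>q\<close> the dimension of the factors after \<open>j\<close>, the quotient
  \<open>x div q div d\<close> holds the digits before \<open>j\<close>,
  \<open>x div q mod d\<close> is digit \<open>j\<close>, and \<open>x mod q\<close> holds the
  digits after it.\<close>

lemma at_factor_entry:
  assumes d: "0 < d" and j: "j < m" and A: "A \<in> carrier_mat d d" and xy: "x < d ^ m" "y < d ^ m"
  defines "q \<equiv> d ^ (m - 1 - j)"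
  shows "at_factor d m j A $$ (x, y) = (if x div q div d = y div q div d then 1 else 0) *
    A $$ (x div q mod d, y div q mod d) * (if x mod q = y mod q then 1 else 0)"
proof -
  have "d ^ j * d * q = d ^ (j + 1 + (m - 1 - j))" by (simp only: power_add power_one_right q_def)
  also have "j + 1 + (m - 1 - j) = m" using j by simp
  finally have m: "d ^ m = d ^ j * d * q" by simp
  have "0 < q" using d by (simp add: q_def)
  have div: "z div q < d ^ j * d" "z div q div d < d ^ j" if "z < d ^ m" for z
    using that unfolding m by (auto intro: less_mult_imp_div_less)
  have q: "d ^ (m - Suc j) = q" by (simp add: q_def)
  show ?thesis
    using A d \<open>0 < q\<close> xy div[OF xy(1)] div[OF xy(2)] unfolding m
    by (simp add: at_factor_def kron_def q)
qed

lemma at_factor_last_entry: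
  assumes "0 < d" "0 < m" "A \<in> carrier_mat d d" "r < d" "s < d"
  shows "at_factor d m (m - 1) A $$ (r, s) = A $$ (r, s)"
proof -
  have "d ^ 1 \<le> d ^ m" using assms by (intro power_increasing) auto
  then show ?thesis using assms by (subst at_factor_entry) auto
qed

lemma depolarise_entry:
  assumes "A \<in> carrier_mat d d" "k < d" "l < d"
  shows "depolarise d t A $$ (k, l) = complex_of_real t * A $$ (k, l)
    + complex_of_real (1 - t) * mat_trace A / of_nat d * (if k = l then 1 else 0)"
  using assms by (simp add: depolarise_def)

lemma depolarise_1: "A \<in> carrier_mat d d \<Longrightarrow> depolarise d 1 A = A"
  by (rule eq_matI) (auto simp: depolarise_def)

lemma tendsto_at_factor_depolarise:
  assumes "0 < d" "j < m" "A \<in> carrier_mat d d" "x < d ^ m" "y < d ^ m" "t \<longlonglongrightarrow> t0"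
  shows "(\<lambda>\<nu>. at_factor d m j (depolarise d (t \<nu>) A) $$ (x, y)) \<longlonglongrightarrow> at_factor d m j (depolarise d t0 A) $$ (x, y)"
  unfolding at_factor_entry[OF assms(1,2) depolarise_carrier[OF assms(3)] assms(4,5)]
  using assms(1) by (auto simp: depolarise_entry[OF assms(3)] intro!: tendsto_intros assms(6))

text \<open>The feasible operators stay bounded: positivity and condition (2) bound their diagonals,
  and \<open>psdf_cmod_le\<close> bounds the other entries. All conditions are closed, so a limit
  along a common subsequence is feasible.\<close>

lemma hierarchy_entries_limit:
  assumes d: "0 < d" and m: "0 < m" and M: "\<And>i. i < n \<Longrightarrow> M i \<in> carrier_mat d d"
    and entries: "\<And>\<nu>. hierarchy_entries d n m M (t \<nu>) (R \<nu>) (R' \<nu>)" and t: "t \<longlonglongrightarrow> t0"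
  shows "\<exists>L L'. hierarchy_entries d n m M t0 L L'"
proof -
  note psd = hierarchy_psd[OF entries]
  \<comment> \<open>Condition (2) at factor \<open>0\<close> already bounds every operator, since
    each belongs to one value of its first outcome.\<close>
  define diag where "diag = (\<lambda>i x \<nu>. at_factor d m 0 (depolarise d (t \<nu>) (M i)) $$ (x, x))"
  have "\<exists>b. \<forall>\<nu>. cmod (diag i x \<nu>) \<le> b" if "i < n" "x < d ^ m" for i x
    using convergent_imp_bounded[OF tendsto_at_factor_depolarise[OF d m M[OF that(1)] that(2,2) t]]
    unfolding bounded_iff diag_def by auto
  then obtain b where b: "\<And>i x \<nu>. i < n \<Longrightarrow> x < d ^ m \<Longrightarrow> cmod (diag i x \<nu>) \<le> b i x" by metis
  have hd: "is ! 0 < n" if "is \<in> words {..<n} m" for "is"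
    using nth_word[OF that m] by simp
  have diag_le: "Re (R \<nu> is x x) \<le> b (is ! 0) x" if "is \<in> words {..<n} m" "x < d ^ m" for \<nu> "is" x
  proof -
    have "R \<nu> is x x \<le> (\<Sum>js | js \<in> words {..<n} m \<and> js ! 0 = is ! 0. R \<nu> js x x)"
      using that by (intro member_le_sum[of "is"]) (auto intro: psdf_diag[OF psd])
    also have "\<dots> = diag (is ! 0) x \<nu>"
      using hierarchy_factor[OF entries m hd[OF that(1)] that(2,2)] by (simp add: diag_def)
    finally have "Re (R \<nu> is x x) \<le> Re (diag (is ! 0) x \<nu>)" by (simp add: less_eq_complex_def)
    also have "\<dots> \<le> cmod (diag (is ! 0) x \<nu>)" by (rule complex_Re_le_cmod)
    finally show ?thesis using b[OF hd[OF that(1)] that(2), of \<nu>] by linarith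
  qed
  define X where "X = words {..<n} m \<times> {..<d ^ m} \<times> {..<d ^ m}"
  define f where "f = (\<lambda>(is, x, y) \<nu>. R \<nu> is x y)"
  have "finite X" by (simp add: X_def)
  moreover have "bounded (range (f z))" if z: "z \<in> X" for z
  proof -
    obtain "is" x y where z': "z = (is, x, y)" "is \<in> words {..<n} m" "x < d ^ m" "y < d ^ m"
      using z by (auto simp: X_def)
    have "cmod (f z \<nu>) \<le> b (is ! 0) x + b (is ! 0) y" for \<nu>
      using psdf_cmod_le[OF psd[OF z'(2)] z'(3,4), of \<nu>] diag_le[OF z'(2,3), of \<nu>] diag_le[OF z'(2,4), of \<nu>]
      by (simp add: f_def z')
    then show ?thesis by (intro boundedI) auto
  qed
  ultimately obtain \<rho> l where \<rho>: "strict_mono \<rho>" "\<forall>z\<in>X. (\<lambda>\<nu>. f z (\<rho> \<nu>)) \<longlonglongrightarrow> l z"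
    using common_convergent_subsequence[of X f] by blast
  define L where "L = (\<lambda>is x y. l (is, x, y))"
  \<comment> \<open>The second family is determined by the first through condition (5) with last
    digits \<open>0\<close>; the index \<open>x * d\<close> is \<open>x\<close> with the digit
    \<open>0\<close> appended.\<close>
  define L' where "L' = (\<lambda>is x y. \<Sum>i<n. L (is @ [i]) (x * d) (y * d))"
  have L: "(\<lambda>\<nu>. R (\<rho> \<nu>) is x y) \<longlonglongrightarrow> L is x y" if "is \<in> words {..<n} m" "x < d ^ m" "y < d ^ m" for "is" x y
    using bspec[OF \<rho>(2), of "(is, x, y)"] that by (simp add: X_def f_def L_def)
  have m': "Suc (m - 1) = m" using m by simp
  have snoc: "x @ [r] \<in> words A m \<longleftrightarrow> x \<in> words A (m - 1) \<and> r \<in> A" for x r and A :: "nat set"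
    using snoc_in_words[of x r A "m - 1"] m' by simp
  have ins: "insert_at a r x \<in> words {..<d} m" if "x \<in> words {..<d} (m - 1)" "r < d" "a < m" for x r a
    using insert_at_in_words[OF that(1), of r a] m' that by simp
  have enc_lt: "enc d (x @ [r]) < d ^ m" if "x \<in> words {..<d} (m - 1)" "r < d" for x r
    using that by (intro enc_less) (auto simp: snoc)
  have L': "(\<lambda>\<nu>. R' (\<rho> \<nu>) is (enc d x) (enc d y)) \<longlonglongrightarrow> L' is (enc d x) (enc d y)"
    if "is \<in> words {..<n} (m - 1)" "x \<in> words {..<d} (m - 1)" "y \<in> words {..<d} (m - 1)" for "is" x y
  proof -
    have "(\<lambda>\<nu>. R' (\<rho> \<nu>) is (enc d x) (enc d y)) = (\<lambda>\<nu>. \<Sum>i<n. R (\<rho> \<nu>) (is @ [i]) (enc d (x @ [0])) (enc d (y @ [0])))"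
      using hierarchy_marginal[OF entries that d d] by simp
    moreover have "(\<lambda>\<nu>. \<Sum>i<n. R (\<rho> \<nu>) (is @ [i]) (enc d (x @ [0])) (enc d (y @ [0]))) \<longlonglongrightarrow>
        (\<Sum>i<n. L (is @ [i]) (enc d (x @ [0])) (enc d (y @ [0])))"
      by (intro tendsto_sum L) (use that d enc_lt in \<open>auto simp: snoc simp del: enc_snoc\<close>)
    ultimately show ?thesis by (simp add: L'_def)
  qed
  have "hierarchy_entries d n m M t0 L L'"
    unfolding hierarchy_entries_def
  proof (intro conjI ballI allI impI; (elim conjE)?)
    fix "is" assume "is \<in> words {..<n} m"
    then show "psdf (d ^ m) (L is)"
      by (intro psdf_limit[of _ "\<lambda>\<nu>. R (\<rho> \<nu>) is" "L is"] psd L)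
  next
    fix "is" assume "is": "is \<in> words {..<n} (m - 1)"
    show "psdf (d ^ (m - 1)) (L' is)"
    proof (rule psdf_limit[of _ "\<lambda>\<nu>. R' (\<rho> \<nu>) is" "L' is"])
      show "psdf (d ^ (m - 1)) (R' (\<rho> \<nu>) is)" for \<nu> by (rule hierarchy_psd'[OF entries "is"])
      show "(\<lambda>\<nu>. R' (\<rho> \<nu>) is x y) \<longlonglongrightarrow> L' is x y" if "x < d ^ (m - 1)" "y < d ^ (m - 1)" for x y
        using L'[OF "is" dec_in_words[OF d] dec_in_words[OF d], of x y] that by simp
    qed
  next
    fix j i x y assume *: "j < m" "i < n" "x < d ^ m" "y < d ^ m"
    have "(\<lambda>\<nu>. \<Sum>is | is \<in> words {..<n} m \<and> is ! j = i. R (\<rho> \<nu>) is x y) \<longlonglongrightarrow>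
        (\<Sum>is | is \<in> words {..<n} m \<and> is ! j = i. L is x y)"
      by (intro tendsto_sum L) (use * in auto)
    moreover have "(\<lambda>\<nu>. at_factor d m j (depolarise d (t (\<rho> \<nu>)) (M i)) $$ (x, y)) \<longlonglongrightarrow>
        at_factor d m j (depolarise d t0 (M i)) $$ (x, y)"
      using tendsto_at_factor_depolarise[OF d *(1) M[OF *(2)] *(3,4)] LIMSEQ_subseq_LIMSEQ[OF t \<rho>(1)]
      by (simp add: o_def)
    ultimately show "(\<Sum>is | is \<in> words {..<n} m \<and> is ! j = i. L is x y) =
        at_factor d m j (depolarise d t0 (M i)) $$ (x, y)"
      unfolding hierarchy_factor[OF entries *] by (rule LIMSEQ_unique)
  next
    fix "is" a b x y
    assume *: "is \<in> words {..<n} m" "a < b" "b < m" "is ! a \<noteq> is ! b"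
      "x \<in> words {..<d} (m - 1)" "y \<in> words {..<d} (m - 1)"
    have "(\<lambda>\<nu>. \<Sum>r<d. R (\<rho> \<nu>) is (enc d (swap_list a b (insert_at a r x))) (enc d (insert_at a r y))) \<longlonglongrightarrow>
        (\<Sum>r<d. L is (enc d (swap_list a b (insert_at a r x))) (enc d (insert_at a r y)))"
      by (intro tendsto_sum L enc_less swap_list_in_words ins) (use * in auto)
    then show "(\<Sum>r<d. L is (enc d (swap_list a b (insert_at a r x))) (enc d (insert_at a r y))) = 0"
      unfolding hierarchy_orthogonal[OF entries *] by (simp add: LIMSEQ_const_iff)
  next
    fix "is" a b x y
    assume *: "is \<in> words {..<n} m" "a < b" "b < m" "x \<in> words {..<d} m" "y \<in> words {..<d} m"
    have "(\<lambda>\<nu>. R (\<rho> \<nu>) is (enc d (swap_list a b x)) (enc d (swap_list a b y))) \<longlonglongrightarrow>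
        L is (enc d (swap_list a b x)) (enc d (swap_list a b y))"
      by (intro L enc_less swap_list_in_words) (use * in auto)
    moreover have "(\<lambda>\<nu>. R (\<rho> \<nu>) (swap_list a b is) (enc d x) (enc d y)) \<longlonglongrightarrow>
        L (swap_list a b is) (enc d x) (enc d y)"
      by (intro L enc_less swap_list_in_words) (use * in auto)
    ultimately show "L is (enc d (swap_list a b x)) (enc d (swap_list a b y)) = L (swap_list a b is) (enc d x) (enc d y)"
      unfolding hierarchy_swap[OF entries *] by (rule LIMSEQ_unique)
  next
    fix "is" x y r s
    assume *: "is \<in> words {..<n} (m - 1)" "x \<in> words {..<d} (m - 1)" "y \<in> words {..<d} (m - 1)" "r < d" "s < d"
    have "(\<lambda>\<nu>. \<Sum>i<n. R (\<rho> \<nu>) (is @ [i]) (enc d (x @ [r])) (enc d (y @ [s]))) \<longlonglongrightarrow>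
        (\<Sum>i<n. L (is @ [i]) (enc d (x @ [r])) (enc d (y @ [s])))"
      by (intro tendsto_sum L) (use * enc_lt in \<open>auto simp: snoc simp del: enc_snoc\<close>)
    moreover have "(\<lambda>\<nu>. if r = s then R' (\<rho> \<nu>) is (enc d x) (enc d y) else 0) \<longlonglongrightarrow>
        (if r = s then L' is (enc d x) (enc d y) else 0)"
      using L'[OF *(1-3)] by simp
    ultimately show "(\<Sum>i<n. L (is @ [i]) (enc d (x @ [r])) (enc d (y @ [s]))) =
        (if r = s then L' is (enc d x) (enc d y) else 0)"
      unfolding hierarchy_marginal[OF entries *] by (rule LIMSEQ_unique)
  qed
  then show ?thesis by blast
qed

lemma psdf_scalar:
  assumes "0 \<le> c" shows "psdf N (\<lambda>x y. if x = y then c else 0)"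
  unfolding psdf_def
proof
  fix u
  have "ip N u (app N (\<lambda>x y. if x = y then c else 0) u) = (\<Sum>r<N. \<Sum>s<N. if r = s then c * (cnj (u r) * u s) else 0)"
    unfolding ip_app by (intro sum.cong refl) auto
  also have "\<dots> = c * ip N u u"
    by (simp add: ip_def sum_distrib_left)
  finally show "0 \<le> ip N u (app N (\<lambda>x y. if x = y then c else 0) u)"
    using assms by (simp add: ip_self less_eq_complex_def sum_nonneg)
qed

lemma set_swap_list: "a < length x \<Longrightarrow> b < length x \<Longrightarrow> set (swap_list a b x) = set x"
  unfolding swap_list_def by (rule set_swap)

lemma hierarchy_entries_0:
  assumes d: "0 < d" and m: "2 \<le> m" and M: "\<And>i. i < n \<Longrightarrow> psd d (M i)"
  shows "\<exists>R R'. hierarchy_entries d n m M 0 R R'"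
proof -
  define c where "c = (\<lambda>i. mat_trace (M i) / of_nat d)"
  \<comment> \<open>The test \<open>set is \<subseteq> {hd is}\<close> singles out constant words.
    The same \<open>W\<close> serves for both families, at lengths \<open>m\<close> and
    \<open>m - 1\<close>; \<open>m \<ge> 2\<close> keeps the shorter words nonempty, so that
    \<open>hd\<close> is meaningful.\<close>
  define W where "W = (\<lambda>(is :: nat list) (x :: nat) y. if set is \<subseteq> {hd is} \<and> x = y then c (hd is) else 0)"
  have c: "0 \<le> c i" if "i < n" for i
  proof -
    have "M i \<in> carrier_mat d d" "\<And>k. k < d \<Longrightarrow> 0 \<le> M i $$ (k, k)"
      using M[OF that] psdf_diag unfolding psd_iff_psdf by blast+
    then have "0 \<le> mat_trace (M i)" by (auto simp: mat_trace_def intro!: sum_nonneg)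
    then show ?thesis using d by (simp add: c_def less_eq_complex_def)
  qed
  have psd: "psdf N (W is)" if "is \<in> words {..<n} k" "0 < k" for N k "is"
  proof -
    have "hd is < n" using hd_word[OF that] by simp
    then show ?thesis
      using psdf_scalar[OF c, of "hd is" N] psdf_scalar[of 0 N] by (cases "set is \<subseteq> {hd is}") (simp_all add: W_def)
  qed
  have m': "Suc (m - 1) = m" "0 < m - 1" using m by auto
  have "hierarchy_entries d n m M 0 W W"
    unfolding hierarchy_entries_def
  proof (intro conjI ballI allI impI; (elim conjE)?)
    fix "is" assume "is \<in> words {..<n} m"
    then show "psdf (d ^ m) (W is)" using psd m by simp
  next
    fix "is" assume "is \<in> words {..<n} (m - 1)"
    then show "psdf (d ^ (m - 1)) (W is)" using psd m' by simp
  next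
    fix j i x y assume *: "j < m" "i < n" "x < d ^ m" "y < d ^ m"
    have const: "is = replicate m i" if "is \<in> words {..<n} m" "is ! j = i" "set is \<subseteq> {hd is}" for "is"
    proof -
      have "i \<in> set is" using that * by (auto simp: words_def)
      then have "hd is = i" using subsetD[OF that(3)] by simp
      then have "set is \<subseteq> {i}" using that(3) by simp
      then show ?thesis using words_length[OF that(1)] by (intro replicate_eqI) auto
    qed
    have "(\<Sum>is | is \<in> words {..<n} m \<and> is ! j = i. W is x y) = (\<Sum>is\<in>{replicate m i}. W is x y)"
    proof (intro sum.mono_neutral_right ballI)
      show "finite {is. is \<in> words {..<n} m \<and> is ! j = i}" by simp
      show "{replicate m i} \<subseteq> {is. is \<in> words {..<n} m \<and> is ! j = i}" using * by (auto simp: words_def)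
      fix "is" assume "is \<in> {is. is \<in> words {..<n} m \<and> is ! j = i} - {replicate m i}"
      then have "\<not> set is \<subseteq> {hd is}" using const by blast
      then show "W is x y = 0" by (simp add: W_def)
    qed
    also have "\<dots> = (if x = y then c i else 0)" using m by (auto simp: W_def)
    also have "\<dots> = at_factor d m j (depolarise d 0 (M i)) $$ (x, y)"
    proof -
      have Mi: "M i \<in> carrier_mat d d" using M[OF *(2)] by (simp add: psd_def)
      define q where "q = d ^ (m - 1 - j)"
      have "x = y \<longleftrightarrow> x div q div d = y div q div d \<and> x div q mod d = y div q mod d \<and> x mod q = y mod q"
        by (metis div_mult_mod_eq)
      then show ?thesis
        using d unfolding at_factor_entry[OF d *(1) depolarise_carrier[OF Mi] *(3,4)] q_def
        by (simp add: depolarise_entry[OF Mi] c_def)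
    qed
    finally show "(\<Sum>is | is \<in> words {..<n} m \<and> is ! j = i. W is x y) = at_factor d m j (depolarise d 0 (M i)) $$ (x, y)" .
  next
    fix "is" a b x y
    assume *: "is \<in> words {..<n} m" "a < b" "b < m" "is ! a \<noteq> is ! b"
    have "is ! a \<in> set is" "is ! b \<in> set is" using * by (auto simp: words_def)
    then have "\<not> set is \<subseteq> {hd is}"
      using *(4) by (metis singletonD subsetD)
    then show "(\<Sum>r<d. W is (enc d (swap_list a b (insert_at a r x))) (enc d (insert_at a r y))) = 0"
      by (simp add: W_def)
  next
    fix "is" a b x y
    assume *: "is \<in> words {..<n} m" "a < b" "b < m" "x \<in> words {..<d} m" "y \<in> words {..<d} m"
    have "set (swap_list a b is) = set is" using * by (intro set_swap_list) (auto simp: words_def)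
    moreover have "hd is \<in> set is" "hd (swap_list a b is) \<in> set (swap_list a b is)"
      using hd_word[of "is" "set is" m] hd_word[of "swap_list a b is" "set (swap_list a b is)" m] *
      by (auto simp: words_def swap_list_def)
    ultimately have "set (swap_list a b is) \<subseteq> {hd (swap_list a b is)} \<longleftrightarrow> set is \<subseteq> {hd is}"
      "set is \<subseteq> {hd is} \<Longrightarrow> hd (swap_list a b is) = hd is"
      by (auto dest!: subset_singletonD)
    moreover have "swap_list a b x = swap_list a b y \<longleftrightarrow> x = y"
      using * by (metis swap_list_involution words_length less_trans)
    then have "enc d (swap_list a b x) = enc d (swap_list a b y) \<longleftrightarrow> enc d x = enc d y"
      using * by (simp add: enc_eq_iff[of _ _ m] swap_list_in_words)
    ultimately show "W is (enc d (swap_list a b x)) (enc d (swap_list a b y)) = W (swap_list a b is) (enc d x) (enc d y)"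
      by (simp add: W_def)
  next
    fix "is" x y r s
    assume *: "is \<in> words {..<n} (m - 1)" "x \<in> words {..<d} (m - 1)" "y \<in> words {..<d} (m - 1)" "r < d" "s < d"
    have "is \<noteq> []" using *(1) m' by (auto simp: words_def)
    have hd: "hd is < n" using hd_word[OF *(1) m'(2)] by simp
    have "x @ [r] \<in> words {..<d} (Suc (m - 1))" "y @ [s] \<in> words {..<d} (Suc (m - 1))" using * by auto
    from enc_eq_iff[OF this] have eq: "enc d (x @ [r]) = enc d (y @ [s]) \<longleftrightarrow> r = s \<and> enc d x = enc d y"
      using enc_eq_iff[OF *(2,3)] by auto
    have "(\<Sum>i<n. W (is @ [i]) (enc d (x @ [r])) (enc d (y @ [s]))) =
        (\<Sum>i<n. if i = hd is then (if r = s then W is (enc d x) (enc d y) else 0) else 0)"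
      using \<open>is \<noteq> []\<close> unfolding W_def eq by (intro sum.cong refl) auto
    then show "(\<Sum>i<n. W (is @ [i]) (enc d (x @ [r])) (enc d (y @ [s]))) = (if r = s then W is (enc d x) (enc d y) else 0)"
      using hd by simp
  qed
  then show ?thesis by blast
qed

text \<open>The feasible parameters form a compact set containing \<open>0\<close>, so the greatest
  one exists and is itself feasible; hence it differs from \<open>1\<close>.\<close>

lemma hierarchy_value_less_1:
  assumes d: "0 < d" and m: "2 \<le> m" and M: "\<And>i. i < n \<Longrightarrow> psd d (M i)"
    and not1: "\<not> hierarchy_feasible d n m M 1"
  shows "hierarchy_value d n m M < 1"
proof -
  have m0: "0 < m" and carrier: "\<And>i. i < n \<Longrightarrow> M i \<in> carrier_mat d d" using m M by (auto simp: psd_def)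
  have feasible_iff: "hierarchy_feasible d n m M t \<longleftrightarrow> (\<exists>R R'. hierarchy_entries d n m M t R R')" for t
    by (rule hierarchy_feasible_iff[OF d m0]) (rule carrier)
  define T where "T = {t. 0 \<le> t \<and> t \<le> 1 \<and> hierarchy_feasible d n m M t}"
  have "closed T"
    unfolding closed_sequential_limits
  proof (intro allI impI, elim conjE)
    fix t t0 assume t: "\<forall>\<nu>. t \<nu> \<in> T" "t \<longlonglongrightarrow> t0"
    then have "\<forall>\<nu>. \<exists>R R'. hierarchy_entries d n m M (t \<nu>) R R'" by (simp add: T_def feasible_iff)
    then obtain R R' where R: "\<And>\<nu>. hierarchy_entries d n m M (t \<nu>) (R \<nu>) (R' \<nu>)" by metis
    have "hierarchy_feasible d n m M t0"
      unfolding feasible_iff by (rule hierarchy_entries_limit[OF d m0 _ R t(2)]) (rule carrier)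
    moreover have "0 \<le> t0" by (rule LIMSEQ_le_const[OF t(2)]) (use t in \<open>auto simp: T_def\<close>)
    moreover have "t0 \<le> 1" by (rule LIMSEQ_le_const2[OF t(2)]) (use t in \<open>auto simp: T_def\<close>)
    ultimately show "t0 \<in> T" by (simp add: T_def)
  qed
  moreover have "bounded T" by (rule boundedI[of _ 1]) (auto simp: T_def)
  ultimately have "compact T" by (simp add: compact_eq_bounded_closed)
  moreover have "0 \<in> T"
    using hierarchy_entries_0[OF d m M] by (simp add: T_def feasible_iff)
  ultimately obtain t where t: "t \<in> T" "\<And>s. s \<in> T \<Longrightarrow> s \<le> t"
    using compact_attains_sup[of T] by blast
  have "hierarchy_value d n m M = t"
    unfolding hierarchy_value_def using t by (intro Greatest_equality) (auto simp: T_def)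
  moreover have "t \<noteq> 1" using t(1) not1 by (auto simp: T_def)
  ultimately show ?thesis using t(1) by (simp add: T_def)
qed

section \<open>The kernel of a feasible point\<close>

text \<open>The first \<open>m - length is\<close> factors are traced out. After summing over its outcome the operator is a
  multiple of the identity on such a factor, so the normalised trace can be read off at the single
  digit \<open>0\<close>; leading zeros do not change \<^const>\<open>enc\<close>.\<close>

definition hierarchy_kernel ::
    "nat \<Rightarrow> nat \<Rightarrow> nat \<Rightarrow> (nat list \<Rightarrow> nat \<Rightarrow> nat \<Rightarrow> complex) \<Rightarrow> nat list \<Rightarrow> nat list \<Rightarrow> nat list \<Rightarrow> complex" where
  "hierarchy_kernel d n m R is x y = (\<Sum>js\<in>words {..<n} (m - length is). R (js @ is) (enc d x) (enc d y))"

lemma replicate_in_words [simp]: "0 < d \<Longrightarrow> replicate k 0 \<in> words {..<d::nat} k"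
  by (auto simp: words_def)

text \<open>Condition (5) concerns the last position only. Condition (4) exchanges position
  \<open>p\<close> with the last one, (5) is applied there, and exchanging back with digits
  \<open>0\<close> expresses the result by the operators themselves.\<close>

lemma hierarchy_marginal_at:
  assumes d: "0 < d" and entries: "hierarchy_entries d n m M t R R'"
    and m: "m = Suc (p + k)" and js: "js \<in> words {..<n} p" and "is": "is \<in> words {..<n} k"
    and x: "x \<in> words {..<d} k" and y: "y \<in> words {..<d} k" and rs: "r < d" "s < d"
  shows "(\<Sum>i<n. R (js @ i # is) (enc d (r # x)) (enc d (s # y))) =
    (if r = s then \<Sum>i<n. R (js @ i # is) (enc d x) (enc d y) else 0)"
proof -
  \<comment> \<open>Leading zeros lengthen the words to \<open>m\<close> digits, as the conditions
    of the hierarchy demand, without changing the encoded index.\<close>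
  define o' where "o' = replicate p (0::nat)"
  have o': "o' \<in> words {..<d} p" using d by (simp add: o'_def)
  have pad: "enc d (o' @ z) = enc d z" for z by (simp add: o'_def)
  have "(\<Sum>i<n. R (js @ i # is) (enc d (o' @ r # x)) (enc d (o' @ s # y))) =
      (if r = s then \<Sum>i<n. R (js @ i # is) (enc d (o' @ 0 # x)) (enc d (o' @ 0 # y)) else 0)"
  \<comment> \<open>For \<open>k = 0\<close> position \<open>p\<close> is already the last one and
    no exchange takes place.\<close>
  proof (cases k)
    case 0
    then have "is = []" "x = []" "y = []" using "is" x y by simp_all
    then show ?thesis
      using hierarchy_marginal[OF entries, of js o' o'] js o' d rs 0 m by (simp del: enc_snoc)
  next
    case (Suc k')
    obtain is' l where is': "is = is' @ [l]" "is' \<in> words {..<n} k'" "l < n"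
      using words_Suc_snocE "is" Suc by blast
    obtain x' a where x': "x = x' @ [a]" "x' \<in> words {..<d} k'" "a < d"
      using words_Suc_snocE x Suc by blast
    obtain y' b where y': "y = y' @ [b]" "y' \<in> words {..<d} k'" "b < d"
      using words_Suc_snocE y Suc by blast
    have last: "swap_list p (m - 1) (z @ i # w @ [j]) = z @ j # w @ [i]"
      if "length z = p" "length w = k'" for z w :: "nat list" and i j
      using that m Suc by (intro swap_list_last) auto
    have len: "length js = p" "length o' = p" "length is' = k'" "length x' = k'" "length y' = k'"
      using js o' is' x' y' by (auto simp: words_length)
    have in_words: "u @ v # w @ [v'] \<in> words A m"
      if "u \<in> words A p" "v \<in> A" "w \<in> words A k'" "v' \<in> A" for u v w v' and A :: "nat set"
      using that m Suc by (auto simp: words_def)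
    have swapped: "R (js @ i # is' @ [l]) (enc d (o' @ r # x' @ [a])) (enc d (o' @ s # y' @ [b])) =
        R ((js @ l # is') @ [i]) (enc d ((o' @ a # x') @ [r])) (enc d ((o' @ b # y') @ [s]))"
      if "i < n" "r < d" "s < d" for i r s
    proof -
      have "R (swap_list p (m - 1) (js @ l # is' @ [i])) (enc d (o' @ r # x' @ [a])) (enc d (o' @ s # y' @ [b])) =
          R (js @ l # is' @ [i]) (enc d (swap_list p (m - 1) (o' @ r # x' @ [a]))) (enc d (swap_list p (m - 1) (o' @ s # y' @ [b])))"
        using that is' x' y' js o' m Suc by (intro hierarchy_swap[OF entries, symmetric] in_words) auto
      then show ?thesis by (simp only: last len append_assoc append_Cons)
    qed
    have "(\<Sum>i<n. R ((js @ l # is') @ [i]) (enc d ((o' @ a # x') @ [r])) (enc d ((o' @ b # y') @ [s]))) =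
        (if r = s then R' (js @ l # is') (enc d (o' @ a # x')) (enc d (o' @ b # y')) else 0)"
      if "r < d" "s < d" for r s
      using that js is' o' x' y' m Suc by (intro hierarchy_marginal[OF entries]) (auto simp: words_def)
    \<comment> \<open>Used at the given digits and at \<open>0\<close>, \<open>0\<close>: both have
      the same \<open>R'\<close> on the right, which is thereby eliminated.\<close>
    note marg = this[OF rs] this[OF d d]
    have "(\<Sum>i<n. R (js @ i # is' @ [l]) (enc d (o' @ r # x' @ [a])) (enc d (o' @ s # y' @ [b]))) =
        (\<Sum>i<n. R ((js @ l # is') @ [i]) (enc d ((o' @ a # x') @ [r])) (enc d ((o' @ b # y') @ [s])))"
      by (intro sum.cong refl swapped rs) auto
    moreover have "(\<Sum>i<n. R (js @ i # is' @ [l]) (enc d (o' @ 0 # x' @ [a])) (enc d (o' @ 0 # y' @ [b]))) =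
        (\<Sum>i<n. R ((js @ l # is') @ [i]) (enc d ((o' @ a # x') @ [0])) (enc d ((o' @ b # y') @ [0])))"
      by (intro sum.cong refl swapped d) auto
    ultimately show ?thesis unfolding is'(1) x'(1) y'(1) marg by (simp only: if_True refl)
  qed
  then show ?thesis unfolding pad by simp
qed

lemma exchangeable_kernel_hierarchy:
  assumes d: "0 < d" and m: "2 \<le> m" and M: "povm d n M" and entries: "hierarchy_entries d n m M 1 R R'"
  shows "exchangeable_kernel d n m (hierarchy_kernel d n m R)"
    and "\<And>i r s. i < n \<Longrightarrow> r < d \<Longrightarrow> s < d \<Longrightarrow> hierarchy_kernel d n m R [i] [r] [s] = M i $$ (r, s)"
proof -
  have M_carrier: "M i \<in> carrier_mat d d" if "i < n" for i using M that by (simp add: povm_def psd_def)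
  show single: "hierarchy_kernel d n m R [i] [r] [s] = M i $$ (r, s)" if irs: "i < n" "r < d" "s < d" for i r s
  proof -
    have m': "Suc (m - 1) = m" "m - 1 < m" using m by auto
    have "d ^ 1 \<le> d ^ m" using d m by (intro power_increasing) auto
    then have lt: "r < d ^ m" "s < d ^ m" using irs by auto
    have "{is. is \<in> words {..<n} m \<and> is ! (m - 1) = i} = (\<lambda>js. js @ [i]) ` words {..<n} (m - 1)"
    proof (intro equalityI subsetI)
      fix "is" assume "is \<in> {is. is \<in> words {..<n} m \<and> is ! (m - 1) = i}"
      then have "is \<in> words {..<n} (Suc (m - 1))" "is ! (m - 1) = i" using m' by auto
      then show "is \<in> (\<lambda>js. js @ [i]) ` words {..<n} (m - 1)"
        by (elim words_Suc_snocE) (auto simp: words_length nth_append)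
    qed (use irs m' in \<open>auto simp: words_def nth_append\<close>)
    then have "(\<Sum>is | is \<in> words {..<n} m \<and> is ! (m - 1) = i. R is r s) =
        (\<Sum>js\<in>words {..<n} (m - 1). R (js @ [i]) r s)"
      by (simp add: sum.reindex inj_on_def)
    then show ?thesis
      using hierarchy_factor[OF entries m'(2) irs(1) lt] at_factor_last_entry[OF d _ M_carrier[OF irs(1)] irs(2,3), of m] m
      by (simp add: hierarchy_kernel_def depolarise_1[OF M_carrier[OF irs(1)]])
  qed
  have marginal: "(\<Sum>i<n. hierarchy_kernel d n m R (i # is) (r # x) (s # y)) =
      (if r = s then hierarchy_kernel d n m R is x y else 0)"
    if k: "k < m" "is \<in> words {..<n} k" "x \<in> words {..<d} k" "y \<in> words {..<d} k" "r < d" "s < d" for k "is" x y r s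
  proof -
    define p where "p = m - Suc k"
    have p: "m = Suc (p + k)" using k by (simp add: p_def)
    have len: "length is = k" using k by (simp add: words_length)
    have "(\<Sum>i<n. hierarchy_kernel d n m R (i # is) (r # x) (s # y)) =
        (\<Sum>js\<in>words {..<n} p. \<Sum>i<n. R (js @ i # is) (enc d (r # x)) (enc d (s # y)))"
      unfolding hierarchy_kernel_def using p len by (subst sum.swap) simp
    also have "\<dots> = (\<Sum>js\<in>words {..<n} p. if r = s then \<Sum>i<n. R (js @ i # is) (enc d x) (enc d y) else 0)"
      by (intro sum.cong refl hierarchy_marginal_at[OF d entries p] k)
    \<comment> \<open>The outcome summed over joins the prefix: \<open>js @ [i]\<close> runs through
      the words of length \<open>Suc p\<close>, the prefix length that belongs to
      \<open>is\<close>.\<close>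
    also have "\<dots> = (if r = s then \<Sum>js\<in>words {..<n} (Suc p). R (js @ is) (enc d x) (enc d y) else 0)"
      by (simp add: sum_words_snoc)
    also have "Suc p = m - length is" using p len by simp
    finally show ?thesis by (simp only: hierarchy_kernel_def)
  qed
  show "exchangeable_kernel d n m (hierarchy_kernel d n m R)"
  proof
    show "0 < d" by (rule d)
  next
    fix k "is" and u :: "nat list \<Rightarrow> complex"
    assume k: "k \<le> m" "is \<in> words {..<n} k"
    let ?W = "words {..<d} k"
    \<comment> \<open>Extension of \<open>u\<close> by zero: the kernel is a sum of principal
      submatrices of positive semidefinite operators.\<close>
    define v where "v = (\<lambda>z. if z < d ^ k then u (dec d k z) else 0)"
    have sub: "d ^ k \<le> d ^ m" using d k by (intro power_increasing) auto
    have "(\<Sum>x\<in>?W. \<Sum>y\<in>?W. cnj (u x) * R (js @ is) (enc d x) (enc d y) * u y) =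
        ip (d ^ m) v (app (d ^ m) (R (js @ is)) v)" for js
    proof -
      have "ip (d ^ m) v (app (d ^ m) (R (js @ is)) v) =
          (\<Sum>x<d ^ k. \<Sum>y<d ^ m. cnj (v x) * R (js @ is) x y * v y)"
        unfolding ip_app using sub by (intro sum.mono_neutral_right) (auto simp: v_def)
      also have "\<dots> = (\<Sum>x<d ^ k. \<Sum>y<d ^ k. cnj (v x) * R (js @ is) x y * v y)"
        using sub by (intro sum.cong refl sum.mono_neutral_right) (auto simp: v_def)
      also have "\<dots> = (\<Sum>x\<in>?W. \<Sum>y\<in>?W. cnj (u x) * R (js @ is) (enc d x) (enc d y) * u y)"
        unfolding sum_enc[OF d] by (intro sum.cong refl) (simp add: v_def enc_less)
      finally show ?thesis by simp
    qed
    then have "(\<Sum>x\<in>?W. \<Sum>y\<in>?W. cnj (u x) * hierarchy_kernel d n m R is x y * u y) =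
        (\<Sum>js\<in>words {..<n} (m - k). ip (d ^ m) v (app (d ^ m) (R (js @ is)) v))"
      unfolding hierarchy_kernel_def words_length[OF k(2)] sum_distrib_left sum_distrib_right
      by (subst sum.swap[of _ "words {..<n} (m - k)"], subst sum.swap[of _ "words {..<n} (m - k)"]) simp
    also have "0 \<le> \<dots>"
    proof (rule sum_nonneg)
      fix js assume "js \<in> words {..<n} (m - k)"
      then have "js @ is \<in> words {..<n} m" using append_in_words[OF _ k(2), of js "m - k"] k by simp
      then show "0 \<le> ip (d ^ m) v (app (d ^ m) (R (js @ is)) v)"
        using hierarchy_psd[OF entries] by (simp add: psdf_def)
    qed
    finally show "0 \<le> (\<Sum>x\<in>?W. \<Sum>y\<in>?W. cnj (u x) * hierarchy_kernel d n m R is x y * u y)" .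
  next
    fix k "is" x y i j r r' s s'
    assume k: "k + 2 \<le> m" "is \<in> words {..<n} k" "x \<in> words {..<d} k" "y \<in> words {..<d} k"
      and ij: "i < n" "j < n" and rs: "r < d" "r' < d" "s < d" "s' < d"
    define p where "p = m - k - 2"
    have p: "m = p + k + 2" using k by (simp add: p_def)
    have in_words: "w @ a # b # z \<in> words A m" if "w \<in> words A p" "a \<in> A" "b \<in> A" "z \<in> words A k" for w a b z and A :: "nat set"
      using that p by (auto simp: words_def)
    define o' where "o' = replicate p (0::nat)"
    have o': "o' \<in> words {..<d} p" "length o' = p" using d by (simp_all add: o'_def)
    have pad: "enc d (o' @ z) = enc d z" for z by (simp add: o'_def)
    have "R (js @ i # j # is) (enc d (o' @ r # r' # x)) (enc d (o' @ s # s' # y)) =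
        R (js @ j # i # is) (enc d (o' @ r' # r # x)) (enc d (o' @ s' # s # y))"
      if "js \<in> words {..<n} p" for js
    proof -
      have "R (js @ j # i # is) (enc d (swap_list p (Suc p) (o' @ r # r' # x))) (enc d (swap_list p (Suc p) (o' @ s # s' # y))) =
          R (swap_list p (Suc p) (js @ j # i # is)) (enc d (o' @ r # r' # x)) (enc d (o' @ s # s' # y))"
        using that ij rs k o' p by (intro hierarchy_swap[OF entries] in_words) auto
      then show ?thesis using that o' by (simp add: swap_list_append words_length)
    qed
    then show "hierarchy_kernel d n m R (i # j # is) (r # r' # x) (s # s' # y) =
        hierarchy_kernel d n m R (j # i # is) (r' # r # x) (s' # s # y)"
      using p by (simp add: hierarchy_kernel_def words_length[OF k(2)] pad)
  next
    fix k "is" x y r s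
    assume "k < m" "is \<in> words {..<n} k" "x \<in> words {..<d} k" "y \<in> words {..<d} k" "r < d" "s < d"
    then show "(\<Sum>i<n. hierarchy_kernel d n m R (i # is) (r # x) (s # y)) =
        (if r = s then hierarchy_kernel d n m R is x y else 0)" by (rule marginal)
  next
    fix k "is" x y i j s s'
    assume k: "k + 2 \<le> m" "is \<in> words {..<n} k" "x \<in> words {..<d} k" "y \<in> words {..<d} k"
      and ij: "i < n" "j < n" "i \<noteq> j" and s: "s < d" "s' < d"
    define p where "p = m - k - 2"
    have p: "m = p + k + 2" using k by (simp add: p_def)
    define o' where "o' = replicate p (0::nat)"
    have o': "o' \<in> words {..<d} p" "length o' = p" using d by (simp_all add: o'_def)
    have pad: "enc d (o' @ z) = enc d z" for z by (simp add: o'_def)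
    have "(\<Sum>r<d. R (js @ i # j # is) (enc d (o' @ s # r # x)) (enc d (o' @ r # s' # y))) = 0"
      if js: "js \<in> words {..<n} p" for js
    proof -
      have "js @ i # j # is \<in> words {..<n} m" using js ij k p by (auto simp: words_def)
      moreover have "(js @ i # j # is) ! p \<noteq> (js @ i # j # is) ! Suc p"
        using ij js by (auto simp: nth_append words_length)
      moreover have "o' @ s # x \<in> words {..<d} (m - 1)" "o' @ s' # y \<in> words {..<d} (m - 1)"
        using o' s k p by (auto simp: words_def)
      ultimately have "(\<Sum>r<d. R (js @ i # j # is) (enc d (swap_list p (Suc p) (insert_at p r (o' @ s # x))))
          (enc d (insert_at p r (o' @ s' # y)))) = 0"
        using p by (intro hierarchy_orthogonal[OF entries]) auto
      then show ?thesis using o' by (simp add: insert_at_append swap_list_append)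
    qed
    then show "(\<Sum>r<d. hierarchy_kernel d n m R (i # j # is) (s # r # x) (r # s' # y)) = 0"
      using p unfolding hierarchy_kernel_def pad by (subst sum.swap) (simp add: words_length[OF k(2)])
  next
    \<comment> \<open>The normalisation is read off at a single diagonal entry, where the effects of
      \<open>M\<close> add up to \<open>1\<close>.\<close>
    have "hierarchy_kernel d n m R [] [] [] = (\<Sum>i<n. hierarchy_kernel d n m R [i] [0] [0])"
      using marginal[of 0 "[]" "[]" "[]" 0 0] d m by simp
    also have "\<dots> = (\<Sum>i<n. M i $$ (0, 0))" using single d by (intro sum.cong) auto
    also have "\<dots> = msum d M {..<n} $$ (0, 0)" using d by (simp add: msum_def)
    also have "\<dots> = 1" using M d by (simp add: povm_def)
    finally show "hierarchy_kernel d n m R [] [] [] = 1" .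
  qed
qed

theorem theorem2:
  fixes d n :: nat and M :: "nat \<Rightarrow> complex mat"
  assumes "1 \<le> d" and "1 \<le> n"
    and "povm d n M"
    and "\<not> simulable d n M"
  shows "\<exists>m0\<ge>2. \<forall>m\<ge>m0. hierarchy_value d n m M < 1"
proof (rule ccontr)
  assume neg: "\<not> ?thesis"
  have d: "0 < d" using assms by simp
  have psd: "psd d (M i)" if "i < n" for i using assms(3) that by (simp add: povm_def)
  then have carrier: "M i \<in> carrier_mat d d" if "i < n" for i using that by (simp add: psd_def)
  define D where "D = (2 * real d ^ 2)\<^sup>2"
  define a where "a = 4 * real n * real d ^ 2"
  have pos: "0 < D" "0 < a" using assms by (simp_all add: D_def a_def)
  have "simulable d n M"
  proof (rule simulable_if_approximable)
    show "M i \<in> carrier_mat d d" if "i < n" for i using carrier that .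
  next
    fix \<epsilon> :: real assume \<epsilon>: "0 < \<epsilon>"
    \<comment> \<open>Chosen so that \<open>D * (c * a)\<close> is half of \<epsilon>; the bound
      \<open>l\<close> below makes the other part at most the other half.\<close>
    define c where "c = \<epsilon> / (2 * D * a)"
    have c: "0 < c" using \<epsilon> pos by (simp add: c_def)
    obtain l :: nat where l: "2 * D / (\<epsilon> * c) < real l" using reals_Archimedean2 by blast
    obtain m where m: "l + 2 \<le> m" "\<not> hierarchy_value d n m M < 1" using neg by (metis le_add2)
    have "2 \<le> m" "0 < m" "real l \<le> real (m - 1)" using m by auto
    have "hierarchy_feasible d n m M 1"
      using hierarchy_value_less_1[OF d \<open>2 \<le> m\<close>, of n M] psd m(2) by blast
    then obtain R R' where entries: "hierarchy_entries d n m M 1 R R'"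
      using hierarchy_feasible_iff[OF d \<open>0 < m\<close>, of n M] carrier by blast
    interpret exchangeable_kernel d n m "hierarchy_kernel d n m R"
      by (rule exchangeable_kernel_hierarchy(1)[OF d \<open>2 \<le> m\<close> assms(3) entries])
    have small: "D * (c * a + 1 / (c * real (m - 1))) \<le> \<epsilon>"
    proof -
      have "2 * D / (\<epsilon> * c) < real (m - 1)" using l \<open>real l \<le> real (m - 1)\<close> by linarith
      then have "2 * D < real (m - 1) * (\<epsilon> * c)" using \<epsilon> c by (simp add: divide_less_eq)
      moreover have "0 < real (m - 1)" using \<open>2 \<le> m\<close> by simp
      ultimately have half: "D / (c * real (m - 1)) \<le> \<epsilon> / 2"
        using c by (simp add: divide_le_eq mult_ac)
      have "D * (c * a + 1 / (c * real (m - 1))) = D * (c * a) + D / (c * real (m - 1))"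
        by (simp add: distrib_left)
      also have "D * (c * a) = \<epsilon> / 2" using pos by (simp add: c_def)
      also have "\<epsilon> / 2 + D / (c * real (m - 1)) \<le> \<epsilon> / 2 + \<epsilon> / 2"
        using half by (rule add_left_mono)
      finally show ?thesis by simp
    qed
    obtain I :: "letter list set" and p :: "letter list \<Rightarrow> real" and B where
      I: "finite I" "\<forall>z\<in>I. 0 \<le> p z \<and> povmf d n (B z)" "(\<Sum>z\<in>I. p z) = 1"
      "\<forall>i<n. \<forall>r<d. \<forall>s<d. hierarchy_kernel d n m R [i] [r] [s] = (\<Sum>z\<in>I. complex_of_real (p z) * B z i r s)"
      "(\<Sum>z\<in>I. p z * defect d n (B z)) \<le> D * (c * a + 1 / (c * real (m - 1)))"
      using mixture_of_small_defect[OF \<open>2 \<le> m\<close> c] unfolding D_def a_def by blast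
    have "\<forall>i<n. \<forall>r<d. \<forall>s<d. M i $$ (r, s) = (\<Sum>z\<in>I. complex_of_real (p z) * B z i r s)"
      using I(4) exchangeable_kernel_hierarchy(2)[OF d \<open>2 \<le> m\<close> assms(3) entries] by simp
    moreover have "(\<Sum>z\<in>I. p z * defect d n (B z)) \<le> \<epsilon>" using I(5) small by linarith
    ultimately show "\<exists>(I :: letter list set) (p :: letter list \<Rightarrow> real) (B :: letter list \<Rightarrow> nat \<Rightarrow> nat \<Rightarrow> nat \<Rightarrow> complex).
       finite I \<and> (\<forall>z\<in>I. 0 \<le> p z \<and> povmf d n (B z)) \<and> (\<Sum>z\<in>I. p z) = 1 \<and>
       (\<forall>i<n. \<forall>r<d. \<forall>s<d. M i $$ (r, s) = (\<Sum>z\<in>I. complex_of_real (p z) * B z i r s)) \<and>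
       (\<Sum>z\<in>I. p z * defect d n (B z)) \<le> \<epsilon>"
      using I(1-3) by blast
  qed
  with assms(4) show False by contradiction
qed

end
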